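(* Let $d\geq 1$, let $E,Z\subset \mathbb{R}^d$ and $T\subset \mathbb{R}_{>0}$ be non-empty Borel sets, and put $\Gamma=Z\times T$. Let $TE=\{rx: r\in T, x\in E\}$ and $\Gamma(E)=TE+Z=\{rx+z: x\in E, z\in Z, r\in T\}$. Then: (i) $\dim_{\mathcal F}(TE)\geq \dim_{\mathcal H}E+\dim_{\mathcal H}T-d$, and $\dim_{\mathcal S}\Gamma(E)\geq \dim_{\mathcal H}E+\dim_{\mathcal H}Z+\dim_{\mathcal H}T-d$. (ii) If $\dim_{\mathcal H}E+\dim_{\mathcal H}Z+\dim_{\mathcal H}T>2d$, then $\mathcal{L}^d(\Gamma(E))>0$. (iii) For $0<u<d$, if $\dim_{\mathcal H}E+\dim_{\mathcal H}Z+\dim_{\mathcal H}T>d+u$, then $\dim_{\mathcal H}\Gamma(E)\geq u$.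
   Context: $\mathcal{L}^d$ is Lebesgue measure on $\mathbb{R}^d$ and $\dim_{\mathcal H}$ is Hausdorff dimension. For $A\subset\mathbb{R}^d$, $\mathcal{M}(A)$ is the set of non-zero Radon measures on $\mathbb{R}^d$ with compact support contained in $A$. The Fourier transform is $\widehat{\mu}(\xi)=\int e^{-2\pi i\xi\cdot x}\,d\mu(x)$. The Fourier dimension of $A$ is $\dim_{\mathcal F}A=\sup\{s\leq d:\ \exists \mu\in\mathcal{M}(A),\ \exists C>0 \text{ with } |\widehat{\mu}(x)|\leq C(1+|x|)^{-s/2}\text{ for all }x\in\mathbb{R}^d\}$. The Sobolev dimension of $\mu\in\mathcal{M}(\mathbb{R}^d)$ is $\dim_{\mathcal S}\mu=\sup\{s\in\mathbb{R}: \int|\widehat{\mu}(x)|^2(1+|x|)^{s-d}\,dx<\infty\}$, and the Sobolev dimension of a set $A$ is $\dim_{\mathcal S}A=\sup\{\dim_{\mathcal S}\mu:\ \mu\in\mathcal{M}(A)\text{ a probability measure}\}$. *)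

theory Defs
  imports "HOL-Probability.Probability"
begin

(* The premise "bounded U" accompanies every use of the diameter, which carries no
   information for unbounded sets.  The gauge is diam(U)^s with the usual conventions
   0^0 = 1 for non-empty U and diam({})^s = 0; powr alone would give 0 powr 0 = 0. *)

definition hausdorff_gauge :: "real \<Rightarrow> 'a::metric_space set \<Rightarrow> ennreal" where
  "hausdorff_gauge s U =
     (if U = {} then 0 else if s = 0 then 1 else ennreal (diameter U powr s))"

definition hausdorff_premeasure :: "real \<Rightarrow> real \<Rightarrow> 'a::metric_space set \<Rightarrow> ennreal" where
  "hausdorff_premeasure s \<delta> A =
     (INF U\<in>{U :: nat \<Rightarrow> 'a set. A \<subseteq> (\<Union>i. U i) \<and> (\<forall>i. bounded (U i) \<and> diameter (U i) \<le> \<delta>)}.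
        \<Sum>i. hausdorff_gauge s (U i))"

definition hausdorff_measure :: "real \<Rightarrow> 'a::metric_space set \<Rightarrow> ennreal" where
  "hausdorff_measure s A = (SUP \<delta>\<in>{0<..}. hausdorff_premeasure s \<delta> A)"

definition hausdorff_dim :: "'a::metric_space set \<Rightarrow> ereal" where
  "hausdorff_dim A = Inf {ereal s | s. 0 \<le> s \<and> hausdorff_measure s A = 0}"

definition radon_measure :: "'a::euclidean_space measure \<Rightarrow> bool" where
  "radon_measure \<mu> \<longleftrightarrow>
     sets \<mu> = sets borel \<and>
     (\<forall>K. compact K \<longrightarrow> emeasure \<mu> K < \<infinity>) \<and>
     (\<forall>B\<in>sets borel. emeasure \<mu> B = (SUP K\<in>{K. K \<subseteq> B \<and> compact K}. emeasure \<mu> K))"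

definition measure_support :: "'a::euclidean_space measure \<Rightarrow> 'a set" where
  "measure_support \<mu> = {x. \<forall>U. open U \<and> x \<in> U \<longrightarrow> 0 < emeasure \<mu> U}"

definition compact_radon_measures :: "'a::euclidean_space set \<Rightarrow> 'a measure set" where
  "compact_radon_measures A =
     {\<mu>. radon_measure \<mu> \<and> emeasure \<mu> (space \<mu>) \<noteq> 0 \<and>
         compact (measure_support \<mu>) \<and> measure_support \<mu> \<subseteq> A}"

definition fourier_transform :: "'a::euclidean_space measure \<Rightarrow> 'a \<Rightarrow> complex" where
  "fourier_transform \<mu> \<xi> = (\<integral>x. exp (- 2 * of_real pi * \<i> * of_real (\<xi> \<bullet> x)) \<partial>\<mu>)"

(* All dimensions are extended reals: the Sobolev dimension of a measure with rapidly
   decaying transform is infinite, and a supremum over the empty set is minus infinity. *)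

definition fourier_dim :: "'a::euclidean_space set \<Rightarrow> ereal" where
  "fourier_dim A =
     Sup {ereal s | s. s \<le> real DIM('a) \<and>
        (\<exists>\<mu>\<in>compact_radon_measures A. \<exists>C>0. \<forall>x.
           cmod (fourier_transform \<mu> x) \<le> C * (1 + norm x) powr (- s / 2))}"

definition sobolev_dim_measure :: "'a::euclidean_space measure \<Rightarrow> ereal" where
  "sobolev_dim_measure \<mu> =
     Sup {ereal s | s.
        (\<integral>\<^sup>+x. ennreal ((cmod (fourier_transform \<mu> x))\<^sup>2 * (1 + norm x) powr (s - real DIM('a))) \<partial>lborel)
          < \<infinity>}"

definition sobolev_dim :: "'a::euclidean_space set \<Rightarrow> ereal" where
  "sobolev_dim A =
     Sup {sobolev_dim_measure \<mu> | \<mu>. \<mu> \<in> compact_radon_measures A \<and> prob_space \<mu>}"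

definition dilates :: "real set \<Rightarrow> 'a::euclidean_space set \<Rightarrow> 'a set" where
  "dilates T E = {r *\<^sub>R x | r x. r \<in> T \<and> x \<in> E}"

(* A pair (z, r) acts as the similarity taking x to r x + z. *)

definition similarity_image :: "('a::euclidean_space \<times> real) set \<Rightarrow> 'a set \<Rightarrow> 'a set" where
  "similarity_image \<Gamma> E = {r *\<^sub>R x + z | r x z. (z, r) \<in> \<Gamma> \<and> x \<in> E}"

end

theory Submission
  imports Defs
begin

text \<open>
  Frostman's lemma puts measures \<open>\<mu>\<close>, \<open>\<nu>\<close>, \<open>\<zeta>\<close> with ball growth exponents \<open>\<alpha>\<close>, \<open>\<beta>\<close>, \<open>\<gamma>\<close> just below
  the Hausdorff dimensions on compact subsets of \<open>E\<close>, \<open>T\<close>, \<open>Z\<close>; let \<open>\<theta>\<close> be the image of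
  \<open>\<nu> \<otimes> \<mu> \<otimes> \<zeta>\<close> under \<open>(r, x, z) \<mapsto> r x + z\<close>.  Its Fourier transform is the product of the transform of
  \<open>\<zeta>\<close> with \<open>F(\<xi>) = \<integral>\<integral> exp(-2\<pi>i r \<xi>\<cdot>x) d\<mu>(x) d\<nu>(r)\<close>.  As a function of \<open>r\<close> the inner integral is
  band-limited at frequency \<open>R = |\<xi>|\<close>, so \<open>\<nu>\<close> may be replaced by its mollification at scale \<open>1/R\<close>,
  of density at most a multiple of \<open>R\<^sup>1\<^sup>-\<^sup>\<beta>\<close>; the remaining quadratic integral is controlled by the
  \<open>\<mu>\<close>-measure of slabs of width \<open>1/R\<close>, at most a multiple of \<open>R\<^sup>d\<^sup>-\<^sup>1\<^sup>-\<^sup>\<alpha>\<close>.  Hence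
  \<open>|F(\<xi>)|\<^sup>2\<close> is at most a multiple of \<open>|\<xi>|\<^sup>d\<^sup>-\<^sup>\<alpha>\<^sup>-\<^sup>\<beta>\<close>, which gives the Fourier dimension of \<open>TE\<close>; with the
  energy of \<open>\<zeta>\<close> it bounds the Sobolev norms of \<open>\<theta>\<close>, and these bound \<open>\<integral> \<theta>(B(x, r)) d\<theta>(x)\<close> by powers
  of \<open>r\<close>, which yields positive volume or a lower bound for the Hausdorff dimension.

  Since \<open>E\<close>, \<open>T\<close>, \<open>Z\<close> are merely Borel, Frostman's lemma is reduced to compact sets by Choquet's
  capacitability argument applied to the dyadic Hausdorff content, and the same argument shows that the
  analytic set \<open>\<Gamma>(E)\<close> is Lebesgue measurable.
\<close>

section \<open>Analytic sets and capacitability\<close>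

text \<open>The mollification is exact. Averaging over Gaussian shifts of size 1/R damps the phase t
  by exp(-2 pi^2 (t/R)^2), which never vanishes, and |t| \<le> B R on the support of \<mu>; undoing
  the damping only reweights \<mu> by a bounded density. Cauchy-Schwarz, used twice, then leaves
  three factors: R from the normalization of the kernel, R^(-\<beta>) from \<nu>, and
  R^(d-1-\<alpha>) from the slabs, with product R^(d-\<alpha>-\<beta>). The slab exponent counts
  balls: a bounded slab of width 1/R consists of about R^(d-1) balls of radius 1/R, each of mass at
  most a multiple of R^(-\<alpha>). Neither Plancherel's theorem nor Fourier inversion enters. The
  Gaussian identity \<open>gauss_energy\<close> converts frequency integrals into energies and back,
  and positive volume comes from Cauchy-Schwarz for ball averages, not from an L^2 density. Frostman
  bounds exist only strictly below the dimension. The loss disappears in a limit for (i) and is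
  absorbed by the strict inequalities in (ii) and (iii).\<close>

definition analytic :: "'a::topological_space set \<Rightarrow> bool" where
  "analytic A \<longleftrightarrow> (\<exists>C :: ((nat \<Rightarrow> nat) \<times> 'a) set. closed C \<and> A = snd ` C)"

lemma closed_imp_analytic: "closed F \<Longrightarrow> analytic F"
  unfolding analytic_def
  by (intro exI[of _ "UNIV \<times> F"]) (auto simp: closed_Times image_iff)

lemma continuous_on_fst_apply:
  "continuous_on UNIV (\<lambda>p :: (nat \<Rightarrow> nat) \<times> 'a::topological_space. fst p i)"
  by (rule continuous_on_compose2[OF continuous_on_product_coordinates continuous_on_fst[OF continuous_on_id]]) simp

lemma continuous_on_reindex:
  "continuous_on UNIV (\<lambda>p :: (nat \<Rightarrow> nat) \<times> 'a::topological_space. (\<lambda>k::nat. fst p (h k), snd p))"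
  by (intro continuous_on_Pair continuous_on_snd continuous_on_id
      continuous_on_coordinatewise_then_product continuous_on_fst_apply)

text \<open>Entry 0 of the coding sequence names one of the sets, and the shifted sequence is a code
  for membership in it.\<close>

lemma analytic_UN:
  fixes A :: "nat \<Rightarrow> 'a::topological_space set"
  assumes "\<And>n. analytic (A n)"
  shows "analytic (\<Union>n. A n)"
proof -
  from assms obtain C :: "nat \<Rightarrow> ((nat \<Rightarrow> nat) \<times> 'a) set"
    where C: "\<And>n. closed (C n)" "\<And>n. A n = snd ` C n"
    unfolding analytic_def by metis
  define g :: "(nat \<Rightarrow> nat) \<times> 'a \<Rightarrow> (nat \<Rightarrow> nat) \<times> 'a" where "g = (\<lambda>p. (\<lambda>k. fst p (Suc k), snd p))"
  \<comment> \<open>The implication "if entry 0 is n then the tail is in \<open>C n\<close>",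
    imposed for all n. Each is a union of two closed sets because a condition on one entry is
    clopen.\<close>
  define D where "D = (\<Inter>n. ((\<lambda>p. fst p 0) -` (- {n})) \<union> g -` C n)"
  have cg: "continuous_on UNIV g" unfolding g_def by (rule continuous_on_reindex)
  have cn: "closed (- {n :: nat})" for n by (intro closed_Compl discrete_topology_class.open_discrete)
  have "closed D"
    unfolding D_def
    by (intro closed_INT ballI closed_Un closed_vimage cg C continuous_on_fst_apply cn)
  moreover have "(\<Union>n. A n) = snd ` D"
  proof (intro set_eqI iffI)
    fix a assume "a \<in> (\<Union>n. A n)"
    then obtain n x where "(x, a) \<in> C n" using C(2) by auto
    then have "((\<lambda>k. case k of 0 \<Rightarrow> n | Suc k \<Rightarrow> x k), a) \<in> D"
      by (auto simp: D_def g_def)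
    then show "a \<in> snd ` D" by force
  next
    fix a assume "a \<in> snd ` D"
    then obtain x where "(x, a) \<in> D" by auto
    then have "g (x, a) \<in> C (x 0)" by (auto simp: D_def)
    then have "a \<in> A (x 0)" unfolding C(2) g_def by force
    then show "a \<in> (\<Union>n. A n)" by blast
  qed
  ultimately show ?thesis unfolding analytic_def by blast
qed

text \<open>Codes for all the sets are interleaved in one sequence by \<open>prod_encode\<close>,
  while the point itself is shared.\<close>

lemma analytic_INT:
  fixes A :: "nat \<Rightarrow> 'a::topological_space set"
  assumes "\<And>n. analytic (A n)"
  shows "analytic (\<Inter>n. A n)"
proof -
  from assms obtain C :: "nat \<Rightarrow> ((nat \<Rightarrow> nat) \<times> 'a) set"
    where C: "\<And>n. closed (C n)" "\<And>n. A n = snd ` C n"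
    unfolding analytic_def by metis
  define g :: "nat \<Rightarrow> (nat \<Rightarrow> nat) \<times> 'a \<Rightarrow> (nat \<Rightarrow> nat) \<times> 'a"
    where "g n = (\<lambda>p. (\<lambda>k. fst p (prod_encode (n, k)), snd p))" for n
  define D where "D = (\<Inter>n. g n -` C n)"
  have cg: "continuous_on UNIV (g n)" for n unfolding g_def by (rule continuous_on_reindex)
  have "closed D"
    unfolding D_def by (intro closed_INT ballI closed_vimage cg C)
  moreover have "(\<Inter>n. A n) = snd ` D"
  proof (intro set_eqI iffI)
    fix a assume "a \<in> (\<Inter>n. A n)"
    then have "\<forall>n. \<exists>x. (x, a) \<in> C n" using C(2) by force
    then obtain x where x: "\<And>n. (x n, a) \<in> C n" by metis
    have "((\<lambda>m. case prod_decode m of (n, k) \<Rightarrow> x n k), a) \<in> D"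
      using x by (auto simp: D_def g_def)
    then show "a \<in> snd ` D" by force
  next
    fix a assume "a \<in> snd ` D"
    then show "a \<in> (\<Inter>n. A n)" using C(2) by (force simp: D_def g_def)
  qed
  ultimately show ?thesis unfolding analytic_def by blast
qed

lemma open_imp_analytic:
  fixes U :: "'a::metric_space set"
  assumes "open U" shows "analytic U"
\<comment> \<open>\<open>infdist\<close> to the empty set is 0 by convention, so the exhaustion by
  distance from the complement needs a non-empty complement.\<close>
proof (cases "U = UNIV")
  case True then show ?thesis by (simp add: closed_imp_analytic)
next
  case False
  define F where "F n = {x. 1 / real (Suc n) \<le> infdist x (- U)}" for n
  have "closed (F n)" for n
    unfolding F_def by (intro closed_Collect_le continuous_intros)
  then have "analytic (\<Union>n. F n)" by (intro analytic_UN closed_imp_analytic)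
  moreover have "(\<Union>n. F n) = U"
  proof (intro set_eqI iffI)
    fix x assume "x \<in> (\<Union>n. F n)"
    then obtain n where n: "1 / real (Suc n) \<le> infdist x (- U)" by (auto simp: F_def)
    show "x \<in> U"
    proof (rule ccontr)
      assume "x \<notin> U" then have "infdist x (- U) = 0" by simp
      with n show False by (simp add: divide_le_0_iff)
    qed
  next
    fix x assume "x \<in> U"
    then have "infdist x (- U) > 0"
      using assms False by (intro infdist_pos_not_in_closed) auto
    then obtain n where "1 / real (Suc n) < infdist x (- U)"
      using nat_approx_posE by blast
    then show "x \<in> (\<Union>n. F n)" by (auto simp: F_def intro!: exI[of _ n])
  qed
  ultimately show ?thesis by simp
qed

text \<open>Analytic sets are not closed under complements, so the induction over the sigma-algebra
  carries each set together with its complement; complementation then merely swaps the two.\<close>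

lemma borel_imp_analytic:
  fixes A :: "'a::metric_space set"
  assumes "A \<in> sets borel" shows "analytic A"
proof -
  have "A \<in> sigma_sets UNIV {S :: 'a set. open S}"
    using assms by (simp add: borel_def)
  then have "analytic A \<and> analytic (- A)"
  proof induction
    case (Basic a)
    then show ?case by (auto intro: open_imp_analytic closed_imp_analytic)
  next
    case Empty
    then show ?case by (auto intro: closed_imp_analytic)
  next
    case (Compl a)
    then show ?case by (simp add: Compl_eq_Diff_UNIV[symmetric])
  next
    case (Union a)
    then show ?case by (auto intro: analytic_UN analytic_INT)
  qed
  then show ?thesis ..
qed

lemma compact_bounded_sequences: "compact {x :: nat \<Rightarrow> nat. \<forall>i. x i \<le> m i}"
proof -
  have "compactin (product_topology (\<lambda>i. euclidean) UNIV) (PiE UNIV (\<lambda>i::nat. {..m i}))"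
    by (subst compactin_PiE) (auto intro: finite_imp_compact)
  moreover have "PiE UNIV (\<lambda>i::nat. {..m i}) = {x. \<forall>i. x i \<le> m i}"
    by (auto simp: PiE_def)
  ultimately show ?thesis by (simp add: euclidean_product_topology)
qed

text \<open>Choquet's argument: continuity along increasing unions allows the entries of the codes
  to be bounded one at a time while the capacity stays above c, and codes with all entries bounded
  form a compact set. Nothing is assumed about decreasing sequences of compact sets, so the
  conclusion speaks of open neighbourhoods.\<close>

theorem capacitability:
  fixes cap :: "'b::topological_space set \<Rightarrow> ennreal" and f :: "'a::euclidean_space \<Rightarrow> 'b"
  assumes mono: "\<And>A B. A \<subseteq> B \<Longrightarrow> cap A \<le> cap B"
    and inc: "\<And>A. incseq A \<Longrightarrow> cap (\<Union>n::nat. A n) \<le> (SUP n. cap (A n))"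
    and f: "continuous_on UNIV f" and A: "analytic A" and c: "c < cap (f ` A)"
  obtains K where "compact K" "K \<subseteq> A" "\<And>U. open U \<Longrightarrow> f ` K \<subseteq> U \<Longrightarrow> c < cap U"
proof -
  obtain C :: "((nat \<Rightarrow> nat) \<times> 'a) set" where C: "closed C" "A = snd ` C"
    using A unfolding analytic_def by blast
  \<comment> \<open>Only the first k entries are bounded, so \<open>D N m k\<close> need not be
    compact. The radius N is fixed at the start because the point component ranges over a
    non-compact space.\<close>
  define D where "D N m k = {p \<in> C. norm (snd p) \<le> real N \<and> (\<forall>i<k. fst p i \<le> m i)}"
    for N :: nat and m :: "nat \<Rightarrow> nat" and k :: nat
  define g where "g p = f (snd p)" for p :: "(nat \<Rightarrow> nat) \<times> 'a"
  have "incseq (\<lambda>N. g ` D N m 0)" for m by (force simp: incseq_def D_def)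
  from inc[OF this] have "cap (\<Union>N. g ` D N (\<lambda>_. 0) 0) \<le> (SUP N. cap (g ` D N (\<lambda>_. 0) 0))" .
  moreover have "(\<Union>N. g ` D N (\<lambda>_. 0) 0) = f ` A"
  proof -
    have "(\<Union>N. D N (\<lambda>_. 0) 0) = C" by (auto simp: D_def real_arch_simple)
    then have "(\<Union>N. g ` D N (\<lambda>_. 0) 0) = g ` C" by blast
    then show ?thesis by (auto simp: C(2) g_def image_image)
  qed
  ultimately have "c < (SUP N. cap (g ` D N (\<lambda>_. 0) 0))" using c by simp
  then obtain N where N: "c < cap (g ` D N (\<lambda>_. 0) 0)" by (auto simp: less_SUP_iff)
  have step: "\<exists>j. c < cap (g ` D N (m(k := j)) (Suc k))" if "c < cap (g ` D N m k)" for m k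
  proof -
    have "incseq (\<lambda>j. g ` D N (m(k := j)) (Suc k))"
    proof (rule incseq_SucI, rule image_mono, rule subsetI)
      fix j p assume "p \<in> D N (m(k := j)) (Suc k)"
      then show "p \<in> D N (m(k := Suc j)) (Suc k)"
        unfolding D_def by (auto simp: less_Suc_eq)
    qed
    from inc[OF this] have "cap (\<Union>j. g ` D N (m(k := j)) (Suc k))
        \<le> (SUP j. cap (g ` D N (m(k := j)) (Suc k)))" .
    moreover have "(\<Union>j. g ` D N (m(k := j)) (Suc k)) = g ` D N m k"
    proof -
      have "(\<Union>j. D N (m(k := j)) (Suc k)) = D N m k"
        by (auto simp: D_def less_Suc_eq)
      then show ?thesis by blast
    qed
    ultimately have "c < (SUP j. cap (g ` D N (m(k := j)) (Suc k)))" using that by simp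
    then show ?thesis by (auto simp: less_SUP_iff)
  qed
  \<comment> \<open>Stage k alters entry k alone, so the stages stabilize entry by entry and define
    one bound m.\<close>
  define M where "M = rec_nat (\<lambda>_. 0) (\<lambda>k m. m(k := SOME j. c < cap (g ` D N (m(k := j)) (Suc k))))"
  have M0: "M 0 = (\<lambda>_. 0)" and MS: "M (Suc k) = (M k)(k := SOME j. c < cap (g ` D N ((M k)(k := j)) (Suc k)))" for k
    by (auto simp: M_def)
  have Mc: "c < cap (g ` D N (M k) k)" for k
  proof (induction k)
    case 0 then show ?case using N by (simp add: M0)
  next
    case (Suc k)
    from someI_ex[OF step[OF this]] show ?case by (simp only: MS)
  qed
  define m where "m i = M (Suc i) i" for i
  have Mm: "M k i = m i" if "i < k" for i k
    using that
  proof (induction k)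
    case (Suc k)
    then show ?case by (cases "i = k") (auto simp: m_def MS)
  qed simp
  have cm: "c < cap (g ` D N m k)" for k
  proof -
    have "D N m k = D N (M k) k" by (auto simp: D_def Mm)
    then show ?thesis using Mc by simp
  qed
  define B where "B = {x :: nat \<Rightarrow> nat. \<forall>i. x i \<le> m i} \<times> cball (0::'a) (real N)"
  define L where "L = C \<inter> B"
  have "compact L"
    unfolding L_def B_def
    by (intro closed_Int_compact C compact_Times compact_bounded_sequences compact_cball)
  have "compact (snd ` L)"
    using \<open>compact L\<close> by (intro compact_continuous_image continuous_on_snd continuous_on_id)
  moreover have "snd ` L \<subseteq> A" by (auto simp: L_def C(2))
  moreover have "c < cap U" if U: "open U" "f ` snd ` L \<subseteq> U" for U
  proof -
    have "\<exists>k. g ` D N m k \<subseteq> U"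
    proof (rule ccontr)
      assume "\<not> ?thesis"
      then have "\<forall>k. \<exists>p. p \<in> D N m k \<and> g p \<notin> U" by blast
      then obtain p where p: "\<And>k. p k \<in> D N m k" "\<And>k. g (p k) \<notin> U" by metis
      \<comment> \<open>Entry i of \<open>p k\<close> can exceed \<open>m i\<close> only for the
        finitely many k \<le> i, and adding those values to the bound puts the whole sequence in a
        compact set. A limit point still obeys m, since entry i does so for all larger k.\<close>
      define m' where "m' i = Max (insert (m i) ((\<lambda>k. fst (p k) i) ` {..i}))" for i
      have pm: "fst (p k) i \<le> m' i" for k i
      proof (cases "i < k")
        case True
        then have "fst (p k) i \<le> m i" using p(1)[of k] by (auto simp: D_def)
        also have "m i \<le> m' i" by (auto simp: m'_def)
        finally show ?thesis .
      next
        case False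
        then show ?thesis unfolding m'_def by (intro Max_ge) auto
      qed
      define B' where "B' = {x :: nat \<Rightarrow> nat. \<forall>i. x i \<le> m' i} \<times> cball (0::'a) (real N)"
      have "compact B'" unfolding B'_def
        by (intro compact_Times compact_bounded_sequences compact_cball)
      then have "seq_compact B'" by (rule compact_imp_seq_compact)
      moreover have "\<forall>k. p k \<in> B'"
      proof
        fix k
        have "norm (snd (p k)) \<le> real N" using p(1)[of k] by (simp add: D_def)
        then show "p k \<in> B'" using pm unfolding B'_def by (cases "p k") (auto, metis fst_conv)
      qed
      ultimately obtain l r where l: "l \<in> B'" "strict_mono r" "(p \<circ> r) \<longlonglongrightarrow> l"
        unfolding seq_compact_def by metis
      have "l \<in> C"
        using closed_sequentially[OF C(1) _ l(3)] p(1) by (auto simp: D_def)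
      have "fst l i \<le> m i" for i
      proof -
        have "((\<lambda>k. fst ((p \<circ> r) k) i) \<longlongrightarrow> fst l i) sequentially"
          using continuous_on_tendsto_compose[OF continuous_on_fst_apply l(3), of i] by simp
        then have "eventually (\<lambda>k. fst ((p \<circ> r) k) i = fst l i) sequentially"
          by (simp add: tendsto_discrete)
        moreover have "eventually (\<lambda>k. fst ((p \<circ> r) k) i \<le> m i) sequentially"
        proof (rule eventually_sequentiallyI)
          fix k assume "Suc i \<le> k"
          then have "i < r k" using seq_suble[OF l(2), of k] by linarith
          then show "fst ((p \<circ> r) k) i \<le> m i" using p(1)[of "r k"] by (auto simp: D_def)
        qed
        ultimately have "eventually (\<lambda>k. fst l i \<le> m i) sequentially"
          by eventually_elim simp
        then show ?thesis by simp
      qed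
      moreover have "snd l \<in> cball 0 (real N)" using l(1) by (auto simp: B'_def)
      ultimately have "l \<in> L" using \<open>l \<in> C\<close>
        by (cases l) (auto simp: L_def B_def)
      then have "g l \<in> U" using U(2) by (auto simp: g_def)
      have "continuous_on UNIV g" unfolding g_def
        by (intro continuous_on_compose2[OF f] continuous_on_snd continuous_on_id) auto
      then have "(\<lambda>k. g ((p \<circ> r) k)) \<longlonglongrightarrow> g l"
        by (rule continuous_on_tendsto_compose[OF _ l(3)]) auto
      then have "eventually (\<lambda>k. g ((p \<circ> r) k) \<in> U) sequentially"
        using U(1) \<open>g l \<in> U\<close> by (rule topological_tendstoD)
      then show False using p(2) by simp
    qed
    then obtain k where "g ` D N m k \<subseteq> U" by blast
    then show ?thesis using cm[of k] mono less_le_trans by blast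
  qed
  ultimately show ?thesis by (rule that)
qed

section \<open>Dyadic content\<close>

text \<open>A half-open cell of side 2^(-n) is named by its lower corner. The corner belongs to the
  cell, so \<open>dyadic m\<close> of a label is the label of the ancestor in generation m \<le>
  n.\<close>

definition dyadic :: "nat \<Rightarrow> 'a::euclidean_space \<Rightarrow> 'a" where
  "dyadic n x = (\<Sum>b\<in>Basis. (real_of_int \<lfloor>2 ^ n * (x \<bullet> b)\<rfloor> / 2 ^ n) *\<^sub>R b)"

lemma dyadic_inner: "b \<in> Basis \<Longrightarrow> dyadic n x \<bullet> b = real_of_int \<lfloor>2 ^ n * (x \<bullet> b)\<rfloor> / 2 ^ n"
  unfolding dyadic_def by (simp)

lemma dyadic_eq_iff:
  "dyadic n x = dyadic n y \<longleftrightarrow> (\<forall>b\<in>Basis. \<lfloor>2 ^ n * (x \<bullet> b)\<rfloor> = \<lfloor>2 ^ n * (y \<bullet> b)\<rfloor>)"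
  by (auto simp: euclidean_eq_iff[of "dyadic n x"] dyadic_inner)

text \<open>Nesting of the generations, from floor(floor(y) / N) = floor(y / N) for positive
  integers N.\<close>

lemma dyadic_dyadic:
  assumes "m \<le> n" shows "dyadic m (dyadic n x) = dyadic m x"
  unfolding dyadic_eq_iff
proof
  fix b :: 'a assume b: "b \<in> Basis"
  define k where "k = \<lfloor>2 ^ n * (x \<bullet> b)\<rfloor>"
  have "2 ^ n = (2 ^ m * 2 ^ (n - m) :: real)" using assms by (simp add: power_add[symmetric])
  then have e: "2 ^ m * (real_of_int k / 2 ^ n) = real_of_int k / of_int (2 ^ (n - m))"
    and e': "2 ^ m * (x \<bullet> b) = (2 ^ n * (x \<bullet> b)) / of_int (2 ^ (n - m))"
    by (simp_all add: field_simps)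
  have "\<lfloor>2 ^ m * (real_of_int k / 2 ^ n)\<rfloor> = k div 2 ^ (n - m)"
    unfolding e by (rule floor_divide_of_int_eq)
  also have "\<dots> = \<lfloor>2 ^ m * (x \<bullet> b)\<rfloor>"
    unfolding e' k_def
    by (metis floor_divide_real_eq_div zero_le_numeral zero_le_power)
  finally show "\<lfloor>2 ^ m * (dyadic n x \<bullet> b)\<rfloor> = \<lfloor>2 ^ m * (x \<bullet> b)\<rfloor>"
    using b by (simp add: dyadic_inner k_def)
qed

lemma dyadic_inner_bounds:
  assumes "b \<in> Basis"
  shows "dyadic n x \<bullet> b \<le> x \<bullet> b" "x \<bullet> b < dyadic n x \<bullet> b + 1 / 2 ^ n"
  using assms floor_correct[of "2 ^ n * (x \<bullet> b)"] by (auto simp: dyadic_inner field_simps)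

lemma dist_dyadic: "dist (dyadic n x) (x::'a::euclidean_space) \<le> DIM('a) / 2 ^ n"
proof -
  have "dist (dyadic n x) x \<le> (\<Sum>b\<in>Basis. \<bar>(dyadic n x - x) \<bullet> b\<bar>)"
    unfolding dist_norm by (rule norm_le_l1)
  also have "\<dots> \<le> (\<Sum>b\<in>(Basis::'a set). 1 / 2 ^ n)"
  proof (rule sum_mono)
    fix b :: 'a assume "b \<in> Basis"
    from dyadic_inner_bounds[OF this, where n = n and x = x] show "\<bar>(dyadic n x - x) \<bullet> b\<bar> \<le> 1 / 2 ^ n"
      by (simp add: inner_diff_left)
  qed
  finally show ?thesis by simp
qed

lemma diameter_dyadic_cell:
  "bounded {y::'a::euclidean_space. dyadic n y = p}" "diameter {y::'a. dyadic n y = p} \<le> 2 * DIM('a) / 2 ^ n"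
proof -
  have d: "dist x y \<le> 2 * DIM('a) / 2 ^ n" if "dyadic n x = p" "dyadic n y = p" for x y :: 'a
    using dist_dyadic[of n x] dist_dyadic[of n y] dist_triangle3[of x y p] that
    by (simp add: dist_commute)
  show "bounded {y::'a. dyadic n y = p}"
    using d unfolding bounded_def by blast
  show "diameter {y::'a. dyadic n y = p} \<le> 2 * DIM('a) / 2 ^ n"
    using d by (intro diameter_le) (auto simp: dist_norm)
qed

text \<open>Offsets of the cells of a given generation that can meet a bounded neighbourhood of a
  given cell, measured in units of the side length.\<close>

definition offsets :: "int \<Rightarrow> 'a::euclidean_space set" where
  "offsets m = (\<lambda>h. \<Sum>b\<in>Basis. real_of_int (h b) *\<^sub>R b) ` (PiE Basis (\<lambda>_. {-m..m}))"

lemma finite_offsets: "finite (offsets m)"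
  unfolding offsets_def by (intro finite_imageI finite_PiE) auto

lemma dyadic_offset:
  assumes "\<And>b. b \<in> Basis \<Longrightarrow> \<bar>\<lfloor>2 ^ n * (y \<bullet> b)\<rfloor> - \<lfloor>2 ^ n * (x \<bullet> b)\<rfloor>\<bar> \<le> m"
  shows "\<exists>v\<in>offsets m. dyadic n y = dyadic n x + (1 / 2 ^ n) *\<^sub>R v"
proof
  define h where "h = restrict (\<lambda>b. \<lfloor>2 ^ n * (y \<bullet> b)\<rfloor> - \<lfloor>2 ^ n * (x \<bullet> b)\<rfloor>) Basis"
  define v where "v = (\<Sum>b\<in>Basis. real_of_int (h b) *\<^sub>R b)"
  have "h \<in> PiE Basis (\<lambda>_. {-m..m})"
    using assms by (fastforce simp: h_def abs_le_iff)
  then show "v \<in> offsets m" unfolding offsets_def v_def by blast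
  have "v \<bullet> b = real_of_int (h b)" if "b \<in> Basis" for b
    using that by (simp add: v_def)
  note v = this
  show "dyadic n y = dyadic n x + (1 / 2 ^ n) *\<^sub>R v"
  proof (rule euclidean_eqI)
    fix b :: 'a assume b: "b \<in> Basis"
    then show "dyadic n y \<bullet> b = (dyadic n x + (1 / 2 ^ n) *\<^sub>R v) \<bullet> b"
      using v[OF b] by (simp add: dyadic_inner inner_add_left h_def diff_divide_distrib)
  qed
qed

lemma countable_range_dyadic: "countable (range (dyadic n :: 'a::euclidean_space \<Rightarrow> 'a))"
proof -
  have "range (dyadic n :: 'a \<Rightarrow> 'a) \<subseteq>
      (\<lambda>h. \<Sum>b\<in>Basis. (real_of_int (h b) / 2 ^ n) *\<^sub>R b) ` (PiE Basis (\<lambda>_. UNIV))"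
  proof clarify
    fix x :: 'a
    show "dyadic n x \<in> (\<lambda>h. \<Sum>b\<in>Basis. (real_of_int (h b) / 2 ^ n) *\<^sub>R b) ` (PiE Basis (\<lambda>_. UNIV))"
      by (rule image_eqI[of _ _ "restrict (\<lambda>b. \<lfloor>2 ^ n * (x \<bullet> b)\<rfloor>) Basis"])
         (auto simp: dyadic_def intro!: sum.cong)
  qed
  then show ?thesis
    by (rule countable_subset) (intro countable_image countable_PiE, auto)
qed

definition dyadic_labels :: "(nat \<times> 'a::euclidean_space) set" where
  "dyadic_labels = {(n, p). p \<in> range (dyadic n)}"

lemma countable_dyadic_labels: "countable (dyadic_labels :: (nat \<times> 'a::euclidean_space) set)"
proof -
  have eq: "(dyadic_labels :: (nat \<times> 'a) set) = (SIGMA n:UNIV. range (dyadic n))"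
    by (auto simp: dyadic_labels_def)
  show ?thesis unfolding eq by (intro countable_SIGMA countable_range_dyadic) auto
qed

definition dyadic_cover :: "(nat \<times> 'a::euclidean_space) set \<Rightarrow> 'a set" where
  "dyadic_cover U = {x. \<exists>n. (n, dyadic n x) \<in> U}"

lemma dyadic_cover_UN: "dyadic_cover (\<Union>i\<in>I. U i) = (\<Union>i\<in>I. dyadic_cover (U i))"
  by (auto simp: dyadic_cover_def)

lemma dyadic_cover_Un: "dyadic_cover (U \<union> V) = dyadic_cover U \<union> dyadic_cover V"
  by (auto simp: dyadic_cover_def)

text \<open>The sum of side^s over a family of cells, packaged as a measure on labels: additivity,
  monotonicity and continuity from below of the weight are then facts about measures.\<close>

definition cover_weight :: "real \<Rightarrow> (nat \<times> 'a::euclidean_space) measure" where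
  "cover_weight s = density (count_space UNIV) (\<lambda>(n, p). ennreal (2 powr (- s * real n)))"

lemma sets_cover_weight[simp]: "U \<in> sets (cover_weight s)"
  by (simp add: cover_weight_def)

lemma emeasure_cover_weight_singleton:
  "emeasure (cover_weight s) {(n, p)} = ennreal (2 powr (- s * real n))"
  unfolding cover_weight_def
  by (simp add: emeasure_density nn_integral_count_space_indicator[symmetric] nn_integral_count_space_finite)

text \<open>A Hausdorff content: the cells have side at most 1 but there is no finer mesh condition.
  This keeps the value at most 2^(-s n) on a cell of generation n, which becomes the Frostman bound,
  and dyadic nesting gives continuity along increasing sequences.\<close>

definition dyadic_content :: "real \<Rightarrow> 'a::euclidean_space set \<Rightarrow> ennreal" where
  "dyadic_content s A =
     (INF U\<in>{U. U \<subseteq> dyadic_labels \<and> A \<subseteq> dyadic_cover U}. emeasure (cover_weight s) U)"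

lemma dyadic_content_le:
  "U \<subseteq> dyadic_labels \<Longrightarrow> A \<subseteq> dyadic_cover U \<Longrightarrow> dyadic_content s A \<le> emeasure (cover_weight s) U"
  unfolding dyadic_content_def by (rule INF_lower) auto

lemma dyadic_content_mono: "A \<subseteq> B \<Longrightarrow> dyadic_content s A \<le> dyadic_content s B"
  unfolding dyadic_content_def by (rule INF_superset_mono) auto

lemma dyadic_content_approx:
  assumes "dyadic_content s A < c"
  obtains U where "U \<subseteq> dyadic_labels" "A \<subseteq> dyadic_cover U" "emeasure (cover_weight s) U < c"
  using assms unfolding dyadic_content_def INF_less_iff by blast

lemma dyadic_content_cell: "dyadic_content s {y. dyadic n y = dyadic n x} \<le> ennreal (2 powr (- s * real n))"
  using dyadic_content_le[of "{(n, dyadic n x)}" "{y. dyadic n y = dyadic n x}" s]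
  by (auto simp: dyadic_labels_def dyadic_cover_def emeasure_cover_weight_singleton)

lemma dyadic_content_empty: "dyadic_content s {} = 0"
  using dyadic_content_le[of "{}" "{}" s] by simp

lemma less_add_ennreal: "x < top \<Longrightarrow> 0 < e \<Longrightarrow> x < x + ennreal e"
  by (cases x) (auto simp: ennreal_plus[symmetric] ennreal_less_iff simp del: ennreal_plus)

lemma dyadic_content_Un: "dyadic_content s (A \<union> B) \<le> dyadic_content s A + dyadic_content s B"
proof (rule ennreal_le_epsilon)
  fix e :: real assume fin: "dyadic_content s A + dyadic_content s B < top" and "0 < e"
  have "dyadic_content s A < dyadic_content s A + ennreal (e/2)"
    "dyadic_content s B < dyadic_content s B + ennreal (e/2)"
    using fin \<open>0 < e\<close> by (auto intro!: less_add_ennreal)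
  then obtain U V where
    U: "U \<subseteq> dyadic_labels" "A \<subseteq> dyadic_cover U" "emeasure (cover_weight s) U < dyadic_content s A + ennreal (e/2)" and
    V: "V \<subseteq> dyadic_labels" "B \<subseteq> dyadic_cover V" "emeasure (cover_weight s) V < dyadic_content s B + ennreal (e/2)"
    by (metis dyadic_content_approx)
  have "dyadic_content s (A \<union> B) \<le> emeasure (cover_weight s) (U \<union> V)"
    using U V by (intro dyadic_content_le) (auto simp: dyadic_cover_Un)
  also have "\<dots> \<le> emeasure (cover_weight s) U + emeasure (cover_weight s) V"
    by (rule emeasure_subadditive) auto
  also have "\<dots> \<le> (dyadic_content s A + ennreal (e/2)) + (dyadic_content s B + ennreal (e/2))"
    using U V by (intro add_mono) auto
  also have "\<dots> = dyadic_content s A + dyadic_content s B + ennreal e"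
    using \<open>0 < e\<close> by (simp add: ennreal_plus[symmetric] add.assoc add.left_commute del: ennreal_plus)
  finally show "dyadic_content s (A \<union> B) \<le> dyadic_content s A + dyadic_content s B + ennreal e" .
qed

lemma dyadic_content_UN_finite:
  "finite I \<Longrightarrow> dyadic_content s (\<Union>i\<in>I. A i) \<le> (\<Sum>i\<in>I. dyadic_content s (A i))"
proof (induction I rule: finite_induct)
  case (insert i I)
  have "dyadic_content s (\<Union>j\<in>insert i I. A j) \<le> dyadic_content s (A i) + dyadic_content s (\<Union>j\<in>I. A j)"
    using dyadic_content_Un[of s "A i" "\<Union>j\<in>I. A j"] by simp
  also have "\<dots> \<le> dyadic_content s (A i) + (\<Sum>j\<in>I. dyadic_content s (A j))"
    by (intro add_left_mono insert.IH)
  finally show ?case using insert.hyps by simp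
qed (simp add: dyadic_content_empty)

text \<open>Dyadic cells are nested or disjoint, so dropping every cell that lies below a coarser
  cell of the family leaves disjoint cells with the same union.\<close>

definition maximal_labels :: "(nat \<times> 'a::euclidean_space) set \<Rightarrow> (nat \<times> 'a) set" where
  "maximal_labels U = {(n, p) \<in> U. \<forall>m<n. (m, dyadic m p) \<notin> U}"

lemma maximal_labels_cover:
  assumes "U \<subseteq> dyadic_labels" shows "dyadic_cover (maximal_labels U) = dyadic_cover U"
proof (intro set_eqI iffI)
  fix x assume "x \<in> dyadic_cover U"
  then have ex: "\<exists>n. (n, dyadic n x) \<in> U" by (auto simp: dyadic_cover_def)
  define n where "n = (LEAST n. (n, dyadic n x) \<in> U)"
  have "(n, dyadic n x) \<in> U" unfolding n_def by (rule LeastI_ex[OF ex])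
  moreover have "(m, dyadic m x) \<notin> U" if "m < n" for m using that unfolding n_def by (rule not_less_Least)
  ultimately have "(n, dyadic n x) \<in> maximal_labels U"
    by (auto simp: maximal_labels_def dyadic_dyadic)
  then show "x \<in> dyadic_cover (maximal_labels U)" by (auto simp: dyadic_cover_def)
qed (auto simp: dyadic_cover_def maximal_labels_def)

lemma maximal_labels_subset: "maximal_labels U \<subseteq> U"
  by (auto simp: maximal_labels_def)

text \<open>Strong subadditivity on the level of covers: the cells that are not maximal in \<open>U \<union> V\<close>,
  together with the common ones, still cover the intersection.\<close>

lemma maximal_labels_strong_subadditive:
  assumes "U \<subseteq> dyadic_labels" "V \<subseteq> dyadic_labels" "A \<subseteq> dyadic_cover U" "A \<subseteq> dyadic_cover V"
  shows "emeasure (cover_weight s) (maximal_labels (U \<union> V)) + dyadic_content s A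
           \<le> emeasure (cover_weight s) U + emeasure (cover_weight s) V"
proof -
  let ?w = "emeasure (cover_weight s)" and ?J = "maximal_labels (U \<union> V)"
  define L where "L = (U \<inter> V) \<union> ((U \<union> V) - ?J)"
  have "A \<subseteq> dyadic_cover L"
  proof
    fix x assume "x \<in> A"
    then obtain m n where mn: "(m, dyadic m x) \<in> U" "(n, dyadic n x) \<in> V"
      using assms(3,4) unfolding dyadic_cover_def by blast
    consider "m = n" | "m < n" | "n < m" by linarith
    then show "x \<in> dyadic_cover L"
    proof cases
      case 1 then show ?thesis using mn by (auto simp: L_def dyadic_cover_def)
    next
      case 2
      then have "(n, dyadic n x) \<notin> ?J" using mn by (auto simp: maximal_labels_def dyadic_dyadic)
      then show ?thesis using mn by (auto simp: L_def dyadic_cover_def)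
    next
      case 3
      then have "(m, dyadic m x) \<notin> ?J" using mn by (auto simp: maximal_labels_def dyadic_dyadic)
      then show ?thesis using mn by (auto simp: L_def dyadic_cover_def)
    qed
  qed
  then have "dyadic_content s A \<le> ?w L"
    using assms by (intro dyadic_content_le) (auto simp: L_def)
  also have "\<dots> \<le> ?w (U \<inter> V) + ?w ((U \<union> V) - ?J)"
    unfolding L_def by (rule emeasure_subadditive) auto
  finally have "?w ?J + dyadic_content s A \<le> ?w ?J + (?w (U \<inter> V) + ?w ((U \<union> V) - ?J))"
    by (rule add_left_mono)
  also have "\<dots> = (?w ?J + ?w ((U \<union> V) - ?J)) + ?w (U \<inter> V)"
    by (simp add: ac_simps)
  also have "?w ?J + ?w ((U \<union> V) - ?J) = ?w (U \<union> V)"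
  proof (subst plus_emeasure)
    show "?w (?J \<union> ((U \<union> V) - ?J)) = ?w (U \<union> V)"
      using maximal_labels_subset[of "U \<union> V"] by (simp add: Un_absorb1)
  qed auto
  also have "?w (U \<union> V) + ?w (U \<inter> V) = ?w U + ?w V"
  proof -
    have "?w (U \<union> V) = ?w U + ?w (V - U)" by (subst plus_emeasure) auto
    moreover have "?w (V - U) + ?w (U \<inter> V) = ?w V"
      by (subst plus_emeasure) (auto intro: arg_cong[where f = ?w])
    ultimately show ?thesis by (simp add: add.assoc)
  qed
  finally show ?thesis .
qed

text \<open>Near-optimal covers of the \<open>A n\<close> are merged one after another. Both the
  merged cover and the next one cover \<open>A n\<close>, so by strong subadditivity each merge
  costs only the new error \<epsilon> and not the whole weight of the new cover.\<close>

theorem dyadic_content_incseq: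
  fixes A :: "nat \<Rightarrow> 'a::euclidean_space set"
  assumes A: "incseq A"
  shows "dyadic_content s (\<Union>n. A n) \<le> (SUP n. dyadic_content s (A n))"
proof (rule ennreal_le_epsilon)
  fix e :: real assume fin: "(SUP n. dyadic_content s (A n)) < top" and "0 < e"
  let ?w = "emeasure (cover_weight s :: (nat \<times> 'a) measure)" and ?N = "dyadic_content s"
  define \<epsilon> where "\<epsilon> i = e * (1/2) ^ Suc i" for i :: nat
  have \<epsilon>: "0 < \<epsilon> i" for i using \<open>0 < e\<close> by (simp add: \<epsilon>_def)
  have finA: "?N (A n) < top" for n
    using fin by (meson SUP_upper UNIV_I le_less_trans)
  have "\<exists>U. U \<subseteq> dyadic_labels \<and> A n \<subseteq> dyadic_cover U \<and> ?w U < ?N (A n) + ennreal (\<epsilon> n)" for n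
  proof -
    have "?N (A n) < ?N (A n) + ennreal (\<epsilon> n)"
      using finA[of n] \<epsilon>[of n] by (intro less_add_ennreal)
    then show ?thesis by (metis dyadic_content_approx)
  qed
  then obtain U where U: "\<And>n. U n \<subseteq> dyadic_labels" "\<And>n. A n \<subseteq> dyadic_cover (U n)"
    "\<And>n. ?w (U n) < ?N (A n) + ennreal (\<epsilon> n)" by metis
  define V where "V n = (\<Union>i\<le>n. U i)" for n
  define W where "W n = maximal_labels (V n)" for n
  have V: "V n \<subseteq> dyadic_labels" for n using U(1) by (auto simp: V_def)
  then have W: "W n \<subseteq> dyadic_labels" for n using maximal_labels_subset[of "V n"] by (auto simp: W_def)
  have cW: "dyadic_cover (W n) = dyadic_cover (V n)" for n
    unfolding W_def by (rule maximal_labels_cover[OF V])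
  have bound: "?w (W n) \<le> ?N (A n) + ennreal (\<Sum>i\<le>n. \<epsilon> i)" for n
  proof (induction n)
    case 0
    have "?w (W 0) \<le> ?w (U 0)"
      using maximal_labels_subset[of "U 0"] by (intro emeasure_mono) (auto simp: W_def V_def)
    also have "\<dots> \<le> ?N (A 0) + ennreal (\<epsilon> 0)" using U(3)[of 0] by simp
    finally show ?case by simp
  next
    case (Suc n)
    \<comment> \<open>A label of \<open>V n\<close> that is maximal in \<open>V (Suc n)\<close> is
      already maximal in \<open>V n\<close>, so working with \<open>W n\<close> in place of
      \<open>V n\<close> loses nothing.\<close>
    have "W (Suc n) \<subseteq> maximal_labels (W n \<union> U (Suc n))"
    proof clarify
      fix k p assume kp: "(k, p) \<in> W (Suc n)"
      then have "(k, p) \<in> V n \<or> (k, p) \<in> U (Suc n)"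
        by (auto simp: W_def maximal_labels_def V_def atMost_Suc)
      moreover have "(m, dyadic m p) \<notin> V (Suc n)" if "m < k" for m
        using kp that by (auto simp: W_def maximal_labels_def)
      moreover have "V n \<subseteq> V (Suc n)" "U (Suc n) \<subseteq> V (Suc n)"
        by (auto simp: V_def atMost_Suc)
      moreover have "W n \<subseteq> V n" by (simp add: W_def maximal_labels_subset)
      ultimately show "(k, p) \<in> maximal_labels (W n \<union> U (Suc n))"
        unfolding W_def maximal_labels_def by blast
    qed
    then have "?w (W (Suc n)) + ?N (A n) \<le> ?w (maximal_labels (W n \<union> U (Suc n))) + ?N (A n)"
      by (intro add_right_mono emeasure_mono) auto
    also have "\<dots> \<le> ?w (W n) + ?w (U (Suc n))"
    proof (rule maximal_labels_strong_subadditive)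
      show "A n \<subseteq> dyadic_cover (W n)" unfolding cW using U(2)[of n]
        by (auto simp: V_def dyadic_cover_UN)
      show "A n \<subseteq> dyadic_cover (U (Suc n))" using U(2)[of "Suc n"] A
        by (meson incseqD le_Suc_eq order_refl order_trans)
    qed (use W U in auto)
    also have "\<dots> \<le> (?N (A n) + ennreal (\<Sum>i\<le>n. \<epsilon> i)) + (?N (A (Suc n)) + ennreal (\<epsilon> (Suc n)))"
      using Suc U(3)[of "Suc n"] by (intro add_mono) auto
    also have "\<dots> = (?N (A (Suc n)) + ennreal (\<Sum>i\<le>Suc n. \<epsilon> i)) + ?N (A n)"
      using \<epsilon> by (simp add: ac_simps less_imp_le sum_nonneg)
    \<comment> \<open>Cancelling the content of \<open>A n\<close> on both sides requires it to be
      finite.\<close>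
    finally show ?case using finA[of n]
      by (auto simp: add.commute[of _ "?N (A n)"] ennreal_add_left_cancel_le)
  qed
  \<comment> \<open>The families \<open>W n\<close> do not increase with n, since a later coarse
    cell may remove an earlier one. The sets \<open>Y \<inter> V n\<close> do increase, and they lie
    inside \<open>W n\<close>.\<close>
  define Y where "Y = maximal_labels (\<Union>n. V n)"
  have "incseq V" unfolding V_def by (intro incseq_SucI UN_mono) auto
  have Y: "Y \<subseteq> dyadic_labels" using maximal_labels_subset[of "\<Union>n. V n"] V by (auto simp: Y_def)
  have "(\<Union>n. A n) \<subseteq> dyadic_cover Y"
  proof -
    have "(\<Union>n. V n) \<subseteq> dyadic_labels" using V by blast
    then have "dyadic_cover Y = (\<Union>n. dyadic_cover (V n))"
      unfolding Y_def by (simp add: maximal_labels_cover dyadic_cover_UN)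
    moreover have "A n \<subseteq> dyadic_cover (V n)" for n
      using U(2)[of n] by (auto simp: V_def dyadic_cover_UN)
    ultimately show ?thesis by blast
  qed
  then have "?N (\<Union>n. A n) \<le> ?w Y" using Y by (intro dyadic_content_le)
  also have "?w Y = (SUP n. ?w (Y \<inter> V n))"
  proof -
    have "incseq (\<lambda>n. Y \<inter> V n)" using \<open>incseq V\<close> by (auto simp: incseq_def)
    then have "(SUP n. ?w (Y \<inter> V n)) = ?w (\<Union>n. Y \<inter> V n)"
      by (intro SUP_emeasure_incseq) auto
    also have "(\<Union>n. Y \<inter> V n) = Y"
      using maximal_labels_subset[of "\<Union>n. V n"] unfolding Y_def by blast
    finally show ?thesis ..
  qed
  also have "\<dots> \<le> (SUP n. ?N (A n)) + ennreal e"
  proof (rule SUP_least)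
    fix n
    have "Y \<inter> V n \<subseteq> W n" unfolding W_def Y_def maximal_labels_def by blast
    then have "?w (Y \<inter> V n) \<le> ?w (W n)" by (rule emeasure_mono) simp
    also have "\<dots> \<le> ?N (A n) + ennreal (\<Sum>i\<le>n. \<epsilon> i)" by (rule bound)
    also have "\<dots> \<le> (SUP n. ?N (A n)) + ennreal e"
    proof (rule add_mono)
      have "(\<Sum>i\<le>n. \<epsilon> i) = e * (1 - (1/2) ^ Suc n)"
        unfolding \<epsilon>_def by (induction n) (simp_all add: field_simps)
      also have "\<dots> \<le> e" using \<open>0 < e\<close> by (simp add: mult_le_cancel_left1)
      finally show "ennreal (\<Sum>i\<le>n. \<epsilon> i) \<le> ennreal e" by (rule ennreal_leI)
    qed (rule SUP_upper, simp)
    finally show "?w (Y \<inter> V n) \<le> (SUP n. ?N (A n)) + ennreal e" .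
  qed
  finally show "?N (\<Union>n. A n) \<le> (SUP n. ?N (A n)) + ennreal e" .
qed

section \<open>Frostman measures\<close>

text \<open>Greedy cutting from the left: the piece of j has length w j unless the interval is used
  up first, in which case the remaining pieces are empty.\<close>

lemma split_interval:
  fixes w :: "'n \<Rightarrow> real"
  assumes "finite S" "\<And>j. j \<in> S \<Longrightarrow> 0 \<le> w j" "b - a \<le> sum w S"
  shows "\<exists>g. (\<forall>u\<in>{a..<b}. g u \<in> S) \<and>
             (\<forall>j\<in>S. \<exists>a' b'. {u\<in>{a..<b}. g u = j} = {a'..<b'} \<and> b' - a' \<le> w j)"
  using assms
proof (induction S arbitrary: a rule: finite_induct)
  case empty
  then show ?case by auto
next
  case (insert j S)
  show ?case
  proof (cases "b \<le> a")
    case True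
    have "\<exists>a' b'. {u\<in>{a..<b}. True} = {a'..<b'} \<and> b' - a' \<le> w i" if "i \<in> insert j S" for i
      using True insert.prems(1)[OF that] by (intro exI[of _ a]) auto
    then show ?thesis using True insert.prems(1) by (intro exI[of _ "\<lambda>_. j"]) (auto intro!: exI[of _ a])
  next
    case False
    define c where "c = min b (a + w j)"
    have c: "a \<le> c" "c \<le> b" "c - a \<le> w j" using False insert.prems(1)[of j] by (auto simp: c_def)
    have "b - c \<le> sum w S"
    proof (cases "c = b")
      case True then show ?thesis using insert.prems(1) by (simp add: sum_nonneg)
    next
      case False then show ?thesis using insert by (auto simp: c_def min_def split: if_splits)
    qed
    with insert.prems(1) have "\<exists>g. (\<forall>u\<in>{c..<b}. g u \<in> S) \<and>
        (\<forall>j\<in>S. \<exists>a' b'. {u\<in>{c..<b}. g u = j} = {a'..<b'} \<and> b' - a' \<le> w j)"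
      by (intro insert.IH) simp_all
    then obtain g where g': "\<forall>u\<in>{c..<b}. g u \<in> S"
      "\<forall>j\<in>S. \<exists>a' b'. {u\<in>{c..<b}. g u = j} = {a'..<b'} \<and> b' - a' \<le> w j"
      by (elim exE conjE)
    note g = bspec[OF g'(1)] bspec[OF g'(2)]
    define h where "h u = (if u < c then j else g u)" for u
    have "\<forall>u\<in>{a..<b}. h u \<in> insert j S"
    proof
      fix u assume "u \<in> {a..<b}"
      then show "h u \<in> insert j S" using g(1)[of u] by (cases "u < c") (simp_all add: h_def)
    qed
    moreover have "\<exists>a' b'. {u\<in>{a..<b}. h u = i} = {a'..<b'} \<and> b' - a' \<le> w i" if i: "i \<in> insert j S" for i
    proof (cases "i = j")
      case True
      have "h u \<noteq> j" if "u \<in> {c..<b}" for u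
        using g(1)[OF that] that insert.hyps(2) by (auto simp: h_def)
      then have "u \<in> {u\<in>{a..<b}. h u = j} \<longleftrightarrow> u \<in> {a..<c}" for u
        using c by (cases "u < c") (auto simp: h_def)
      then have "{u\<in>{a..<b}. h u = j} = {a..<c}" by blast
      then show ?thesis using True c by blast
    next
      case False
      have "{u\<in>{a..<b}. h u = i} = {u\<in>{c..<b}. g u = i}" using c False by (auto simp: h_def)
      then show ?thesis using g(2)[of i] i False by auto
    qed
    ultimately show ?thesis by blast
  qed
qed

text \<open>A subadditive weight on a tree dominates a measure on its branches with the same total mass.
  Lebesgue measure on an interval, split along the tree, realizes it without any compactness or
  extension theorem.\<close>

lemma interval_paths:
  fixes c :: "nat \<Rightarrow> 'n \<Rightarrow> real" and ch :: "nat \<Rightarrow> 'n \<Rightarrow> 'n set" and par :: "nat \<Rightarrow> 'n \<Rightarrow> 'n"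
  assumes fin: "\<And>n q. finite (ch n q)" and par: "\<And>n q j. j \<in> ch n q \<Longrightarrow> par n j = q"
    and nonneg: "\<And>n q. 0 \<le> c n q" and sub: "\<And>n q. c n q \<le> sum (c (Suc n)) (ch n q)"
  shows "\<exists>f. (\<forall>u. f 0 u = q0) \<and> (\<forall>n. \<forall>u\<in>{0..<c 0 q0}. f (Suc n) u \<in> ch n (f n u)) \<and>
           (\<forall>n q. \<exists>a b. {u\<in>{0..<c 0 q0}. f n u = q} = {a..<b} \<and> b - a \<le> c n q)"
proof -
  let ?I = "{0..<c 0 q0}"
  \<comment> \<open>Invariant of the recursive choice: each level set is one interval, no longer
    than the weight of its node. This is the input that \<open>split_interval\<close> needs at the
    next level.\<close>
  define P where "P n f \<longleftrightarrow> (n = 0 \<longrightarrow> f = (\<lambda>_. q0)) \<and>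
     (\<forall>q. \<exists>a b. {u\<in>?I. f u = q} = {a..<b} \<and> b - a \<le> c n q)" for n :: nat and f :: "real \<Rightarrow> 'n"
  have "\<exists>f. \<forall>n. P n (f n) \<and> (\<forall>u\<in>?I. f (Suc n) u \<in> ch n (f n u))"
  proof (rule dependent_nat_choice)
    have "\<exists>a b. {u\<in>?I. q0 = q} = {a..<b} \<and> b - a \<le> c 0 q" for q
    proof (cases "q0 = q")
      case True then show ?thesis by (intro exI[of _ 0] exI[of _ "c 0 q0"]) auto
    next
      case False then show ?thesis using nonneg[of 0 q] by (intro exI[of _ 0]) auto
    qed
    then show "\<exists>f. P 0 f" unfolding P_def by (intro exI[of _ "\<lambda>_. q0"]) blast
  next
    fix f n assume "P n f"
    then obtain a b where ab: "\<And>q. {u\<in>?I. f u = q} = {a q..<b q}" "\<And>q. b q - a q \<le> c n q"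
      unfolding P_def by metis
    have "\<exists>g. (\<forall>u\<in>{a q..<b q}. g u \<in> ch n q) \<and>
             (\<forall>j\<in>ch n q. \<exists>a' b'. {u\<in>{a q..<b q}. g u = j} = {a'..<b'} \<and> b' - a' \<le> c (Suc n) j)" for q
      using ab(2)[of q] sub[of n q] by (intro split_interval fin nonneg) linarith
    then obtain g where g: "\<And>q u. u \<in> {a q..<b q} \<Longrightarrow> g q u \<in> ch n q"
       "\<And>q j. j \<in> ch n q \<Longrightarrow> \<exists>a' b'. {u\<in>{a q..<b q}. g q u = j} = {a'..<b'} \<and> b' - a' \<le> c (Suc n) j"
      by metis
    define h where "h u = g (f u) u" for u
    have h: "h u \<in> ch n (f u)" "par n (h u) = f u" if "u \<in> ?I" for u
      using g(1)[of u "f u"] ab(1)[of "f u"] that par unfolding h_def by blast+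
    have pieces: "\<exists>a' b'. {u\<in>?I. h u = j} = {a'..<b'} \<and> b' - a' \<le> c (Suc n) j" for j
    \<comment> \<open>A node determines its parent, so its level set is cut from a single interval
      and is itself an interval.\<close>
    proof (cases "j \<in> ch n (par n j)")
      case True
      have "{u\<in>?I. h u = j} = {u\<in>{u\<in>?I. f u = par n j}. h u = j}"
        using h by auto
      also have "\<dots> = {u\<in>{u\<in>?I. f u = par n j}. g (par n j) u = j}" by (auto simp: h_def)
      also have "\<dots> = {u\<in>{a (par n j)..<b (par n j)}. g (par n j) u = j}" unfolding ab(1) ..
      finally show ?thesis using g(2)[OF True] by simp
    next
      case False
      then have "{u\<in>?I. h u = j} = {}" using h(1) h(2) by (auto simp del: atLeastLessThan_iff)
      then show ?thesis using nonneg[of "Suc n" j] by (intro exI[of _ 0]) simp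
    qed
    show "\<exists>y. P (Suc n) y \<and> (\<forall>u\<in>?I. y u \<in> ch n (f u))"
    proof (intro exI[of _ h] conjI ballI)
      show "P (Suc n) h" unfolding P_def by (intro conjI impI allI pieces) simp
    qed (rule h(1))
  qed
  then obtain f where f': "\<forall>n. P n (f n) \<and> (\<forall>u\<in>?I. f (Suc n) u \<in> ch n (f n u))"
    by (elim exE)
  note f = spec[OF f']
  show ?thesis
  proof (intro exI[of _ f] conjI allI ballI)
    show "f 0 u = q0" for u using f[of 0] by (simp add: P_def)
    show "\<exists>a b. {u\<in>?I. f n u = q} = {a..<b} \<and> b - a \<le> c n q" for n q
      using f[of n] by (simp add: P_def)
    show "f (Suc n) u \<in> ch n (f n u)" if "u \<in> ?I" for n u
      using f[of n] that by blast
  qed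
qed

text \<open>The exponent may be any real number. For s \<le> 0 the growth condition holds for every
  probability measure with C = 1, so sets of dimension 0 fit the same scheme.\<close>

definition frostman :: "real \<Rightarrow> 'a::euclidean_space measure \<Rightarrow> bool" where
  "frostman s \<mu> \<longleftrightarrow> sets \<mu> = sets borel \<and> prob_space \<mu> \<and>
     (\<exists>C>0. \<forall>x r. 0 < r \<and> r \<le> 1 \<longrightarrow> emeasure \<mu> (cball x r) \<le> ennreal (C * r powr s))"

lemma dyadic_scale:
  assumes "0 < r" "r \<le> (1::real)"
  obtains n :: nat where "1 / 2 ^ Suc n < r" "r \<le> 1 / 2 ^ n"
proof -
  have ex: "\<exists>n. 1 / 2 ^ Suc n < r"
  proof -
    obtain n where "(1/2) ^ n < r" using real_arch_pow_inv[of r "1/2"] assms by auto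
    moreover have "(1/2::real) ^ Suc n \<le> (1/2) ^ n" by (simp add: power_decreasing)
    ultimately show ?thesis by (intro exI[of _ n]) (simp add: power_divide)
  qed
  define n where "n = (LEAST n. 1 / 2 ^ Suc n < r)"
  have 1: "1 / 2 ^ Suc n < r" unfolding n_def by (rule LeastI_ex[OF ex])
  have 2: "r \<le> 1 / 2 ^ n"
  proof (cases n)
    case 0 then show ?thesis using assms by simp
  next
    case (Suc m)
    then have "\<not> 1 / 2 ^ Suc m < r" unfolding n_def by (intro not_less_Least) simp
    then show ?thesis using Suc by simp
  qed
  show ?thesis using that 1 2 by blast
qed

text \<open>The content of K inside a cell serves as tree weight: it is subadditive over children
  and at most 2^(-s n). Along a branch the cells shrink to a point of K; the measure is the law of
  this point for a uniformly chosen u. A ball meets boundedly many cells of comparable size.\<close>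

lemma frostman_compact:
  fixes K :: "'a::euclidean_space set"
  assumes K: "compact K" and pos: "dyadic_content s K > 0" and s: "0 < s"
  shows "\<exists>\<mu>. frostman s \<mu> \<and> emeasure \<mu> K = 1"
proof -
  let ?cell = "\<lambda>n q. {y::'a. dyadic n y = q}"
  let ?d = "real DIM('a)"
  define c where "c n q = enn2real (dyadic_content s (K \<inter> ?cell n q))" for n q
  \<comment> \<open>Only children that meet K are kept: the branching is finite and every branch
    stays close to K.\<close>
  define ch where "ch n q = dyadic (Suc n) ` (K \<inter> ?cell n q)" for n and q :: 'a
  have c_le: "dyadic_content s (K \<inter> ?cell n q) \<le> ennreal (2 powr (- s * real n))" for n q
  proof (cases "q \<in> range (dyadic n)")
    case True
    then obtain x where "q = dyadic n x" by blast
    then show ?thesis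
      using dyadic_content_mono[of "K \<inter> ?cell n q" "?cell n q" s] dyadic_content_cell[of s n x]
      by (meson inf_le2 order_trans)
  next
    case False
    then have "K \<inter> ?cell n q = {}" by auto
    then show ?thesis by (simp only: dyadic_content_empty zero_le)
  qed
  then have c: "ennreal (c n q) = dyadic_content s (K \<inter> ?cell n q)" for n q
    unfolding c_def by (intro ennreal_enn2real) (metis ennreal_less_top le_less_trans)
  have c_bound: "c n q \<le> 2 powr (- s * real n)" for n q
    using c_le[of n q] unfolding c[symmetric] by simp
  have c0: "0 \<le> c n q" for n q by (simp add: c_def)
  have finK: "finite (dyadic n ` K)" for n
  proof -
    obtain B where B: "\<And>x. x \<in> K \<Longrightarrow> norm x \<le> B" using compact_imp_bounded[OF K] bounded_iff by blast
    define m where "m = \<lceil>2 ^ n * \<bar>B\<bar>\<rceil> + 1"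
    have "dyadic n ` K \<subseteq> (\<lambda>v. dyadic n 0 + (1 / 2 ^ n) *\<^sub>R v) ` offsets m"
    proof clarify
      fix x assume x: "x \<in> K"
      have "\<exists>v\<in>offsets m. dyadic n x = dyadic n 0 + (1 / 2 ^ n) *\<^sub>R v"
      proof (rule dyadic_offset)
        fix b :: 'a assume "b \<in> Basis"
        then have "\<bar>x \<bullet> b\<bar> \<le> \<bar>B\<bar>" using Basis_le_norm[of b x] B[OF x] by linarith
        then have "\<bar>2 ^ n * (x \<bullet> b)\<bar> \<le> 2 ^ n * \<bar>B\<bar>" by (simp add: abs_mult)
        then show "\<bar>\<lfloor>2 ^ n * (x \<bullet> b)\<rfloor> - \<lfloor>2 ^ n * (0 \<bullet> b)\<rfloor>\<bar> \<le> m"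
          unfolding m_def by simp linarith
      qed
      then show "dyadic n x \<in> (\<lambda>v. dyadic n 0 + (1 / 2 ^ n) *\<^sub>R v) ` offsets m" by blast
    qed
    then show ?thesis by (rule finite_subset) (intro finite_imageI finite_offsets)
  qed
  have fin: "finite (ch n q)" for n q
    unfolding ch_def by (rule finite_subset[OF _ finK[of "Suc n"]]) blast
  have par: "dyadic n j = q" if "j \<in> ch n q" for n j q
    using that by (auto simp: ch_def dyadic_dyadic)
  have sub: "c n q \<le> sum (c (Suc n)) (ch n q)" for n q
  proof -
    have "K \<inter> ?cell n q \<subseteq> (\<Union>j\<in>ch n q. K \<inter> ?cell (Suc n) j)" by (auto simp: ch_def)
    then have "dyadic_content s (K \<inter> ?cell n q) \<le> (\<Sum>j\<in>ch n q. dyadic_content s (K \<inter> ?cell (Suc n) j))"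
      using dyadic_content_UN_finite[OF fin] dyadic_content_mono order_trans by blast
    then show ?thesis unfolding c[symmetric] using c0 by (simp add: sum_nonneg)
  qed
  obtain q0 where q0: "c 0 q0 > 0" "q0 \<in> range (dyadic 0)"
  proof -
    have "K \<subseteq> (\<Union>q\<in>dyadic 0 ` K. K \<inter> ?cell 0 q)" by auto
    then have "dyadic_content s K \<le> (\<Sum>q\<in>dyadic 0 ` K. dyadic_content s (K \<inter> ?cell 0 q))"
      using dyadic_content_UN_finite[OF finK] dyadic_content_mono order_trans by blast
    then have "(\<Sum>q\<in>dyadic 0 ` K. ennreal (c 0 q)) \<noteq> 0" unfolding c using pos by auto
    then obtain q where "q \<in> dyadic 0 ` K" "ennreal (c 0 q) \<noteq> 0" by (meson sum.neutral)
    then show ?thesis using that c0 by (metis ennreal_eq_0_iff image_iff not_le rangeI)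
  qed
  obtain f where f: "\<And>u. f 0 u = q0" "\<And>n u. u \<in> {0..<c 0 q0} \<Longrightarrow> f (Suc n) u \<in> ch n (f n u)"
    "\<And>n q. \<exists>a b. {u\<in>{0..<c 0 q0}. f n u = q} = {a..<b} \<and> b - a \<le> c n q"
    using interval_paths[where ch = ch and par = dyadic and c = c and ?q0.0 = q0, OF fin par c0 sub] by blast
  define I where "I = {0..<c 0 q0}"
  have fch: "f (Suc n) u \<in> ch n (f n u)" if "u \<in> I" for n u using f(2) that by (simp add: I_def)
  have f_level: "{u\<in>I. f n u = q} \<in> sets borel"
    "emeasure lborel {u\<in>I. f n u = q} \<le> ennreal (2 powr (- s * real n))" for n q
  proof -
    obtain a b where ab: "{u\<in>I. f n u = q} = {a..<b}" "b - a \<le> c n q"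
      using f(3)[of n q] by (auto simp: I_def)
    show "{u\<in>I. f n u = q} \<in> sets borel" unfolding ab by simp
    have "emeasure lborel {a..<b} \<le> ennreal (c n q)"
      using ab(2) c0[of n q] by (cases "a \<le> b") (auto intro: ennreal_leI)
    also have "\<dots> \<le> ennreal (2 powr (- s * real n))" by (rule ennreal_leI[OF c_bound])
    finally show "emeasure lborel {u\<in>I. f n u = q} \<le> ennreal (2 powr (- s * real n))" unfolding ab(1) .
  qed
  have f_meet: "\<exists>y\<in>K. dyadic n y = f n u" if u: "u \<in> I" for n u
    using fch[OF u, of n] by (auto simp: ch_def)
  have f_dy: "dyadic n (f m u) = f n u" if u: "u \<in> I" and "n \<le> m" for n m u
    using \<open>n \<le> m\<close>
  proof (induction m rule: dec_induct)
    case base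
    from f_meet[OF u, of n] obtain y where "dyadic n y = f n u" by blast
    then show ?case by (metis dyadic_dyadic order_refl)
  next
    case (step m)
    have "dyadic n (f (Suc m) u) = dyadic n (dyadic m (f (Suc m) u))"
      using step by (simp add: dyadic_dyadic)
    also have "dyadic m (f (Suc m) u) = f m u" using par[OF fch[OF u]] .
    finally show ?case using step by simp
  qed
  have f_Cauchy: "Cauchy (\<lambda>n. f n u)" if u: "u \<in> I" for u
  proof (rule metric_CauchyI)
    fix e :: real assume "0 < e"
    have "(\<lambda>n. ?d * (1/2) ^ n) \<longlonglongrightarrow> ?d * 0"
      by (intro tendsto_mult tendsto_const LIMSEQ_power_zero) simp
    then obtain N where N: "?d * (1/2) ^ N < e / 2"
      using \<open>0 < e\<close> by (metis (no_types, lifting) eventually_sequentially half_gt_zero mult_zero_right order_refl order_tendstoD(2))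
    have "dist (f N u) (f m u) \<le> ?d * (1/2) ^ N" if "N \<le> m" for m
      using dist_dyadic[of N "f m u"] f_dy[OF u that] by (simp add: power_divide)
    then have "dist (f m u) (f N u) < e / 2" if "N \<le> m" for m
      using N that by (metis dist_commute le_less_trans)
    then have "dist (f m u) (f n u) < e" if "N \<le> m" "N \<le> n" for m n
      using that dist_triangle_half_l by blast
    then show "\<exists>M. \<forall>m\<ge>M. \<forall>n\<ge>M. dist (f m u) (f n u) < e" by blast
  qed
  define X where "X u = (if u \<in> I then lim (\<lambda>n. f n u) else q0)" for u
  have X_lim: "(\<lambda>n. f n u) \<longlonglongrightarrow> X u" if "u \<in> I" for u
    using f_Cauchy[OF that] that Cauchy_convergent_iff convergent_LIMSEQ_iff by (auto simp: X_def)
  \<comment> \<open>The limit of the corners may lie on the far face of the cell, hence \<le> in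
    both bounds. The mass of a ball is therefore counted through the cells \<open>f n u\<close>, not
    through \<open>dyadic n (X u)\<close>.\<close>
  have X_bounds: "f n u \<bullet> b \<le> X u \<bullet> b" "X u \<bullet> b \<le> f n u \<bullet> b + 1 / 2 ^ n"
    if u: "u \<in> I" and b: "b \<in> Basis" for u n b
  proof -
    have lim: "(\<lambda>m. f m u \<bullet> b) \<longlonglongrightarrow> X u \<bullet> b" by (intro tendsto_inner tendsto_const X_lim u)
    have bd: "f n u \<bullet> b \<le> f m u \<bullet> b" "f m u \<bullet> b \<le> f n u \<bullet> b + 1 / 2 ^ n" if "n \<le> m" for m
      using dyadic_inner_bounds[OF b, where n = n and x = "f m u"] f_dy[OF u that] by auto
    show "f n u \<bullet> b \<le> X u \<bullet> b"
      by (rule LIMSEQ_le_const[OF lim]) (use bd in blast)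
    show "X u \<bullet> b \<le> f n u \<bullet> b + 1 / 2 ^ n"
      by (rule LIMSEQ_le_const2[OF lim]) (use bd in blast)
  qed
  have X_K: "X u \<in> K" if u: "u \<in> I" for u
  proof -
    obtain y where y: "\<And>n. y n \<in> K" "\<And>n. dyadic n (y n) = f n u" using f_meet[OF u] by metis
    have "(\<lambda>n. dist (y n) (X u)) \<longlonglongrightarrow> 0"
    proof (rule tendsto_sandwich[of "\<lambda>_. 0" _ _ "\<lambda>n. ?d * (1/2) ^ n + dist (f n u) (X u)"])
      have "dist (y n) (X u) \<le> ?d * (1/2) ^ n + dist (f n u) (X u)" for n
        using dist_dyadic[of n "y n"] y(2)[of n] dist_triangle[of "y n" "X u" "f n u"]
        by (simp add: dist_commute power_divide)
      then show "eventually (\<lambda>n. dist (y n) (X u) \<le> ?d * (1/2) ^ n + dist (f n u) (X u)) sequentially"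
        by simp
      have "(\<lambda>n. ?d * (1/2) ^ n + dist (f n u) (X u)) \<longlonglongrightarrow> ?d * 0 + 0"
        using iffD1[OF tendsto_dist_iff X_lim[OF u]]
        by (intro tendsto_add tendsto_mult tendsto_const LIMSEQ_power_zero) auto
      then show "(\<lambda>n. ?d * (1/2) ^ n + dist (f n u) (X u)) \<longlonglongrightarrow> 0" by simp
    qed auto
    then have "y \<longlonglongrightarrow> X u" by (rule iffD2[OF tendsto_dist_iff])
    then show ?thesis using closed_sequentially[OF compact_imp_closed[OF K]] y(1) by blast
  qed
  define M where "M = uniform_measure lborel I"
  have I: "I \<in> sets borel" "emeasure lborel I = ennreal (c 0 q0)" using q0 by (auto simp: I_def)
  interpret M: prob_space M unfolding M_def
    using I q0 by (intro prob_space_uniform_measure) (auto simp: ennreal_eq_0_iff)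
  have sM: "sets M = sets borel" "space M = UNIV" by (auto simp: M_def)
  \<comment> \<open>\<open>f n\<close> is controlled only on I. With the constant value q0 elsewhere
    it has countably many values and Borel level sets, so X is a pointwise limit of Borel
    functions.\<close>
  define g where "g n u = (if u \<in> I then f n u else q0)" for n u
  have g_meas: "g n \<in> borel_measurable borel" for n
  proof -
    let ?R = "insert q0 (range (dyadic n))"
    have "g n \<in> measurable borel (count_space ?R)"
    proof (subst measurable_count_space_eq_countable, simp add: countable_range_dyadic, intro conjI ballI)
      show "g n \<in> space borel \<rightarrow> ?R"
      proof
        fix u
        show "g n u \<in> ?R"
        proof (cases "u \<in> I")
          case True
          then obtain y where "dyadic n y = f n u" using f_meet by blast
          then show ?thesis using True unfolding g_def by (metis insertI2 rangeI)
        qed (simp add: g_def)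
      qed
    next
      fix q
      have "g n -` {q} \<inter> space borel = {u\<in>I. f n u = q} \<union> (if q = q0 then - I else {})"
        by (auto simp: g_def split: if_splits)
      also have "\<dots> \<in> sets borel" using f_level(1)[of n q] I by auto
      finally show "g n -` {q} \<inter> space borel \<in> sets borel" .
    qed
    moreover have "(\<lambda>x. x) \<in> measurable (count_space ?R) borel" by simp
    ultimately have "(\<lambda>u. g n u) \<in> borel_measurable borel" by (rule measurable_compose)
    then show ?thesis .
  qed
  have X_meas[measurable]: "X \<in> borel_measurable borel"
  proof (rule borel_measurable_LIMSEQ_metric[OF g_meas])
    fix u show "(\<lambda>n. g n u) \<longlonglongrightarrow> X u"
      using X_lim[of u] by (cases "u \<in> I") (auto simp: g_def X_def)
  qed
  have X_meas'[measurable]: "X \<in> measurable M borel" using X_meas sM by (simp cong: measurable_cong_sets)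
  define \<mu> where "\<mu> = distr M borel X"
  have emu: "emeasure \<mu> B = emeasure lborel {u\<in>I. X u \<in> B} / ennreal (c 0 q0)" if "B \<in> sets borel" for B
  proof -
    have "emeasure \<mu> B = emeasure M (X -` B)"
      unfolding \<mu>_def using that by (subst emeasure_distr) (auto simp: sM)
    also have "X -` B \<in> sets borel" using measurable_sets[OF X_meas that] by simp
    then have "emeasure M (X -` B) = emeasure lborel (I \<inter> X -` B) / emeasure lborel I"
      unfolding M_def using I by (subst emeasure_uniform_measure) auto
    also have "I \<inter> X -` B = {u\<in>I. X u \<in> B}" by auto
    finally show ?thesis using I by simp
  qed
  \<comment> \<open>In units of 2^(-n): one for the radius of the ball, one for the closed cell
    containing \<open>X u\<close>, one for rounding.\<close>
  define N where "N = card (offsets 3 :: 'a set)"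
  \<comment> \<open>2 powr s pays for replacing 2^(-n) by 2 r, the denominator normalizes the mass,
    and N + 1 keeps C visibly positive.\<close>
  define C where "C = (real N + 1) * 2 powr s / c 0 q0"
  have "C > 0" using q0 unfolding C_def by (intro divide_pos_pos mult_pos_pos) auto
  moreover have "emeasure \<mu> (cball x r) \<le> ennreal (C * r powr s)" if r: "0 < r" "r \<le> 1" for x r
  proof -
    obtain n where n: "1 / 2 ^ Suc n < r" "r \<le> 1 / 2 ^ n" using dyadic_scale[OF r] .
    have "{u\<in>I. X u \<in> cball x r} \<subseteq> (\<Union>v\<in>offsets 3. {u\<in>I. f n u = dyadic n x + (1 / 2 ^ n) *\<^sub>R v})"
    proof clarify
      fix u assume u: "u \<in> I" "X u \<in> cball x r"
      have "\<exists>v\<in>offsets 3. dyadic n (f n u) = dyadic n x + (1 / 2 ^ n) *\<^sub>R v"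
      proof (rule dyadic_offset)
        fix b :: 'a assume b: "b \<in> Basis"
        define k where "k = \<lfloor>2 ^ n * (f n u \<bullet> b)\<rfloor>"
        have fk: "f n u \<bullet> b = real_of_int k / 2 ^ n"
          using f_dy[OF u(1) order_refl, of n] dyadic_inner[OF b, of n "f n u"] by (simp add: k_def)
        have "\<bar>(X u - x) \<bullet> b\<bar> \<le> norm (X u - x)" by (rule Basis_le_norm[OF b])
        also have "\<dots> \<le> 1 / 2 ^ n" using u(2) n(2) by (simp add: dist_norm norm_minus_commute)
        finally have "\<bar>X u \<bullet> b - x \<bullet> b\<bar> * 2 ^ n \<le> 1" by (simp add: inner_diff_left field_simps)
        moreover have "\<bar>2 ^ n * (X u \<bullet> b) - 2 ^ n * (x \<bullet> b)\<bar> = 2 ^ n * \<bar>X u \<bullet> b - x \<bullet> b\<bar>"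
          by (simp only: right_diff_distrib[symmetric] abs_mult) simp
        ultimately have 1: "\<bar>2 ^ n * (X u \<bullet> b) - 2 ^ n * (x \<bullet> b)\<bar> \<le> 1"
          by (simp only: mult.commute)
        have 2: "real_of_int k \<le> 2 ^ n * (X u \<bullet> b)" "2 ^ n * (X u \<bullet> b) \<le> real_of_int k + 1"
          using X_bounds[OF u(1) b, of n] unfolding fk by (auto simp: field_simps)
        have "\<bar>k - \<lfloor>2 ^ n * (x \<bullet> b)\<rfloor>\<bar> \<le> 3"
          using 1 2 by linarith
        then show "\<bar>\<lfloor>2 ^ n * (f n u \<bullet> b)\<rfloor> - \<lfloor>2 ^ n * (x \<bullet> b)\<rfloor>\<bar> \<le> 3" by (simp add: k_def)
      qed
      then show "u \<in> (\<Union>v\<in>offsets 3. {u\<in>I. f n u = dyadic n x + (1 / 2 ^ n) *\<^sub>R v})"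
        using f_dy[OF u(1) order_refl, of n] u(1) by auto
    qed
    then have "emeasure lborel {u\<in>I. X u \<in> cball x r}
        \<le> emeasure lborel (\<Union>v\<in>offsets 3. {u\<in>I. f n u = dyadic n x + (1 / 2 ^ n) *\<^sub>R v})"
      using f_level(1) by (intro emeasure_mono) (auto simp: finite_offsets)
    also have "\<dots> \<le> (\<Sum>v\<in>offsets 3. emeasure lborel {u\<in>I. f n u = dyadic n x + (1 / 2 ^ n) *\<^sub>R v})"
      using f_level(1) by (intro emeasure_subadditive_finite finite_offsets) auto
    also have "\<dots> \<le> (\<Sum>v\<in>(offsets 3 :: 'a set). ennreal (2 powr (- s * real n)))"
      by (intro sum_mono f_level(2))
    also have "\<dots> = ennreal (real N * 2 powr (- s * real n))"
      by (simp add: N_def ennreal_mult ennreal_of_nat_eq_real_of_nat)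
    also have "\<dots> \<le> ennreal ((real N + 1) * (2 powr s * r powr s))"
    proof (intro ennreal_leI mult_mono)
      have "2 powr (- s * real n) = (1 / 2 ^ n) powr s"
        by (simp add: powr_divide powr_powr powr_realpow[symmetric] powr_minus_divide mult.commute)
      also have "\<dots> \<le> (2 * r) powr s"
        using n s by (intro powr_mono2) (auto simp: field_simps)
      finally show "2 powr (- s * real n) \<le> 2 powr s * r powr s" using r by (simp add: powr_mult)
    qed auto
    finally have "emeasure lborel {u\<in>I. X u \<in> cball x r} / ennreal (c 0 q0)
         \<le> ennreal ((real N + 1) * (2 powr s * r powr s)) / ennreal (c 0 q0)"
      by (rule divide_right_mono_ennreal)
    also have "\<dots> = ennreal (C * r powr s)"
      using q0 by (subst divide_ennreal) (auto simp: C_def)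
    finally show ?thesis by (subst emu) auto
  qed
  moreover have "prob_space \<mu>" unfolding \<mu>_def by (rule M.prob_space_distr) measurable
  moreover have "emeasure \<mu> K = 1"
  proof -
    have "{u\<in>I. X u \<in> K} = I" using X_K by auto
    then show ?thesis using emu[of K] K q0 I by (simp add: borel_compact)
  qed
  ultimately show ?thesis unfolding frostman_def by (intro exI[of _ \<mu>]) (auto simp: \<mu>_def)
qed

section \<open>Frostman's lemma for Borel sets\<close>

lemma emeasure_cover_weight:
  "emeasure (cover_weight s) U = (\<integral>\<^sup>+l. ennreal (2 powr (- s * real (fst l))) \<partial>count_space U)"
  unfolding cover_weight_def
  by (subst emeasure_density) (auto simp: nn_integral_count_space_indicator case_prod_unfold)

text \<open>A union of half-open cells need not be open. Widening each cell by its own side length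
  in all directions makes it open, and the result is covered by the translates of the family by
  \<open>offsets 1\<close>, each of the original weight.\<close>

lemma dyadic_content_neighbourhood:
  assumes "U \<subseteq> dyadic_labels"
  obtains O' :: "'a::euclidean_space set" where "open O'" "dyadic_cover U \<subseteq> O'"
    "dyadic_content s O' \<le> of_nat (card (offsets 1 :: 'a set)) * emeasure (cover_weight s) U"
proof -
  define B :: "nat \<times> 'a \<Rightarrow> 'a set" where
    "B l = {y. \<forall>b\<in>Basis. snd l \<bullet> b - 1 / 2 ^ fst l < y \<bullet> b \<and> y \<bullet> b < snd l \<bullet> b + 2 / 2 ^ fst l}" for l
  define O' where "O' = (\<Union>l\<in>U. B l)"
  define sh :: "'a \<Rightarrow> nat \<times> 'a \<Rightarrow> nat \<times> 'a" where
    "sh v l = (fst l, snd l + (1 / 2 ^ fst l) *\<^sub>R v)" for v l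
  define V where "V = (\<Union>v\<in>offsets 1. sh v ` U)"
  have "open (B l)" for l
  proof -
    have "B l = (\<Inter>b\<in>Basis. {y. snd l \<bullet> b - 1 / 2 ^ fst l < y \<bullet> b} \<inter> {y. y \<bullet> b < snd l \<bullet> b + 2 / 2 ^ fst l})"
      by (auto simp: B_def)
    then show ?thesis
      by (simp only:) (intro open_INT open_Int ballI open_Collect_less continuous_intros finite_Basis)
  qed
  then have 1: "open O'" unfolding O'_def by (intro open_UN ballI)
  have 2: "dyadic_cover U \<subseteq> O'"
  proof
    fix x assume "x \<in> dyadic_cover U"
    then obtain n where n: "(n, dyadic n x) \<in> U" by (auto simp: dyadic_cover_def)
    have "x \<in> B (n, dyadic n x)"
      unfolding B_def mem_Collect_eq
    proof
      fix b :: 'a assume b: "b \<in> Basis"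
      have p: "(0::real) < 1 / 2 ^ n" by simp
      from dyadic_inner_bounds[OF b, where n = n and x = x] p
      show "snd (n, dyadic n x) \<bullet> b - 1 / 2 ^ fst (n, dyadic n x) < x \<bullet> b \<and>
         x \<bullet> b < snd (n, dyadic n x) \<bullet> b + 2 / 2 ^ fst (n, dyadic n x)"
        unfolding fst_conv snd_conv by linarith
    qed
    then show "x \<in> O'" using n by (auto simp: O'_def)
  qed
  have weight_sh: "emeasure (cover_weight s) (sh v ` U) = emeasure (cover_weight s) U" for v
  proof -
    have "bij_betw (sh v) U (sh v ` U)"
      by (intro inj_on_imp_bij_betw inj_onI) (auto simp: sh_def prod_eq_iff)
    from nn_integral_bij_count_space[OF this, of "\<lambda>l. ennreal (2 powr (- s * real (fst l)))"]
    show ?thesis unfolding emeasure_cover_weight by (simp add: sh_def)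
  qed
  have "O' \<subseteq> dyadic_cover (V \<inter> dyadic_labels)"
  proof
    fix y assume "y \<in> O'"
    then obtain n p where np: "(n, p) \<in> U" "y \<in> B (n, p)" by (auto simp: O'_def)
    then obtain x where x: "p = dyadic n x" using assms by (auto simp: dyadic_labels_def)
    have "\<exists>v\<in>offsets 1. dyadic n y = dyadic n x + (1 / 2 ^ n) *\<^sub>R v"
    proof (rule dyadic_offset)
      fix b :: 'a assume b: "b \<in> Basis"
      define k where "k = \<lfloor>2 ^ n * (x \<bullet> b)\<rfloor>"
      have "real_of_int k / 2 ^ n - 1 / 2 ^ n < y \<bullet> b" "y \<bullet> b < real_of_int k / 2 ^ n + 2 / 2 ^ n"
        using np(2) b unfolding B_def x by (auto simp: dyadic_inner k_def)
      then have "real_of_int k - 1 < 2 ^ n * (y \<bullet> b)" "2 ^ n * (y \<bullet> b) < real_of_int k + 2"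
        by (auto simp: field_simps)
      then show "\<bar>\<lfloor>2 ^ n * (y \<bullet> b)\<rfloor> - \<lfloor>2 ^ n * (x \<bullet> b)\<rfloor>\<bar> \<le> 1"
        unfolding k_def[symmetric] by linarith
    qed
    then obtain v where v: "v \<in> offsets 1" "dyadic n y = p + (1 / 2 ^ n) *\<^sub>R v" unfolding x by blast
    then have "(n, dyadic n y) = sh v (n, p)" by (simp add: sh_def)
    then have "(n, dyadic n y) \<in> V" using np(1) v(1) unfolding V_def by blast
    then show "y \<in> dyadic_cover (V \<inter> dyadic_labels)"
      by (auto simp: dyadic_cover_def dyadic_labels_def)
  qed
  then have "dyadic_content s O' \<le> emeasure (cover_weight s) (V \<inter> dyadic_labels)"
    by (intro dyadic_content_le) auto
  also have "\<dots> \<le> emeasure (cover_weight s) V" by (intro emeasure_mono) auto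
  also have "\<dots> \<le> (\<Sum>v\<in>offsets 1. emeasure (cover_weight s) (sh v ` U))"
    unfolding V_def by (intro emeasure_subadditive_finite finite_offsets) auto
  also have "\<dots> = of_nat (card (offsets 1 :: 'a set)) * emeasure (cover_weight s) U"
    by (simp add: weight_sh)
  finally have "dyadic_content s O' \<le> of_nat (card (offsets 1 :: 'a set)) * emeasure (cover_weight s) U" .
  then show ?thesis using that 1 2 by blast
qed

text \<open>A cover of K of weight below c / (N + 1) would enlarge to an open neighbourhood of
  content at most c. In this way the conclusion of \<open>capacitability\<close>, which concerns
  neighbourhoods, reaches K itself.\<close>

lemma dyadic_content_compact_pos:
  fixes K :: "'a::euclidean_space set"
  assumes K: "\<And>U. open U \<Longrightarrow> K \<subseteq> U \<Longrightarrow> ennreal c < dyadic_content s U" and c: "0 < c"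
  shows "0 < dyadic_content s K"
proof (rule ccontr)
  let ?N = "card (offsets 1 :: 'a set)"
  assume "\<not> ?thesis"
  then have "dyadic_content s K = 0" by (simp add: not_gr_zero)
  then have "dyadic_content s K < ennreal (c / (?N + 1))" using c by simp
  then obtain U where U: "U \<subseteq> dyadic_labels" "K \<subseteq> dyadic_cover U"
    "emeasure (cover_weight s) U < ennreal (c / (?N + 1))"
    by (rule dyadic_content_approx)
  obtain O' :: "'a set" where O': "open O'" "dyadic_cover U \<subseteq> O'"
    "dyadic_content s O' \<le> of_nat ?N * emeasure (cover_weight s) U"
    using dyadic_content_neighbourhood[OF U(1)] .
  have "of_nat ?N * emeasure (cover_weight s) U \<le> ennreal (real ?N) * ennreal (c / (?N + 1))"
    using U(3) by (intro mult_mono) (auto simp: ennreal_of_nat_eq_real_of_nat)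
  also have "\<dots> = ennreal (real ?N * (c / (?N + 1)))" using c by (intro ennreal_mult[symmetric]) auto
  also have "\<dots> \<le> ennreal c" using c by (intro ennreal_leI) (auto simp: field_simps)
  finally have "dyadic_content s O' \<le> ennreal c" using O'(3) by (rule order_trans[rotated])
  moreover have "ennreal c < dyadic_content s O'" using O' U by (intro K) auto
  ultimately show False by simp
qed

text \<open>The weight of each single cell is at most the total weight, so for s > 0 a family of
  small total weight consists of small cells and satisfies any prescribed mesh condition
  automatically.\<close>

lemma hausdorff_measure_eq_0_if_dyadic_content:
  fixes A :: "'a::euclidean_space set"
  assumes A: "dyadic_content s A = 0" and s: "0 < s"
  shows "hausdorff_measure s A = 0"
proof -
  define D where "D = 2 * real DIM('a)"
  have D: "0 < D" by (simp add: D_def)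
  have "hausdorff_premeasure s \<delta> A \<le> ennreal e" if \<delta>: "0 < \<delta>" and e: "0 < e" for \<delta> e
  proof -
    \<comment> \<open>The first term bounds the sum of the gauges by e, the second forces all
      diameters below \<delta>; a cell of generation n has diameter at most D / 2^n.\<close>
    define \<eta> where "\<eta> = min (e / D powr s) ((\<delta> / D) powr s)"
    have "0 < \<eta>" using D e \<delta> by (simp add: \<eta>_def)
    then obtain U where U: "U \<subseteq> dyadic_labels" "A \<subseteq> dyadic_cover U" "emeasure (cover_weight s) U < ennreal \<eta>"
      using A dyadic_content_approx[of s A "ennreal \<eta>"] by auto
    have cU: "countable U" using U(1) countable_dyadic_labels by (rule countable_subset)
    have small: "D / 2 ^ fst l \<le> \<delta>" if "l \<in> U" for l
    proof (rule ccontr)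
      assume "\<not> ?thesis"
      then have "\<delta> / D < 1 / 2 ^ fst l" using D by (simp add: field_simps)
      then have "(\<delta> / D) powr s < (1 / 2 ^ fst l) powr s" using \<delta> D s by (intro powr_less_mono2) auto
      also have "\<dots> = 2 powr (- s * real (fst l))"
        by (simp add: powr_divide powr_powr powr_realpow[symmetric] powr_minus_divide mult.commute)
      finally have "ennreal \<eta> \<le> ennreal (2 powr (- s * real (fst l)))"
        by (intro ennreal_leI) (auto simp: \<eta>_def)
      also have "\<dots> = emeasure (cover_weight s) {l}"
        using emeasure_cover_weight_singleton[of s "fst l" "snd l"] by simp
      also have "\<dots> \<le> emeasure (cover_weight s) U" using that by (intro emeasure_mono) auto
      finally show False using U(3) by simp
    qed
    define I where "I = to_nat_on U ` U"
    have bij: "bij_betw (to_nat_on U) U I"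
      unfolding I_def using cU by (intro inj_on_imp_bij_betw inj_on_to_nat_on)
    define cell where "cell l = {y::'a. dyadic (fst l) y = snd l}" for l :: "nat \<times> 'a"
    define W where "W i = (if i \<in> I then cell (from_nat_into U i) else {})" for i
    have WU: "\<exists>l\<in>U. W i = cell l" if "i \<in> I" for i
      using that cU by (auto simp: W_def I_def)
    have cell: "bounded (cell l)" "diameter (cell l) \<le> D / 2 ^ fst l" for l
      unfolding cell_def D_def using diameter_dyadic_cell[of "fst l" "snd l"] by simp_all
    have "A \<subseteq> (\<Union>i. W i)"
    proof
      fix x assume "x \<in> A"
      then obtain n where n: "(n, dyadic n x) \<in> U" using U(2) by (auto simp: dyadic_cover_def)
      have "x \<in> W (to_nat_on U (n, dyadic n x))"
        using n cU by (auto simp: W_def I_def cell_def)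
      then show "x \<in> (\<Union>i. W i)" by blast
    qed
    moreover have "bounded (W i) \<and> diameter (W i) \<le> \<delta>" for i
    proof (cases "i \<in> I")
      case True
      then obtain l where "l \<in> U" "W i = cell l" using WU by blast
      then show ?thesis using cell[of l] small[of l] by simp
    next
      case False then show ?thesis using \<delta> by (simp add: W_def)
    qed
    ultimately have "hausdorff_premeasure s \<delta> A \<le> (\<Sum>i. hausdorff_gauge s (W i))"
      unfolding hausdorff_premeasure_def by (intro INF_lower) auto
    also have "\<dots> = (\<integral>\<^sup>+i. hausdorff_gauge s (W i) \<partial>count_space UNIV)"
      by (simp add: nn_integral_count_space_nat)
    also have "\<dots> = (\<integral>\<^sup>+i. hausdorff_gauge s (cell (from_nat_into U i)) \<partial>count_space I)"
      by (subst (2) nn_integral_count_space_indicator)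
         (auto intro!: nn_integral_cong simp: W_def hausdorff_gauge_def split: split_indicator)
    also have "\<dots> = (\<integral>\<^sup>+l. hausdorff_gauge s (cell (from_nat_into U (to_nat_on U l))) \<partial>count_space U)"
      by (rule nn_integral_bij_count_space[OF bij, symmetric])
    also have "\<dots> \<le> (\<integral>\<^sup>+l. ennreal (D powr s) * ennreal (2 powr (- s * real (fst l))) \<partial>count_space U)"
    proof (rule nn_integral_mono)
      fix l assume "l \<in> space (count_space U)"
      then have l: "from_nat_into U (to_nat_on U l) = l" using cU by simp
      have "hausdorff_gauge s (cell l) \<le> ennreal (diameter (cell l) powr s)"
        using s by (simp add: hausdorff_gauge_def)
      also have "\<dots> \<le> ennreal ((D / 2 ^ fst l) powr s)"
        using cell[of l] s by (intro ennreal_leI powr_mono2) (auto simp: diameter_ge_0)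
      also have "(D / 2 ^ fst l) powr s = D powr s * 2 powr (- s * real (fst l))"
        using D by (simp add: powr_divide powr_powr powr_realpow[symmetric] powr_minus_divide mult.commute)
      finally show "hausdorff_gauge s (cell (from_nat_into U (to_nat_on U l))) \<le> ennreal (D powr s) * ennreal (2 powr (- s * real (fst l)))"
        unfolding l by (simp add: ennreal_mult)
    qed
    also have "\<dots> = ennreal (D powr s) * emeasure (cover_weight s) U"
      by (subst nn_integral_cmult) (auto simp: emeasure_cover_weight)
    also have "\<dots> \<le> ennreal (D powr s) * ennreal (e / D powr s)"
      using U(3) by (intro mult_left_mono order_trans[OF less_imp_le[OF U(3)]] ennreal_leI) (auto simp: \<eta>_def)
    also have "\<dots> = ennreal e" using D e by (simp add: ennreal_mult[symmetric])
    finally show ?thesis .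
  qed
  then have "hausdorff_premeasure s \<delta> A = 0" if "0 < \<delta>" for \<delta>
    using that by (metis ennreal_le_epsilon add_0 le_zero_eq)
  then show ?thesis unfolding hausdorff_measure_def by (simp add: SUP_eq_const)
qed

theorem frostman_borel:
  fixes A :: "'a::euclidean_space set"
  assumes A: "A \<in> sets borel" "A \<noteq> {}" and s: "ereal s < hausdorff_dim A"
  obtains K \<mu> where "compact K" "K \<subseteq> A" "frostman s \<mu>" "emeasure \<mu> K = 1"
\<comment> \<open>For s \<le> 0 a Dirac mass will do, since r powr s \<ge> 1 for 0 < r \<le>
  1.\<close>
proof (cases "s \<le> 0")
  case True
  obtain a where a: "a \<in> A" using A by blast
  have "emeasure (return borel a) (cball x r) \<le> ennreal (1 * r powr s)" if "0 < r" "r \<le> 1" for x r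
  proof -
    have "1 \<le> r powr s" using that True powr_mono2'[of s r 1] by simp
    then have "1 \<le> ennreal (1 * r powr s)" by simp
    moreover have "emeasure (return borel a) (cball x r) \<le> 1" by (simp add: indicator_def)
    ultimately show ?thesis by (rule order_trans[rotated])
  qed
  then have "frostman s (return borel a)"
    unfolding frostman_def using prob_space_return[of a borel]
    by (intro conjI exI[of _ 1]) auto
  then show ?thesis using that[of "{a}" "return borel a"] a by simp
next
  case False
  then have s0: "0 < s" by simp
  have "hausdorff_measure s A \<noteq> 0"
  proof
    assume "hausdorff_measure s A = 0"
    then have "hausdorff_dim A \<le> ereal s"
      unfolding hausdorff_dim_def using s0 by (intro Inf_lower) auto
    then show False using s by simp
  qed
  then have "dyadic_content s A \<noteq> 0" using hausdorff_measure_eq_0_if_dyadic_content s0 by blast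
  then obtain c where c: "0 < c" "c < dyadic_content s A" by (meson dense gr_zeroI)
  then obtain c' where c': "c = ennreal c'" "0 < c'"
    by (cases c) auto
  obtain K where K: "compact K" "K \<subseteq> A" "\<And>U. open U \<Longrightarrow> (\<lambda>x. x) ` K \<subseteq> U \<Longrightarrow> c < dyadic_content s U"
  proof (rule capacitability[of "dyadic_content s" "\<lambda>x. x" A c])
    show "analytic A" using A(1) by (rule borel_imp_analytic)
  qed (use c in \<open>auto intro: dyadic_content_mono dyadic_content_incseq\<close>)
  have "0 < dyadic_content s K"
    using K(3) c' by (intro dyadic_content_compact_pos[of K c' s]) auto
  from frostman_compact[OF K(1) this s0] show ?thesis using that K by blast
qed

section \<open>Lebesgue measurability of continuous images of analytic sets\<close>

text \<open>Outer regularity, used to carry the bound that \<open>capacitability\<close> gives for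
  open neighbourhoods over to the compact image, at the price of strictness.\<close>

lemma emeasure_compact_ge:
  fixes S :: "'a::euclidean_space set"
  assumes S: "S \<in> sets borel" and U: "\<And>U. open U \<Longrightarrow> S \<subseteq> U \<Longrightarrow> c < emeasure lborel U"
  shows "c \<le> emeasure lborel S"
proof (rule ccontr)
  assume "\<not> ?thesis"
  then have lt: "emeasure lborel S < c" by simp
  then obtain e where e: "0 < e" "emeasure lborel S + ennreal e \<le> c"
  proof (cases c)
    case (real c')
    then obtain a where a: "emeasure lborel S = ennreal a" "0 \<le> a" "a < c'"
      using lt by (cases "emeasure lborel S") (auto simp: ennreal_less_iff)
    then show ?thesis using real that[of "c' - a"] by (simp add: ennreal_plus[symmetric] del: ennreal_plus)
  qed (use that[of 1] in auto)
  obtain T where T: "open T" "S \<subseteq> T" "emeasure lebesgue (T - S) < ennreal e"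
    using sets_lebesgue_outer_open[of S e] S e by auto
  have "emeasure lborel T = emeasure lborel S + emeasure lborel (T - S)"
    using T S by (subst plus_emeasure) (auto intro: arg_cong[where f = "emeasure lborel"])
  also have "\<dots> \<le> emeasure lborel S + ennreal e"
    using T S by (intro add_left_mono) simp
  also have "\<dots> \<le> c" by (rule e)
  finally show False using U[OF T(1,2)] by simp
qed

lemma analytic_Int_closed:
  assumes "analytic A" "closed F" shows "analytic (A \<inter> F)"
proof -
  have eq: "A \<inter> F = (\<Inter>n::nat. if n = 0 then A else F)" by (auto split: if_splits)
  show ?thesis unfolding eq using assms by (intro analytic_INT) (simp add: closed_imp_analytic)
qed

text \<open>Outer Lebesgue measure is continuous along increasing sequences of arbitrary sets, so
  \<open>capacitability\<close> applies to it: images of compact subsets exhaust the outer measure.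
  A countable union of them differs from a Borel hull by a null set.\<close>

theorem analytic_image_lebesgue:
  fixes f :: "'a::euclidean_space \<Rightarrow> 'b::euclidean_space"
  assumes A: "analytic A" and f: "continuous_on UNIV f"
  shows "f ` A \<in> sets lebesgue"
proof -
  \<comment> \<open>Boundedness makes the measure of the hull finite, so that it can be
    subtracted.\<close>
  have bdd: "f ` A' \<in> sets lebesgue" if A': "analytic A'" "bounded (f ` A')" for A'
  proof -
    let ?o = "outer_measure_of (lborel :: 'b measure)" and ?K = "{K. compact K \<and> K \<subseteq> A'}"
    have bK: "f ` K \<in> sets borel" if "K \<in> ?K" for K
      using that compact_continuous_image[OF continuous_on_subset[OF f]] by (auto intro: borel_compact)
    have ge: "?o (f ` A') \<le> (SUP K\<in>?K. emeasure lborel (f ` K))"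
    proof (rule dense_le)
      fix c assume c: "c < ?o (f ` A')"
      obtain K where K: "compact K" "K \<subseteq> A'" "\<And>U. open U \<Longrightarrow> f ` K \<subseteq> U \<Longrightarrow> c < ?o U"
      proof (rule capacitability[of ?o f A' c])
        show "?o (\<Union>n. B n) \<le> (SUP n. ?o (B n))" if "incseq B" for B :: "nat \<Rightarrow> 'b set"
          using SUP_outer_measure_of_incseq[OF _ that, of lborel] by simp
      qed (use c A' f in \<open>auto intro: outer_measure_of_mono\<close>)
      have "c \<le> emeasure lborel (f ` K)"
        using K(3) bK K(1,2) by (intro emeasure_compact_ge) (auto simp: outer_measure_of_eq)
      also have "\<dots> \<le> (SUP K\<in>?K. emeasure lborel (f ` K))" using K by (intro SUP_upper) auto
      finally show "c \<le> (SUP K\<in>?K. emeasure lborel (f ` K))" .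
    qed
    have "?K \<noteq> {}" by (intro CollectI ex_in_conv[THEN iffD1] exI[of _ "{}"]) auto
    then obtain g :: "nat \<Rightarrow> ennreal" where g: "range g \<subseteq> (\<lambda>K. emeasure lborel (f ` K)) ` ?K"
      "(SUP K\<in>?K. emeasure lborel (f ` K)) = (SUP n. g n)"
      using ennreal_SUP_countable_SUP[of ?K "\<lambda>K. emeasure lborel (f ` K)"] by auto
    have "\<exists>K\<in>?K. g n = emeasure lborel (f ` K)" for n using g(1) by blast
    then obtain K where K: "\<And>n. K n \<in> ?K" "\<And>n. g n = emeasure lborel (f ` K n)" by metis
    define L where "L = (\<Union>n. f ` K n)"
    have L: "L \<in> sets borel" "L \<subseteq> f ` A'" unfolding L_def using bK K(1) by auto
    have "(SUP n. g n) \<le> emeasure lborel L"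
      unfolding K(2) using L(1) by (intro SUP_least emeasure_mono) (auto simp: L_def)
    with ge have oL: "?o (f ` A') \<le> emeasure lborel L" unfolding g(2) by simp
    obtain B where B: "B \<in> sets borel" "f ` A' \<subseteq> B" "?o (f ` A') = emeasure lborel B"
      using outer_measure_of_attain[of "f ` A'" lborel] by auto
    obtain r where r: "f ` A' \<subseteq> cball 0 r" using A'(2) by (fastforce simp: bounded_iff)
    have "emeasure lborel B \<le> emeasure lborel (cball (0::'b) r)"
      using outer_measure_of_mono[OF r, of lborel] unfolding B(3)[symmetric] by simp
    also have "\<dots> < \<infinity>" by (rule emeasure_lborel_cball_finite)
    finally have fin: "emeasure lborel B \<noteq> \<infinity>" by simp
    have "emeasure lborel L \<le> emeasure lborel B" using L B by (intro emeasure_mono) auto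
    then have eq: "emeasure lborel L = emeasure lborel B" using oL B(3) by simp
    then have "emeasure lborel (B - L) = emeasure lborel B - emeasure lborel L"
      using L B fin by (intro emeasure_Diff) auto
    then have "B - L \<in> null_sets lborel" using eq fin B L by (intro null_setsI) auto
    then show ?thesis using L B
      by (intro sets_completionI[of _ L "f ` A' - L" "B - L"]) auto
  qed
  have "f ` A = (\<Union>n::nat. f ` (A \<inter> f -` cball 0 (real n)))"
  proof (intro set_eqI iffI)
    fix y assume "y \<in> f ` A"
    then obtain x where x: "x \<in> A" "y = f x" by blast
    obtain n :: nat where "norm (f x) \<le> real n" using real_arch_simple by blast
    then have "y \<in> f ` (A \<inter> f -` cball 0 (real n))" using x by auto
    then show "y \<in> (\<Union>n::nat. f ` (A \<inter> f -` cball 0 (real n)))" by blast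
  qed auto
  also have "\<dots> \<in> sets lebesgue"
  proof (intro sets.countable_UN subsetI)
    fix S assume "S \<in> range (\<lambda>n::nat. f ` (A \<inter> f -` cball 0 (real n)))"
    then obtain n :: nat where S: "S = f ` (A \<inter> f -` cball 0 (real n))" by blast
    have "closed (f -` cball 0 (real n))" using f by (intro closed_vimage) auto
    moreover have "bounded S" unfolding S by (rule bounded_subset[OF bounded_cball]) auto
    ultimately show "S \<in> sets lebesgue" unfolding S by (intro bdd analytic_Int_closed A) auto
  qed
  finally show ?thesis .
qed

section \<open>Gaussian measure and mollification\<close>

definition gauss :: "'a::euclidean_space measure" where
  "gauss = density lborel (\<lambda>x. ennreal (exp (- (norm x)\<^sup>2 / 2) / sqrt (2 * pi) ^ DIM('a)))"

lemma sets_gauss[simp, measurable_cong]: "sets gauss = sets borel"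
  and space_gauss[simp]: "space gauss = UNIV"
  by (simp_all add: gauss_def)

lemma norm_square_Basis: "(norm (x::'a::euclidean_space))\<^sup>2 = (\<Sum>b\<in>Basis. (x \<bullet> b)\<^sup>2)"
  by (subst power2_norm_eq_inner, subst euclidean_inner) (simp add: power2_eq_square)

lemma gauss_density_prod:
  fixes x :: "'a::euclidean_space"
  shows "exp (- (norm x)\<^sup>2 / 2) / sqrt (2 * pi) ^ DIM('a) = (\<Prod>b\<in>Basis. std_normal_density (x \<bullet> b))"
proof -
  have "(norm x)\<^sup>2 = (\<Sum>b\<in>Basis. (x \<bullet> b)\<^sup>2)"
    by (rule norm_square_Basis)
  then have "exp (- (norm x)\<^sup>2 / 2) = (\<Prod>b\<in>Basis. exp (- (x \<bullet> b)\<^sup>2 / 2))"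
    by (simp add: exp_sum[symmetric] sum_negf sum_divide_distrib)
  then show ?thesis
    by (simp add: std_normal_density_def prod_dividef)
qed

lemma integral_lborel_prod:
  fixes f :: "'a::euclidean_space \<Rightarrow> real \<Rightarrow> complex"
  assumes "\<And>b. b \<in> Basis \<Longrightarrow> integrable lborel (f b)"
  shows "(\<integral>x. (\<Prod>b\<in>Basis. f b (x \<bullet> b)) \<partial>(lborel :: 'a measure)) = (\<Prod>b\<in>Basis. \<integral>x. f b x \<partial>lborel)"
proof -
  interpret product_sigma_finite "\<lambda>_::'a. lborel :: real measure" ..
  have [measurable]: "f b \<in> borel_measurable borel" if "b \<in> Basis" for b
    using borel_measurable_integrable[OF assms[OF that]] by simp
  have "(\<integral>x. (\<Prod>b\<in>Basis. f b (x \<bullet> b)) \<partial>(lborel :: 'a measure)) =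
     (\<integral>g. (\<Prod>b\<in>Basis. f b ((\<Sum>i\<in>Basis. g i *\<^sub>R i) \<bullet> b)) \<partial>(\<Pi>\<^sub>M b\<in>(Basis::'a set). lborel))"
    by (subst lborel_eq, subst integral_distr) auto
  also have "\<dots> = (\<integral>g. (\<Prod>b\<in>Basis. f b (g b)) \<partial>(\<Pi>\<^sub>M b\<in>(Basis::'a set). lborel))"
    by (intro Bochner_Integration.integral_cong prod.cong refl) simp
  also have "\<dots> = (\<Prod>b\<in>Basis. \<integral>x. f b x \<partial>lborel)"
    using assms by (intro product_integral_prod) auto
  finally show ?thesis .
qed

lemma gauss_char:
  fixes t :: "'a::euclidean_space"
  shows "(\<integral>x. iexp (t \<bullet> x) \<partial>gauss) = complex_of_real (exp (- (norm t)\<^sup>2 / 2))"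
proof -
  have int: "integrable lborel (\<lambda>x. complex_of_real (std_normal_density x) * iexp (s * x))" for s
  proof (rule Bochner_Integration.integrable_bound)
    show "integrable lborel std_normal_density" by simp
  qed (auto simp: norm_mult)
  have one: "(\<integral>x. complex_of_real (std_normal_density x) * iexp (s * x) \<partial>lborel) = exp (- s\<^sup>2 / 2)" for s
  proof -
    have "(\<integral>x. complex_of_real (std_normal_density x) * iexp (s * x) \<partial>lborel) = char std_normal_distribution s"
      unfolding char_def by (subst integral_density) (auto simp: scaleR_conv_of_real)
    then show ?thesis by (simp add: char_std_normal_distribution)
  qed
  have "(\<integral>x. iexp (t \<bullet> x) \<partial>gauss) =
    (\<integral>x. (exp (- (norm x)\<^sup>2 / 2) / sqrt (2 * pi) ^ DIM('a)) *\<^sub>R iexp (t \<bullet> x) \<partial>lborel)"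
    unfolding gauss_def by (subst integral_density) auto
  also have "\<dots> = (\<integral>x. (\<Prod>b\<in>Basis. complex_of_real (std_normal_density (x \<bullet> b)) * iexp ((t \<bullet> b) * (x \<bullet> b))) \<partial>lborel)"
  proof (rule Bochner_Integration.integral_cong[OF refl])
    fix x :: 'a
    have "iexp (t \<bullet> x) = (\<Prod>b\<in>Basis. iexp ((t \<bullet> b) * (x \<bullet> b)))"
      by (simp add: exp_sum[symmetric] euclidean_inner[of t x] sum_distrib_left)
    then show "(exp (- (norm x)\<^sup>2 / 2) / sqrt (2 * pi) ^ DIM('a)) *\<^sub>R iexp (t \<bullet> x) =
       (\<Prod>b\<in>Basis. complex_of_real (std_normal_density (x \<bullet> b)) * iexp ((t \<bullet> b) * (x \<bullet> b)))"
      unfolding gauss_density_prod by (simp add: scaleR_conv_of_real prod.distrib)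
  qed
  also have "\<dots> = (\<Prod>b\<in>Basis. complex_of_real (exp (- (t \<bullet> b)\<^sup>2 / 2)))"
    by (subst integral_lborel_prod) (simp_all only: int one)
  also have "\<dots> = complex_of_real (\<Prod>b\<in>Basis. exp (- (t \<bullet> b)\<^sup>2 / 2))" by simp
  also have "(\<Prod>b\<in>Basis. exp (- (t \<bullet> b)\<^sup>2 / 2)) = exp (- (norm t)\<^sup>2 / 2)"
  proof -
    have "(norm t)\<^sup>2 = (\<Sum>b\<in>Basis. (t \<bullet> b)\<^sup>2)"
      by (rule norm_square_Basis)
    then show ?thesis by (simp add: exp_sum[symmetric] sum_negf sum_divide_distrib)
  qed
  finally show ?thesis .
qed

lemma prob_space_gauss: "prob_space (gauss :: 'a::euclidean_space measure)"
proof
  interpret product_sigma_finite "\<lambda>_::'a. lborel :: real measure" ..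
  have "emeasure gauss (space gauss :: 'a set) = (\<integral>\<^sup>+x. (\<Prod>b\<in>(Basis::'a set). ennreal (std_normal_density (x \<bullet> b))) \<partial>lborel)"
    unfolding gauss_def gauss_density_prod by (subst emeasure_density) (auto simp: prod_ennreal)
  also have "\<dots> = (\<integral>\<^sup>+g. (\<Prod>b\<in>Basis. ennreal (std_normal_density (g b))) \<partial>(\<Pi>\<^sub>M b\<in>(Basis::'a set). lborel))"
    by (subst lborel_eq, subst nn_integral_distr) (auto intro!: nn_integral_cong)
  also have "\<dots> = (\<Prod>b\<in>(Basis::'a set). \<integral>\<^sup>+x. ennreal (std_normal_density x) \<partial>lborel)"
    by (subst product_nn_integral_prod) auto
  also have "(\<integral>\<^sup>+x. ennreal (std_normal_density x) \<partial>lborel) = 1"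
    using prob_space.emeasure_space_1[OF prob_space_normal_density[of 1 0]]
    by (simp add: emeasure_density)
  finally show "emeasure gauss (space gauss :: 'a set) = 1" by simp
qed

text \<open>The squared modulus is a double integral of iexp (\<eta> \<bullet> (g x - g y));
  integrating in \<eta> first produces the Gaussian characteristic function. The map g is general
  because both real phases and points of the whole space are substituted for it.\<close>

lemma gauss_energy:
  fixes g :: "'b \<Rightarrow> 'a::euclidean_space"
  assumes M: "finite_measure M" and g[measurable]: "g \<in> borel_measurable M"
  shows "(\<integral>\<^sup>+\<eta>. ennreal ((cmod (\<integral>x. iexp (\<eta> \<bullet> g x) \<partial>M))\<^sup>2) \<partial>gauss)
       = (\<integral>\<^sup>+x. \<integral>\<^sup>+y. ennreal (exp (- (norm (g x - g y))\<^sup>2 / 2)) \<partial>M \<partial>M)"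
proof -
  interpret M: finite_measure M by fact
  interpret G: prob_space "gauss :: 'a measure" by (rule prob_space_gauss)
  interpret MM: pair_sigma_finite M M ..
  interpret MMf: finite_measure "M \<Otimes>\<^sub>M M" by (rule finite_measure_pair_measure) fact+
  interpret GMM: pair_sigma_finite "gauss :: 'a measure" "M \<Otimes>\<^sub>M M" ..
  interpret GMMf: finite_measure "gauss \<Otimes>\<^sub>M (M \<Otimes>\<^sub>M M) :: ('a \<times> _) measure"
    by (rule finite_measure_pair_measure) unfold_locales
  define h where "h \<eta> = (\<integral>x. iexp (\<eta> \<bullet> g x) \<partial>M)" for \<eta>
  have [measurable]: "h \<in> borel_measurable borel" unfolding h_def by measurable
  have h2: "complex_of_real ((cmod (h \<eta>))\<^sup>2) = (\<integral>p. iexp (\<eta> \<bullet> (g (fst p) - g (snd p))) \<partial>(M \<Otimes>\<^sub>M M))" for \<eta>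
  proof -
    have "complex_of_real ((cmod (h \<eta>))\<^sup>2) = h \<eta> * cnj (h \<eta>)" by (rule complex_norm_square)
    also have "cnj (h \<eta>) = (\<integral>y. iexp (- (\<eta> \<bullet> g y)) \<partial>M)"
      unfolding h_def by (subst Bochner_Integration.integral_cnj[symmetric]) (simp add: exp_cnj)
    also have "h \<eta> * (\<integral>y. iexp (- (\<eta> \<bullet> g y)) \<partial>M) = (\<integral>x. \<integral>y. iexp (\<eta> \<bullet> g x) * iexp (- (\<eta> \<bullet> g y)) \<partial>M \<partial>M)"
      by (simp add: h_def)
    also have "\<dots> = (\<integral>x. \<integral>y. iexp (\<eta> \<bullet> (g x - g y)) \<partial>M \<partial>M)"
      by (simp add: exp_add[symmetric] inner_diff_right algebra_simps)
    also have "\<dots> = (\<integral>p. iexp (\<eta> \<bullet> (g (fst p) - g (snd p))) \<partial>(M \<Otimes>\<^sub>M M))"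
      by (subst MM.integral_fst'[symmetric])
         (auto intro!: MMf.integrable_const_bound[where B = 1])
    finally show ?thesis .
  qed
  have intg: "integrable gauss (\<lambda>\<eta>. (cmod (h \<eta>))\<^sup>2)"
  proof (rule G.integrable_const_bound[where B = "(measure M (space M))\<^sup>2"])
    have "cmod (h \<eta>) \<le> measure M (space M)" for \<eta>
    proof -
      have "cmod (h \<eta>) \<le> (\<integral>x. cmod (iexp (\<eta> \<bullet> g x)) \<partial>M)" unfolding h_def by (rule integral_norm_bound)
      then show ?thesis by simp
    qed
    then show "AE \<eta> in gauss. norm ((cmod (h \<eta>))\<^sup>2) \<le> (measure M (space M))\<^sup>2"
      by (auto intro!: power_mono)
  qed measurable
  have intk: "integrable (M \<Otimes>\<^sub>M M) (\<lambda>p. exp (- (norm (g (fst p) - g (snd p)))\<^sup>2 / 2))"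
    by (rule MMf.integrable_const_bound[where B = 1]) auto
  have "complex_of_real (\<integral>\<eta>. (cmod (h \<eta>))\<^sup>2 \<partial>gauss) = (\<integral>\<eta>. complex_of_real ((cmod (h \<eta>))\<^sup>2) \<partial>gauss)"
    by (rule integral_complex_of_real[symmetric])
  also have "\<dots> = (\<integral>\<eta>. \<integral>p. iexp (\<eta> \<bullet> (g (fst p) - g (snd p))) \<partial>(M \<Otimes>\<^sub>M M) \<partial>gauss)"
    unfolding h2 ..
  also have "\<dots> = (\<integral>p. \<integral>\<eta>. iexp (\<eta> \<bullet> (g (fst p) - g (snd p))) \<partial>gauss \<partial>(M \<Otimes>\<^sub>M M))"
    by (rule GMM.Fubini_integral[symmetric])
       (rule GMMf.integrable_const_bound[where B = 1], auto simp: case_prod_unfold)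
  also have "\<dots> = (\<integral>p. complex_of_real (exp (- (norm (g (fst p) - g (snd p)))\<^sup>2 / 2)) \<partial>(M \<Otimes>\<^sub>M M))"
    by (simp only: inner_commute[of _ "g _ - g _"] gauss_char)
  also have "\<dots> = complex_of_real (\<integral>p. exp (- (norm (g (fst p) - g (snd p)))\<^sup>2 / 2) \<partial>(M \<Otimes>\<^sub>M M))"
    by simp
  finally have eq: "(\<integral>\<eta>. (cmod (h \<eta>))\<^sup>2 \<partial>gauss) = (\<integral>p. exp (- (norm (g (fst p) - g (snd p)))\<^sup>2 / 2) \<partial>(M \<Otimes>\<^sub>M M))"
    by (simp only: of_real_eq_iff)
  have "(\<integral>\<^sup>+\<eta>. ennreal ((cmod (h \<eta>))\<^sup>2) \<partial>gauss) = ennreal (\<integral>\<eta>. (cmod (h \<eta>))\<^sup>2 \<partial>gauss)"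
    using intg by (intro nn_integral_eq_integral) auto
  also have "\<dots> = (\<integral>\<^sup>+p. ennreal (exp (- (norm (g (fst p) - g (snd p)))\<^sup>2 / 2)) \<partial>(M \<Otimes>\<^sub>M M))"
    unfolding eq using intk by (intro nn_integral_eq_integral[symmetric]) auto
  also have "\<dots> = (\<integral>\<^sup>+x. \<integral>\<^sup>+y. ennreal (exp (- (norm (g x - g y))\<^sup>2 / 2)) \<partial>M \<partial>M)"
    by (subst M.nn_integral_fst[symmetric]) auto
  finally show ?thesis unfolding h_def .
qed

section \<open>Frostman measures compared with Lebesgue measure at a given scale\<close>

text \<open>The volume of the ball times \<Phi> y is the integral of that constant over the ball
  about y, where \<Psi> dominates it; exchanging the integrals leaves the \<mu>-mass of a ball as
  weight of \<Psi> z. The pair \<Phi>, \<Psi> encodes an integrand that varies little at scale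
  r.\<close>

lemma smoothing:
  fixes \<mu> :: "'a::euclidean_space measure"
  assumes "finite_measure \<mu>" and [measurable_cong]: "sets \<mu> = sets borel" and [measurable]: "\<Phi> \<in> borel_measurable borel" "\<Psi> \<in> borel_measurable borel"
    and ball: "\<And>z. emeasure \<mu> (cball z r) \<le> C"
    and le: "\<And>y z. dist y z \<le> r \<Longrightarrow> \<Phi> y \<le> \<Psi> z"
  shows "emeasure lborel (cball (0::'a) r) * (\<integral>\<^sup>+y. \<Phi> y \<partial>\<mu>) \<le> C * (\<integral>\<^sup>+z. \<Psi> z \<partial>lborel)"
proof -
  interpret finite_measure \<mu> by fact
  interpret pair_sigma_finite \<mu> lborel ..
  have m[measurable]: "Measurable.pred (\<mu> \<Otimes>\<^sub>M lborel) (\<lambda>p. dist (fst p) (snd p) \<le> r)" by measurable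
  have "emeasure lborel (cball (0::'a) r) * (\<integral>\<^sup>+y. \<Phi> y \<partial>\<mu>) = (\<integral>\<^sup>+y. \<Phi> y * emeasure lborel (cball y r) \<partial>\<mu>)"
  proof -
    have "emeasure lborel (cball y r) = emeasure lborel (cball (0::'a) r)" for y :: 'a
    proof (cases "0 \<le> r")
      case True then show ?thesis by (simp add: emeasure_cball)
    qed simp
    then have "(\<integral>\<^sup>+y. \<Phi> y * emeasure lborel (cball y r) \<partial>\<mu>) = (\<integral>\<^sup>+y. \<Phi> y * emeasure lborel (cball (0::'a) r) \<partial>\<mu>)"
      by (intro nn_integral_cong arg_cong2[where f = "(*)"] refl)
    also have "\<dots> = (\<integral>\<^sup>+y. \<Phi> y \<partial>\<mu>) * emeasure lborel (cball (0::'a) r)"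
      by (rule nn_integral_multc) measurable
    finally show ?thesis by (simp add: mult.commute)
  qed
  also have "\<dots> = (\<integral>\<^sup>+y. \<integral>\<^sup>+z. \<Phi> y * indicator {p. dist (fst p) (snd p) \<le> r} (y, z) \<partial>lborel \<partial>\<mu>)"
  proof (rule nn_integral_cong)
    fix y
    have "\<Phi> y * emeasure lborel (cball y r) = \<Phi> y * (\<integral>\<^sup>+z. indicator (cball y r) z \<partial>lborel)" by simp
    also have "\<dots> = (\<integral>\<^sup>+z. \<Phi> y * indicator (cball y r) z \<partial>lborel)" by (rule nn_integral_cmult[symmetric]) (auto intro: borel_measurable_indicator)
    finally show "\<Phi> y * emeasure lborel (cball y r) = (\<integral>\<^sup>+z. \<Phi> y * indicator {p. dist (fst p) (snd p) \<le> r} (y, z) \<partial>lborel)"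
      by (simp add: indicator_def cball_def)
  qed
  also have "\<dots> \<le> (\<integral>\<^sup>+y. \<integral>\<^sup>+z. \<Psi> z * indicator {p. dist (fst p) (snd p) \<le> r} (y, z) \<partial>lborel \<partial>\<mu>)"
    using le by (intro nn_integral_mono) (auto simp: indicator_def)
  also have "\<dots> = (\<integral>\<^sup>+z. \<integral>\<^sup>+y. \<Psi> z * indicator {p. dist (fst p) (snd p) \<le> r} (y, z) \<partial>\<mu> \<partial>lborel)"
    by (rule Fubini'[symmetric]) (simp add: case_prod_unfold)
  also have "\<dots> = (\<integral>\<^sup>+z. \<Psi> z * emeasure \<mu> (cball z r) \<partial>lborel)"
  proof (rule nn_integral_cong)
    fix z
    have "\<Psi> z * emeasure \<mu> (cball z r) = \<Psi> z * (\<integral>\<^sup>+y. indicator (cball z r) y \<partial>\<mu>)" by simp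
    also have "\<dots> = (\<integral>\<^sup>+y. \<Psi> z * indicator (cball z r) y \<partial>\<mu>)" by (rule nn_integral_cmult[symmetric]) (auto intro: borel_measurable_indicator)
    finally show "(\<integral>\<^sup>+y. \<Psi> z * indicator {p. dist (fst p) (snd p) \<le> r} (y, z) \<partial>\<mu>) = \<Psi> z * emeasure \<mu> (cball z r)"
      by (simp add: indicator_def cball_def dist_commute)
  qed
  also have "\<dots> \<le> (\<integral>\<^sup>+z. \<Psi> z * C \<partial>lborel)" by (intro nn_integral_mono mult_left_mono ball) auto
  also have "\<dots> = C * (\<integral>\<^sup>+z. \<Psi> z \<partial>lborel)"
    by (subst mult.commute) (rule nn_integral_cmult, measurable)
  finally show ?thesis .
qed

text \<open>Seen at scale 1/\<rho> the measure has density at most a multiple of \<rho>^(-s) /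
  \<rho>^(-d). K is chosen before \<rho> and the test functions, which later depend on
  \<xi>.\<close>

lemma smoothing_frostman:
  fixes \<mu> :: "'a::euclidean_space measure"
  assumes \<mu>: "frostman s \<mu>"
  shows "\<exists>K>0. \<forall>\<rho>\<ge>1. \<forall>\<Phi> \<Psi>. \<Phi> \<in> borel_measurable borel \<longrightarrow> \<Psi> \<in> borel_measurable borel \<longrightarrow>
      (\<forall>y z. dist y z \<le> 1 / \<rho> \<longrightarrow> \<Phi> y \<le> \<Psi> z) \<longrightarrow>
      (\<integral>\<^sup>+y. \<Phi> y \<partial>\<mu>) \<le> ennreal (K * \<rho> powr (real DIM('a) - s)) * (\<integral>\<^sup>+z. \<Psi> z \<partial>lborel)"
proof -
  let ?d = "DIM('a)" and ?v = "unit_ball_vol (real DIM('a))"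
  have v: "0 < ?v" by simp
  obtain C where C: "0 < C" "\<And>x r. 0 < r \<Longrightarrow> r \<le> 1 \<Longrightarrow> emeasure \<mu> (cball x r) \<le> ennreal (C * r powr s)"
    using \<mu> unfolding frostman_def by blast
  show ?thesis
  proof (intro exI[of _ "C / ?v"] conjI allI impI)
    show "0 < C / ?v" using C v by (intro divide_pos_pos)
    fix \<rho> :: real and \<Phi> \<Psi> :: "'a \<Rightarrow> ennreal"
    assume \<rho>: "1 \<le> \<rho>" and m: "\<Phi> \<in> borel_measurable borel" "\<Psi> \<in> borel_measurable borel"
      and le': "\<forall>y z. dist y z \<le> 1 / \<rho> \<longrightarrow> \<Phi> y \<le> \<Psi> z"
    have le: "\<Phi> y \<le> \<Psi> z" if "dist y z \<le> 1 / \<rho>" for y z using le' that by blast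
    define c where "c = ?v * (1 / \<rho>) ^ ?d"
    have c: "0 < c" unfolding c_def using \<rho> v by (intro mult_pos_pos zero_less_power) auto
    have "emeasure lborel (cball (0::'a) (1 / \<rho>)) * (\<integral>\<^sup>+y. \<Phi> y \<partial>\<mu>) \<le> ennreal (C * (1 / \<rho>) powr s) * (\<integral>\<^sup>+z. \<Psi> z \<partial>lborel)"
      using \<mu> \<rho> by (intro smoothing C m le) (auto simp: frostman_def prob_space.finite_measure)
    also have "emeasure lborel (cball (0::'a) (1 / \<rho>)) = ennreal c"
      using \<rho> by (subst emeasure_cball) (auto simp: c_def)
    finally have "ennreal (1 / c) * (ennreal c * (\<integral>\<^sup>+y. \<Phi> y \<partial>\<mu>)) \<le> ennreal (1 / c) * (ennreal (C * (1 / \<rho>) powr s) * (\<integral>\<^sup>+z. \<Psi> z \<partial>lborel))"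
      by (rule mult_left_mono) simp
    also have "ennreal (1 / c) * (ennreal c * (\<integral>\<^sup>+y. \<Phi> y \<partial>\<mu>)) = (\<integral>\<^sup>+y. \<Phi> y \<partial>\<mu>)"
      using c by (simp add: mult.assoc[symmetric] ennreal_mult[symmetric])
    also have "ennreal (1 / c) * (ennreal (C * (1 / \<rho>) powr s) * (\<integral>\<^sup>+z. \<Psi> z \<partial>lborel)) =
       ennreal (1 / c * (C * (1 / \<rho>) powr s)) * (\<integral>\<^sup>+z. \<Psi> z \<partial>lborel)"
      using c C(1) by (subst ennreal_mult) (auto simp: mult.assoc)
    also have "1 / c * (C * (1 / \<rho>) powr s) = C / ?v * \<rho> powr (real ?d - s)"
      using \<rho> by (simp add: c_def powr_diff powr_realpow powr_divide power_divide)
    finally show "(\<integral>\<^sup>+y. \<Phi> y \<partial>\<mu>) \<le> ennreal (C / ?v * \<rho> powr (real ?d - s)) * (\<integral>\<^sup>+z. \<Psi> z \<partial>lborel)" .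
  qed
qed

lemma nn_integral_gaussian:
  assumes \<sigma>: "0 < \<sigma>"
  shows "(\<integral>\<^sup>+x. ennreal (exp (- (x - m)\<^sup>2 / (2 * \<sigma>\<^sup>2))) \<partial>lborel) = ennreal (sqrt (2 * pi) * \<sigma>)"
proof -
  have "(\<integral>\<^sup>+x. ennreal (normal_density m \<sigma> x) \<partial>lborel) = 1"
    using prob_space.emeasure_space_1[OF prob_space_normal_density[OF \<sigma>, of m]]
    by (simp add: emeasure_density)
  moreover have "(\<integral>\<^sup>+x. ennreal (exp (- (x - m)\<^sup>2 / (2 * \<sigma>\<^sup>2))) \<partial>lborel) =
     (\<integral>\<^sup>+x. ennreal (sqrt (2 * pi) * \<sigma>) * ennreal (normal_density m \<sigma> x) \<partial>lborel)"
  proof (rule nn_integral_cong)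
    fix x
    have "exp (- (x - m)\<^sup>2 / (2 * \<sigma>\<^sup>2)) = (sqrt (2 * pi) * \<sigma>) * normal_density m \<sigma> x"
      using \<sigma> by (simp add: normal_density_def real_sqrt_mult)
    then show "ennreal (exp (- (x - m)\<^sup>2 / (2 * \<sigma>\<^sup>2))) = ennreal (sqrt (2 * pi) * \<sigma>) * ennreal (normal_density m \<sigma> x)"
      using \<sigma> by (simp add: ennreal_mult)
  qed
  ultimately show ?thesis by (simp add: nn_integral_cmult)
qed

text \<open>Averaging over translations by \<open>\<tau> \<eta> / |\<eta>|\<close> with \<open>0 \<le> \<tau> \<le> 1\<close> reduces the slab to a
  one-dimensional integral, so that no rotation of coordinates is needed.\<close>

lemma slab_bound:
  fixes \<eta> :: "'a::euclidean_space"
  assumes \<eta>: "\<eta> \<noteq> 0" and B: "0 \<le> B"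
  shows "(\<integral>\<^sup>+z. ennreal (exp (- (\<eta> \<bullet> z - a)\<^sup>2 / 2)) * indicator (cball 0 B) z \<partial>lborel)
     \<le> ennreal (unit_ball_vol (real DIM('a)) * (B + 1) ^ DIM('a) * sqrt (2 * pi) / norm \<eta>)"
proof -
  define \<rho> where "\<rho> = norm \<eta>"
  have \<rho>: "0 < \<rho>" using \<eta> by (simp add: \<rho>_def)
  define S where "S = (\<integral>\<^sup>+z. ennreal (exp (- (\<eta> \<bullet> z - a)\<^sup>2 / 2)) * indicator (cball 0 B) z \<partial>lborel)"
  define J where "J z \<tau> = ennreal (exp (- (\<eta> \<bullet> z + \<tau> * \<rho> - a)\<^sup>2 / 2)) * indicator (cball 0 (B + 1)) z" for z \<tau>
  have [measurable]: "cball (0::'a) B \<in> sets borel" "cball (0::'a) (B + 1) \<in> sets borel" by auto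
  have step: "S \<le> (\<integral>\<^sup>+z. J z \<tau> \<partial>lborel)" if \<tau>: "0 \<le> \<tau>" "\<tau> \<le> 1" for \<tau>
  proof -
    \<comment> \<open>A translation of length at most 1 along \<eta>. It adds \<tau> \<rho> to
      \<eta> \<bullet> z, and the enlarged radius B + 1 makes room for it.\<close>
    define e where "e = (\<tau> / \<rho>) *\<^sub>R \<eta>"
    have e: "norm e \<le> 1" "\<eta> \<bullet> e = \<tau> * \<rho>"
      using \<tau> \<rho> by (auto simp: e_def \<rho>_def power2_norm_eq_inner[symmetric] power2_eq_square)
    have "S = (\<integral>\<^sup>+z. ennreal (exp (- (\<eta> \<bullet> z - a)\<^sup>2 / 2)) * indicator (cball 0 B) z \<partial>(distr lborel borel ((+) e)))"
      by (simp add: S_def lborel_distr_plus)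
    also have "\<dots> = (\<integral>\<^sup>+z. ennreal (exp (- (\<eta> \<bullet> (e + z) - a)\<^sup>2 / 2)) * indicator (cball 0 B) (e + z) \<partial>lborel)"
      by (subst nn_integral_distr) auto
    also have "\<dots> \<le> (\<integral>\<^sup>+z. J z \<tau> \<partial>lborel)"
    proof (rule nn_integral_mono)
      fix z
      have "norm z \<le> B + 1" if "norm (e + z) \<le> B"
        using norm_triangle_ineq4[of "e + z" e] that e(1) by simp
      then show "ennreal (exp (- (\<eta> \<bullet> (e + z) - a)\<^sup>2 / 2)) * indicator (cball 0 B) (e + z) \<le> J z \<tau>"
        unfolding J_def by (auto simp: indicator_def inner_add_right e(2) add.commute)
    qed
    finally show ?thesis .
  qed
  have "S = (\<integral>\<^sup>+\<tau>. S * indicator {0..1} \<tau> \<partial>(lborel :: real measure))"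
    by (subst nn_integral_cmult) auto
  \<comment> \<open>After averaging over 0 \<le> \<tau> \<le> 1 the range of \<tau> is enlarged to
    the whole line, where the Gaussian can be integrated exactly.\<close>
  also have "\<dots> \<le> (\<integral>\<^sup>+\<tau>. \<integral>\<^sup>+z. J z \<tau> \<partial>lborel \<partial>lborel)"
    using step by (intro nn_integral_mono) (auto simp: indicator_def)
  also have "\<dots> = (\<integral>\<^sup>+z. \<integral>\<^sup>+\<tau>. J z \<tau> \<partial>lborel \<partial>lborel)"
    unfolding J_def by (rule pair_sigma_finite.Fubini') (auto simp: case_prod_unfold intro!: pair_sigma_finite.intro sigma_finite_lborel)
  also have "\<dots> = (\<integral>\<^sup>+z. ennreal (sqrt (2 * pi) / \<rho>) * indicator (cball 0 (B + 1)) z \<partial>(lborel :: 'a measure))"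
  proof (rule nn_integral_cong)
    fix z
    have "(\<integral>\<^sup>+\<tau>. J z \<tau> \<partial>lborel) = (\<integral>\<^sup>+\<tau>. ennreal (exp (- (\<tau> - (a - \<eta> \<bullet> z) / \<rho>)\<^sup>2 / (2 * (1 / \<rho>)\<^sup>2))) \<partial>lborel) * indicator (cball 0 (B + 1)) z"
    proof (subst nn_integral_multc[symmetric], simp, rule nn_integral_cong)
      fix \<tau>
      have "(\<tau> - (a - \<eta> \<bullet> z) / \<rho>)\<^sup>2 / (2 * (1 / \<rho>)\<^sup>2) = (\<rho> * (\<tau> - (a - \<eta> \<bullet> z) / \<rho>))\<^sup>2 / 2"
        using \<rho> by (simp add: power_mult_distrib power_divide)
      also have "\<rho> * (\<tau> - (a - \<eta> \<bullet> z) / \<rho>) = \<eta> \<bullet> z + \<tau> * \<rho> - a" using \<rho> by (simp add: field_simps)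
      finally show "J z \<tau> = ennreal (exp (- (\<tau> - (a - \<eta> \<bullet> z) / \<rho>)\<^sup>2 / (2 * (1 / \<rho>)\<^sup>2))) * indicator (cball 0 (B + 1)) z"
        by (simp only: J_def minus_divide_left[symmetric])
    qed
    also have "(\<integral>\<^sup>+\<tau>. ennreal (exp (- (\<tau> - (a - \<eta> \<bullet> z) / \<rho>)\<^sup>2 / (2 * (1 / \<rho>)\<^sup>2))) \<partial>lborel) = ennreal (sqrt (2 * pi) * (1 / \<rho>))"
      using \<rho> by (intro nn_integral_gaussian) simp
    finally show "(\<integral>\<^sup>+\<tau>. J z \<tau> \<partial>lborel) = ennreal (sqrt (2 * pi) / \<rho>) * indicator (cball 0 (B + 1)) z" by simp
  qed
  also have "\<dots> = ennreal (sqrt (2 * pi) / \<rho>) * emeasure lborel (cball (0::'a) (B + 1))"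
    by (subst nn_integral_cmult) auto
  also have "emeasure lborel (cball (0::'a) (B + 1)) = ennreal (unit_ball_vol (real DIM('a)) * (B + 1) ^ DIM('a))"
    using B by (simp add: emeasure_cball)
  also have "ennreal (sqrt (2 * pi) / \<rho>) * \<dots> = ennreal (unit_ball_vol (real DIM('a)) * (B + 1) ^ DIM('a) * sqrt (2 * pi) / norm \<eta>)"
    using \<rho> B by (subst ennreal_mult[symmetric]) (auto simp: \<rho>_def field_simps)
  finally show ?thesis unfolding S_def .
qed

text \<open>Moving the argument of a Gaussian by a bounded amount costs a constant factor once the
  exponent is halved. This is how Gaussians meet the condition on \<Phi> and \<Psi> in
  \<open>smoothing\<close>.\<close>

lemma square_shift_le:
  fixes u v c :: real
  assumes "\<bar>u - v\<bar> \<le> c" shows "- u\<^sup>2 / 2 \<le> - v\<^sup>2 / 4 + c\<^sup>2 / 2"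
proof -
  have "(u - v)\<^sup>2 \<le> c\<^sup>2" using assms by (metis abs_ge_zero power2_abs power_mono)
  moreover have "v\<^sup>2 \<le> 2 * u\<^sup>2 + 2 * (u - v)\<^sup>2"
  proof -
    have "2 * u\<^sup>2 + 2 * (u - v)\<^sup>2 - v\<^sup>2 = (2 * u - v)\<^sup>2" by (simp add: power2_eq_square algebra_simps)
    then show ?thesis by (metis diff_ge_0_iff_ge zero_le_power2)
  qed
  ultimately show ?thesis by (simp add: field_simps)
qed

text \<open>The integrand concentrates on a slab of width of order 1/|\<xi>|. At that scale \<mu>
  has density of order |\<xi>|^(d-s), and the bounded slab has volume of order 1/|\<xi>|. The
  constant is uniform in a, which later is the phase of a second point.\<close>

lemma plate_bound:
  fixes \<mu> :: "'a::euclidean_space measure"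
  assumes \<mu>: "frostman s \<mu>" and B: "0 \<le> B" and AE: "AE x in \<mu>. x \<in> cball 0 B"
  obtains C where "0 < C" "\<And>\<xi> a. 1 \<le> norm \<xi> \<Longrightarrow>
     (\<integral>\<^sup>+y. ennreal (exp (- (4 * pi * (\<xi> \<bullet> y) - a)\<^sup>2 / 2)) \<partial>\<mu>) \<le> ennreal (C * norm \<xi> powr (real DIM('a) - 1 - s))"
proof -
  obtain K where K: "0 < K" "\<And>\<rho> \<Phi> \<Psi>. 1 \<le> \<rho> \<Longrightarrow> \<Phi> \<in> borel_measurable borel \<Longrightarrow> \<Psi> \<in> borel_measurable borel \<Longrightarrow>
      (\<And>y z. dist y z \<le> 1 / \<rho> \<Longrightarrow> \<Phi> y \<le> \<Psi> z) \<Longrightarrow>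
      (\<integral>\<^sup>+y. \<Phi> y \<partial>\<mu>) \<le> ennreal (K * \<rho> powr (real DIM('a) - s)) * (\<integral>\<^sup>+z. \<Psi> z \<partial>lborel)"
    using smoothing_frostman[OF \<mu>] by metis
  \<comment> \<open>One unit of radius for the passage from y to z, a second one for the
    translations in \<open>slab_bound\<close>.\<close>
  define V where "V = unit_ball_vol (real DIM('a)) * (B + 1 + 1) ^ DIM('a) * sqrt (2 * pi)"
  define E where "E = exp ((4 * pi)\<^sup>2 / 2)"
  have V: "0 < V" unfolding V_def using B by (intro mult_pos_pos zero_less_power) auto
  have E: "0 < E" by (simp add: E_def)
  have bc[measurable]: "cball (0::'a) r \<in> sets borel" for r by simp
  show ?thesis
  proof (rule that[of "K * E * V * (sqrt 2 / (4 * pi))"])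
    show "0 < K * E * V * (sqrt 2 / (4 * pi))" using K(1) E V by simp
    fix \<xi> :: 'a and a :: real assume \<xi>: "1 \<le> norm \<xi>"
    define R where "R = norm \<xi>"
    have R: "1 \<le> R" using \<xi> by (simp add: R_def)
    define \<Phi> where "\<Phi> y = ennreal (exp (- (4 * pi * (\<xi> \<bullet> y) - a)\<^sup>2 / 2)) * indicator (cball 0 B) y" for y
    \<comment> \<open>The factor 1 / sqrt 2 takes up the halved exponent of
      \<open>square_shift_le\<close>.\<close>
    define \<eta> where "\<eta> = (4 * pi / sqrt 2) *\<^sub>R \<xi>"
    define \<Psi> where "\<Psi> z = ennreal E * (ennreal (exp (- (\<eta> \<bullet> z - a / sqrt 2)\<^sup>2 / 2)) * indicator (cball 0 (B + 1)) z)" for z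
    have \<eta>: "\<eta> \<noteq> 0" "norm \<eta> = 4 * pi / sqrt 2 * R" using R by (auto simp: \<eta>_def R_def)
    have "(\<integral>\<^sup>+y. ennreal (exp (- (4 * pi * (\<xi> \<bullet> y) - a)\<^sup>2 / 2)) \<partial>\<mu>) = (\<integral>\<^sup>+y. \<Phi> y \<partial>\<mu>)"
      using AE by (intro nn_integral_cong_AE) (auto simp: \<Phi>_def)
    also have "\<dots> \<le> ennreal (K * R powr (real DIM('a) - s)) * (\<integral>\<^sup>+z. \<Psi> z \<partial>lborel)"
    proof (rule K(2)[OF R])
      show "\<Phi> \<in> borel_measurable borel" unfolding \<Phi>_def by measurable
      show "\<Psi> \<in> borel_measurable borel" unfolding \<Psi>_def by measurable
      fix y z :: 'a assume yz: "dist y z \<le> 1 / R"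
      show "\<Phi> y \<le> \<Psi> z"
      proof (cases "norm y \<le> B")
        case True
        have "1 / R \<le> 1" using R by simp
        then have "norm z \<le> B + 1"
          using True yz norm_triangle_ineq2[of z y] by (simp add: dist_norm norm_minus_commute)
        define u where "u = 4 * pi * (\<xi> \<bullet> y) - a"
        define v where "v = 4 * pi * (\<xi> \<bullet> z) - a"
        have "\<bar>u - v\<bar> = 4 * pi * \<bar>\<xi> \<bullet> (y - z)\<bar>"
          by (simp add: u_def v_def inner_diff_right right_diff_distrib[symmetric] abs_mult)
        also have "\<dots> \<le> 4 * pi * (R * (1 / R))"
          using yz R by (intro mult_left_mono order_trans[OF Cauchy_Schwarz_ineq2] mult_mono) (auto simp: R_def dist_norm)
        finally have "\<bar>u - v\<bar> \<le> 4 * pi" using R by simp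
        then have "- u\<^sup>2 / 2 \<le> - v\<^sup>2 / 4 + (4 * pi)\<^sup>2 / 2" by (rule square_shift_le)
        also have "- v\<^sup>2 / 4 = - (\<eta> \<bullet> z - a / sqrt 2)\<^sup>2 / 2"
        proof -
          have "\<eta> \<bullet> z - a / sqrt 2 = v / sqrt 2" by (simp add: \<eta>_def v_def diff_divide_distrib)
          then show ?thesis by (simp add: power_divide)
        qed
        finally have "exp (- u\<^sup>2 / 2) \<le> E * exp (- (\<eta> \<bullet> z - a / sqrt 2)\<^sup>2 / 2)"
          unfolding E_def exp_add[symmetric] by (simp add: add.commute)
        then have "ennreal (exp (- u\<^sup>2 / 2)) \<le> ennreal E * ennreal (exp (- (\<eta> \<bullet> z - a / sqrt 2)\<^sup>2 / 2))"
          using E by (simp add: ennreal_mult[symmetric])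
        then show ?thesis using \<open>norm z \<le> B + 1\<close> True by (simp add: \<Phi>_def \<Psi>_def u_def)
      qed (simp add: \<Phi>_def)
    qed
    also have "(\<integral>\<^sup>+z. \<Psi> z \<partial>lborel) = ennreal E * (\<integral>\<^sup>+z. ennreal (exp (- (\<eta> \<bullet> z - a / sqrt 2)\<^sup>2 / 2)) * indicator (cball 0 (B + 1)) z \<partial>lborel)"
      unfolding \<Psi>_def by (rule nn_integral_cmult) measurable
    also have "\<dots> \<le> ennreal E * ennreal (V / norm \<eta>)"
      unfolding V_def using \<eta> B by (intro mult_left_mono slab_bound) auto
    also have "ennreal (K * R powr (real DIM('a) - s)) * (ennreal E * ennreal (V / norm \<eta>)) = ennreal (K * R powr (real DIM('a) - s) * (E * (V / norm \<eta>)))"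
      using K(1) E by (simp only: ennreal_mult'[symmetric] less_imp_le mult_nonneg_nonneg powr_ge_zero)
    also have "K * R powr (real DIM('a) - s) * (E * (V / norm \<eta>)) = K * E * V * (sqrt 2 / (4 * pi)) * (R powr (real DIM('a) - s) / R)"
      unfolding \<eta>(2) using R by (simp add: field_simps)
    also have "R powr (real DIM('a) - s) / R = R powr (real DIM('a) - 1 - s)"
      using R by (simp add: powr_diff)
    finally show "(\<integral>\<^sup>+y. ennreal (exp (- (4 * pi * (\<xi> \<bullet> y) - a)\<^sup>2 / 2)) \<partial>\<mu>) \<le> ennreal (K * E * V * (sqrt 2 / (4 * pi)) * norm \<xi> powr (real DIM('a) - 1 - s))"
      by (simp add: R_def mult_left_mono)
  qed
qed

text \<open>Up to normalization the left side is the mollification of \<nu> at scale 1/R. The factor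
  exp (-s^2 / 8), available since \<nu> lives on a bounded set, later supplies the Gaussian weight
  in s that \<open>gauss_energy\<close> requires.\<close>

lemma mollified_bound:
  fixes \<nu> :: "real measure"
  assumes \<nu>: "frostman \<beta> \<nu>" and B: "0 \<le> B" and AE: "AE r in \<nu>. r \<in> cball 0 B"
  obtains C where "0 < C" "\<And>R s. 1 \<le> R \<Longrightarrow>
     (\<integral>\<^sup>+r. ennreal (exp (- (R * (s - r))\<^sup>2 / 2)) \<partial>\<nu>) \<le> ennreal (C * R powr (- \<beta>) * exp (- s\<^sup>2 / 8))"
proof -
  obtain K where K: "0 < K" "\<And>\<rho> \<Phi> \<Psi>. 1 \<le> \<rho> \<Longrightarrow> \<Phi> \<in> borel_measurable borel \<Longrightarrow> \<Psi> \<in> borel_measurable borel \<Longrightarrow>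
      (\<And>y z. dist y z \<le> 1 / \<rho> \<Longrightarrow> \<Phi> y \<le> \<Psi> z) \<Longrightarrow>
      (\<integral>\<^sup>+y. \<Phi> y \<partial>\<nu>) \<le> ennreal (K * \<rho> powr (real DIM(real) - \<beta>)) * (\<integral>\<^sup>+z. \<Psi> z \<partial>lborel)"
    using smoothing_frostman[OF \<nu>] by metis
  have sb[measurable_cong]: "sets \<nu> = sets borel" using \<nu> by (simp add: frostman_def)
  define E where "E = exp (B\<^sup>2 / 4) * exp (1 / 4)"
  have E: "0 < E" by (simp add: E_def)
  show ?thesis
  proof (rule that[of "E * K * (sqrt (2 * pi) * 2)"])
    show "0 < E * K * (sqrt (2 * pi) * 2)" using K(1) E by simp
    fix R s :: real assume R: "1 \<le> R"
    define \<Phi> where "\<Phi> r = ennreal (exp (- (R * (s - r))\<^sup>2 / 4))" for r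
    define \<Psi> where "\<Psi> r = ennreal (exp (1 / 4)) * ennreal (exp (- (r - s)\<^sup>2 / (2 * (2 / R)\<^sup>2)))" for r
    \<comment> \<open>The exponent is split in halves: one yields decay in s through s^2 \<le> 2 (s
      - r)^2 + 2 r^2 with |r| \<le> B, the other is kept for smoothing at scale 1/R.\<close>
    have ptw: "ennreal (exp (- (R * (s - r))\<^sup>2 / 2)) \<le> ennreal (exp (B\<^sup>2 / 4) * exp (- s\<^sup>2 / 8)) * \<Phi> r" if r: "r \<in> cball 0 B" for r
    proof -
      have "r\<^sup>2 \<le> B\<^sup>2" using r by (auto intro: power2_le_iff_abs_le[THEN iffD2] simp: B power2_le_iff_abs_le)
      moreover have "s\<^sup>2 \<le> 2 * (s - r)\<^sup>2 + 2 * r\<^sup>2"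
      proof -
        have "2 * (s - r)\<^sup>2 + 2 * r\<^sup>2 - s\<^sup>2 = (s - 2 * r)\<^sup>2" by (simp add: power2_eq_square algebra_simps)
        then show ?thesis by (metis diff_ge_0_iff_ge zero_le_power2)
      qed
      moreover have "(s - r)\<^sup>2 \<le> (R * (s - r))\<^sup>2"
        using R mult_right_mono[of 1 "R\<^sup>2" "(s - r)\<^sup>2"] by (simp add: power_mult_distrib one_le_power)
      ultimately have "- (R * (s - r))\<^sup>2 / 2 \<le> B\<^sup>2 / 4 + - s\<^sup>2 / 8 + - (R * (s - r))\<^sup>2 / 4" by simp
      then have "exp (- (R * (s - r))\<^sup>2 / 2) \<le> exp (B\<^sup>2 / 4) * exp (- s\<^sup>2 / 8) * exp (- (R * (s - r))\<^sup>2 / 4)"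
        unfolding exp_add[symmetric] by simp
      then show ?thesis unfolding \<Phi>_def by (subst ennreal_mult[symmetric]) (auto intro: ennreal_leI)
    qed
    have "(\<integral>\<^sup>+r. ennreal (exp (- (R * (s - r))\<^sup>2 / 2)) \<partial>\<nu>) \<le> (\<integral>\<^sup>+r. ennreal (exp (B\<^sup>2 / 4) * exp (- s\<^sup>2 / 8)) * \<Phi> r \<partial>\<nu>)"
      by (rule nn_integral_mono_AE) (rule eventually_mono[OF AE ptw])
    also have "\<dots> = ennreal (exp (B\<^sup>2 / 4) * exp (- s\<^sup>2 / 8)) * (\<integral>\<^sup>+r. \<Phi> r \<partial>\<nu>)"
      unfolding \<Phi>_def by (rule nn_integral_cmult) measurable
    also have "(\<integral>\<^sup>+r. \<Phi> r \<partial>\<nu>) \<le> ennreal (K * R powr (real DIM(real) - \<beta>)) * (\<integral>\<^sup>+z. \<Psi> z \<partial>lborel)"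
    proof (rule K(2)[OF R])
      show "\<Phi> \<in> borel_measurable borel" unfolding \<Phi>_def by measurable
      show "\<Psi> \<in> borel_measurable borel" unfolding \<Psi>_def by measurable
      fix y z :: real assume yz: "dist y z \<le> 1 / R"
      have "\<bar>R * (s - y) - R * (s - z)\<bar> = R * dist y z"
        using R by (simp add: dist_real_def right_diff_distrib[symmetric] abs_mult abs_minus_commute)
      also have "\<dots> \<le> 1" using yz R by (simp add: field_simps)
      finally have "- (R * (s - y))\<^sup>2 / 2 \<le> - (R * (s - z))\<^sup>2 / 4 + 1\<^sup>2 / 2" by (rule square_shift_le)
      then have "- (R * (s - y))\<^sup>2 / 4 \<le> 1 / 4 + - (R * (s - z))\<^sup>2 / 8" by simp
      also have "- (R * (s - z))\<^sup>2 / 8 = - (z - s)\<^sup>2 / (2 * (2 / R)\<^sup>2)"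
        using R by (simp add: power_mult_distrib power_divide power2_commute[of s z])
      finally have "exp (- (R * (s - y))\<^sup>2 / 4) \<le> exp (1 / 4) * exp (- (z - s)\<^sup>2 / (2 * (2 / R)\<^sup>2))"
        unfolding exp_add[symmetric] by simp
      then show "\<Phi> y \<le> \<Psi> z"
        unfolding \<Phi>_def \<Psi>_def by (subst ennreal_mult[symmetric]) (auto intro: ennreal_leI)
    qed
    also have "(\<integral>\<^sup>+z. \<Psi> z \<partial>lborel) = ennreal (exp (1 / 4)) * (\<integral>\<^sup>+r. ennreal (exp (- (r - s)\<^sup>2 / (2 * (2 / R)\<^sup>2))) \<partial>lborel)"
      unfolding \<Psi>_def by (rule nn_integral_cmult) measurable
    also have "(\<integral>\<^sup>+r. ennreal (exp (- (r - s)\<^sup>2 / (2 * (2 / R)\<^sup>2))) \<partial>lborel) = ennreal (sqrt (2 * pi) * (2 / R))"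
      using R by (intro nn_integral_gaussian) simp
    also have "ennreal (exp (B\<^sup>2 / 4) * exp (- s\<^sup>2 / 8)) * (ennreal (K * R powr (real DIM(real) - \<beta>)) * (ennreal (exp (1 / 4)) * ennreal (sqrt (2 * pi) * (2 / R))))
      = ennreal (exp (B\<^sup>2 / 4) * exp (- s\<^sup>2 / 8) * (K * R powr (real DIM(real) - \<beta>) * (exp (1 / 4) * (sqrt (2 * pi) * (2 / R)))))"
      using K(1) by (simp only: ennreal_mult'[symmetric] less_imp_le mult_nonneg_nonneg powr_ge_zero exp_ge_zero)
    also have "exp (B\<^sup>2 / 4) * exp (- s\<^sup>2 / 8) * (K * R powr (real DIM(real) - \<beta>) * (exp (1 / 4) * (sqrt (2 * pi) * (2 / R))))
       = E * K * (sqrt (2 * pi) * 2) * (R powr (1 - \<beta>) / R) * exp (- s\<^sup>2 / 8)"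
      by (simp add: E_def)
    also have "R powr (1 - \<beta>) / R = R powr (- \<beta>)"
      using R by (simp add: powr_diff powr_minus_divide)
    finally show "(\<integral>\<^sup>+r. ennreal (exp (- (R * (s - r))\<^sup>2 / 2)) \<partial>\<nu>) \<le> ennreal (E * K * (sqrt (2 * pi) * 2) * R powr (- \<beta>) * exp (- s\<^sup>2 / 8))"
      by (simp add: mult_left_mono)
  qed
qed

section \<open>Decay of the Fourier transform under dilations\<close>

text \<open>Non-negativity of the variance of the modulus; the bound W supplies
  integrability.\<close>

lemma square_norm_integral_le:
  fixes f :: "'b \<Rightarrow> complex"
  assumes "prob_space P" and f[measurable]: "f \<in> borel_measurable P" and W: "\<And>x. cmod (f x) \<le> W"
  shows "ennreal ((cmod (\<integral>x. f x \<partial>P))\<^sup>2) \<le> (\<integral>\<^sup>+x. ennreal ((cmod (f x))\<^sup>2) \<partial>P)"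
proof -
  interpret prob_space P by fact
  have W0: "0 \<le> W" using W[of undefined] norm_ge_zero order_trans by blast
  have i1: "integrable P (\<lambda>x. cmod (f x))" by (rule integrable_const_bound[where B = W]) (use W in auto)
  have i2: "integrable P (\<lambda>x. (cmod (f x))\<^sup>2)"
    by (rule integrable_const_bound[where B = "W\<^sup>2"]) (use W in \<open>auto intro!: power_mono\<close>)
  have "(cmod (\<integral>x. f x \<partial>P))\<^sup>2 \<le> (\<integral>x. cmod (f x) \<partial>P)\<^sup>2" by (intro power_mono integral_norm_bound) simp
  also have "\<dots> \<le> (\<integral>x. (cmod (f x))\<^sup>2 \<partial>P)"
    using variance_eq[OF i1 i2] variance_positive[of "\<lambda>x. cmod (f x)"] by simp
  finally have "ennreal ((cmod (\<integral>x. f x \<partial>P))\<^sup>2) \<le> ennreal (\<integral>x. (cmod (f x))\<^sup>2 \<partial>P)" by (rule ennreal_leI)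
  also have "\<dots> = (\<integral>\<^sup>+x. ennreal ((cmod (f x))\<^sup>2) \<partial>P)"
    using i2 by (intro nn_integral_eq_integral[symmetric]) auto
  finally show ?thesis .
qed

lemma nn_integral_gauss_real:
  assumes [measurable]: "f \<in> borel_measurable borel"
  shows "(\<integral>\<^sup>+x. f x \<partial>(gauss :: real measure)) = (\<integral>\<^sup>+x. ennreal (exp (- x\<^sup>2 / 2) / sqrt (2 * pi)) * f x \<partial>lborel)"
  unfolding gauss_def by (subst nn_integral_density) auto

theorem bilinear_decay:
  fixes \<mu> :: "'a::euclidean_space measure" and \<nu> :: "real measure"
  assumes \<mu>: "frostman \<alpha> \<mu>" "AE x in \<mu>. x \<in> cball 0 B"
    and \<nu>: "frostman \<beta> \<nu>" "AE r in \<nu>. r \<in> cball 0 B" and B: "0 \<le> B"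
  shows "\<exists>C>0. \<forall>\<xi>. 1 \<le> norm \<xi> \<longrightarrow>
    (cmod (\<integral>r. \<integral>x. iexp (- (2 * pi * r * (\<xi> \<bullet> x))) \<partial>\<mu> \<partial>\<nu>))\<^sup>2 \<le> C * norm \<xi> powr (real DIM('a) - \<alpha> - \<beta>)"
proof -
  obtain C1 where C1: "0 < C1" "\<And>R s. 1 \<le> R \<Longrightarrow>
     (\<integral>\<^sup>+r. ennreal (exp (- (R * (s - r))\<^sup>2 / 2)) \<partial>\<nu>) \<le> ennreal (C1 * R powr (- \<beta>) * exp (- s\<^sup>2 / 8))"
    using mollified_bound[OF \<nu>(1) B \<nu>(2)] by metis
  obtain C2 where C2: "0 < C2" "\<And>\<xi> a. 1 \<le> norm \<xi> \<Longrightarrow>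
     (\<integral>\<^sup>+y. ennreal (exp (- (4 * pi * (\<xi> \<bullet> y) - a)\<^sup>2 / 2)) \<partial>\<mu>) \<le> ennreal (C2 * norm \<xi> powr (real DIM('a) - 1 - \<alpha>))"
    using plate_bound[OF \<mu>(1) B \<mu>(2)] by metis
  have s\<mu>[measurable_cong]: "sets \<mu> = sets borel" and s\<nu>[measurable_cong]: "sets \<nu> = sets borel"
    using \<mu> \<nu> by (auto simp: frostman_def)
  interpret \<mu>: prob_space \<mu> using \<mu> by (simp add: frostman_def)
  interpret \<nu>: prob_space \<nu> using \<nu> by (simp add: frostman_def)
  interpret G: prob_space "gauss :: real measure" by (rule prob_space_gauss)
  define W where "W = exp (2 * pi\<^sup>2 * B\<^sup>2)"
  have W: "1 \<le> W" by (simp add: W_def)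
  have bc[measurable]: "cball (0::'a) B \<in> sets borel" by simp
  show ?thesis
  proof (intro exI[of _ "2 * C1 * W\<^sup>2 * C2"] conjI allI impI)
    show "0 < 2 * C1 * W\<^sup>2 * C2" using C1(1) C2(1) W by simp
    fix \<xi> :: 'a assume \<xi>: "1 \<le> norm \<xi>"
    define R where "R = norm \<xi>"
    have R: "1 \<le> R" using \<xi> by (simp add: R_def)
    define t where "t x = \<xi> \<bullet> x" for x
    have [measurable]: "t \<in> borel_measurable borel" unfolding t_def by measurable
    \<comment> \<open>On the ball this is the reciprocal of the factor by which Gaussian averaging
      at scale 1/R damps the phase. There |t x| \<le> R B, so w is at most W whatever \<xi>
      is.\<close>
    define w where "w x = exp (2 * pi\<^sup>2 * (t x / R)\<^sup>2) * indicator (cball 0 B) x" for x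
    have [measurable]: "w \<in> borel_measurable borel" unfolding w_def by measurable
    have w: "0 \<le> w x" "w x \<le> W" for x
    proof -
      show "0 \<le> w x" by (simp add: w_def)
      show "w x \<le> W"
      proof (cases "norm x \<le> B")
        case True
        have "\<bar>t x\<bar> \<le> R * norm x" unfolding t_def R_def by (rule Cauchy_Schwarz_ineq2)
        also have "\<dots> \<le> R * B" using True R by (intro mult_left_mono) auto
        finally have "\<bar>t x / R\<bar> \<le> B" using R by (simp add: field_simps)
        then have "(t x / R)\<^sup>2 \<le> B\<^sup>2" using B by (metis abs_ge_zero power2_abs power_mono)
        then show ?thesis unfolding w_def W_def using True by (simp add: mult_left_mono)
      qed (use W in \<open>simp add: w_def\<close>)
    qed
    define M where "M = density \<mu> (\<lambda>x. ennreal (w x))"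
    have sM[measurable_cong]: "sets M = sets borel" by (simp add: M_def s\<mu>)
    have nnM: "(\<integral>\<^sup>+x. f x \<partial>M) \<le> ennreal W * (\<integral>\<^sup>+x. f x \<partial>\<mu>)" if [measurable]: "f \<in> borel_measurable borel" for f
    proof -
      have "(\<integral>\<^sup>+x. f x \<partial>M) = (\<integral>\<^sup>+x. ennreal (w x) * f x \<partial>\<mu>)" unfolding M_def by (rule nn_integral_density) auto
      also have "\<dots> \<le> (\<integral>\<^sup>+x. ennreal W * f x \<partial>\<mu>)" using w by (intro nn_integral_mono mult_right_mono ennreal_leI) auto
      also have "\<dots> = ennreal W * (\<integral>\<^sup>+x. f x \<partial>\<mu>)" by (rule nn_integral_cmult) auto
      finally show ?thesis .
    qed
    have eM: "emeasure M (space M) \<le> ennreal W"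
      using nnM[of "\<lambda>_. 1"] \<mu>.emeasure_space_1 by simp
    interpret M: finite_measure M
      by (rule finite_measureI) (use eM in \<open>auto simp: top_unique\<close>)
    define ft where "ft s = (\<integral>x. iexp (- (2 * pi * s * t x)) \<partial>M)" for s
    have [measurable]: "ft \<in> borel_measurable borel" unfolding ft_def by measurable
    have ft_W: "cmod (ft s) \<le> W" for s
    proof -
      have "cmod (ft s) \<le> (\<integral>x. cmod (iexp (- (2 * pi * s * t x))) \<partial>M)" unfolding ft_def by (rule integral_norm_bound)
      also have "\<dots> = measure M (space M)" by simp
      also have "\<dots> \<le> W" using eM W by (simp add: M.emeasure_eq_measure)
      finally show ?thesis .
    qed
    define h where "h r = (\<integral>x. iexp (- (2 * pi * r * t x)) \<partial>\<mu>)" for r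
    have [measurable]: "h \<in> borel_measurable borel" unfolding h_def by measurable
    have h1: "cmod (h r) \<le> 1" for r
    proof -
      have "cmod (h r) \<le> (\<integral>x. cmod (iexp (- (2 * pi * r * t x))) \<partial>\<mu>)" unfolding h_def by (rule integral_norm_bound)
      then show ?thesis by (simp add: \<mu>.prob_space)
    qed
    \<comment> \<open>The damping by the Gaussian and the weight w cancel, so h is exactly a
      Gaussian average of ft.\<close>
    have h_eq: "h r = (\<integral>g. ft (r + g / R) \<partial>gauss)" for r
    proof -
      interpret pair_sigma_finite "gauss :: real measure" M ..
      interpret PM: finite_measure "(gauss :: real measure) \<Otimes>\<^sub>M M"
        by (rule finite_measure_pair_measure) unfold_locales
      have "(\<integral>g. ft (r + g / R) \<partial>gauss) = (\<integral>x. \<integral>g. iexp (- (2 * pi * (r + g / R) * t x)) \<partial>gauss \<partial>M)"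
        unfolding ft_def
        by (rule Fubini_integral[symmetric]) (rule PM.integrable_const_bound[where B = 1], auto simp: case_prod_unfold)
      also have "\<dots> = (\<integral>x. iexp (- (2 * pi * r * t x)) * exp (- (2 * pi\<^sup>2 * (t x / R)\<^sup>2)) \<partial>M)"
      proof (rule Bochner_Integration.integral_cong[OF refl])
        fix x
        have "(\<integral>g. iexp (- (2 * pi * (r + g / R) * t x)) \<partial>gauss) =
          (\<integral>g. iexp (- (2 * pi * r * t x)) * iexp ((- (2 * pi * t x / R)) \<bullet> g) \<partial>gauss)"
        proof (rule Bochner_Integration.integral_cong[OF refl])
          fix g :: real
          have "- (2 * pi * (r + g / R) * t x) = - (2 * pi * r * t x) + (- (2 * pi * t x / R)) \<bullet> g"
            using R by (simp add: field_simps)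
          then show "iexp (- (2 * pi * (r + g / R) * t x)) = iexp (- (2 * pi * r * t x)) * iexp ((- (2 * pi * t x / R)) \<bullet> g)"
            by (simp only: of_real_add distrib_left exp_add)
        qed
        also have "\<dots> = iexp (- (2 * pi * r * t x)) * (\<integral>g. iexp ((- (2 * pi * t x / R)) \<bullet> g) \<partial>gauss)" by simp
        also have "(\<integral>g. iexp ((- (2 * pi * t x / R)) \<bullet> g) \<partial>gauss) = exp (- (norm (- (2 * pi * t x / R)))\<^sup>2 / 2)"
          by (rule gauss_char)
        also have "- (norm (- (2 * pi * t x / R)))\<^sup>2 / 2 = - (2 * pi\<^sup>2 * (t x / R)\<^sup>2)"
          by (simp add: power_mult_distrib power_divide)
        finally show "(\<integral>g. iexp (- (2 * pi * (r + g / R) * t x)) \<partial>gauss) = iexp (- (2 * pi * r * t x)) * exp (- (2 * pi\<^sup>2 * (t x / R)\<^sup>2))" .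
      qed
      also have "\<dots> = (\<integral>x. w x *\<^sub>R (iexp (- (2 * pi * r * t x)) * exp (- (2 * pi\<^sup>2 * (t x / R)\<^sup>2))) \<partial>\<mu>)"
        unfolding M_def by (rule integral_density) (auto simp: w)
      also have "\<dots> = h r"
        unfolding h_def
      proof (rule integral_cong_AE)
        show "AE x in \<mu>. w x *\<^sub>R (iexp (- (2 * pi * r * t x)) * exp (- (2 * pi\<^sup>2 * (t x / R)\<^sup>2))) = iexp (- (2 * pi * r * t x))"
          using \<mu>(2)
        proof eventually_elim
          case (elim x)
          have "w x * exp (- (2 * pi\<^sup>2 * (t x / R)\<^sup>2)) = 1"
            using elim by (simp add: w_def exp_minus)
          then have e: "complex_of_real (w x) * complex_of_real (exp (- (2 * pi\<^sup>2 * (t x / R)\<^sup>2))) = 1"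
            by (metis of_real_1 of_real_mult)
          show ?case
            by (simp only: scaleR_conv_of_real mult.left_commute[of "complex_of_real (w x)"] e mult_1_right)
        qed
      qed measurable
      finally show ?thesis ..
    qed
    let ?F = "\<integral>r. \<integral>x. iexp (- (2 * pi * r * (\<xi> \<bullet> x))) \<partial>\<mu> \<partial>\<nu>"
    have "ennreal ((cmod ?F)\<^sup>2) = ennreal ((cmod (\<integral>r. h r \<partial>\<nu>))\<^sup>2)" by (simp add: h_def t_def)
    \<comment> \<open>Cauchy-Schwarz for \<nu> here, then once more for the Gaussian average inside
      the integral.\<close>
    also have "\<dots> \<le> (\<integral>\<^sup>+r. ennreal ((cmod (h r))\<^sup>2) \<partial>\<nu>)"
      by (rule square_norm_integral_le[OF _ _ h1]) (use \<nu>.prob_space_axioms in auto)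
    also have "\<dots> \<le> (\<integral>\<^sup>+r. \<integral>\<^sup>+s. ennreal ((cmod (ft s))\<^sup>2) * (ennreal (R / sqrt (2 * pi)) * ennreal (exp (- (R * (s - r))\<^sup>2 / 2))) \<partial>lborel \<partial>\<nu>)"
    proof (rule nn_integral_mono)
      fix r
      have "ennreal ((cmod (h r))\<^sup>2) \<le> (\<integral>\<^sup>+g. ennreal ((cmod (ft (r + g / R)))\<^sup>2) \<partial>gauss)"
        unfolding h_eq by (rule square_norm_integral_le[OF _ _ ft_W]) (use G.prob_space_axioms in auto)
      also have "\<dots> = (\<integral>\<^sup>+g. ennreal (exp (- g\<^sup>2 / 2) / sqrt (2 * pi)) * ennreal ((cmod (ft (r + g / R)))\<^sup>2) \<partial>lborel)"
        by (rule nn_integral_gauss_real) measurable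
      also have "\<dots> = (\<integral>\<^sup>+s. ennreal ((cmod (ft s))\<^sup>2) * (ennreal (R / sqrt (2 * pi)) * ennreal (exp (- (R * (s - r))\<^sup>2 / 2))) \<partial>lborel)"
      \<comment> \<open>Substituting s = r + g / R turns the average around r into an integral over
        s; the Jacobian is the factor R of the kernel.\<close>
      proof (subst (2) nn_integral_real_affine[where t = r and c = "1 / R"])
        have "ennreal \<bar>1 / R\<bar> * (\<integral>\<^sup>+g. ennreal ((cmod (ft (r + 1 / R * g)))\<^sup>2) * (ennreal (R / sqrt (2 * pi)) * ennreal (exp (- (R * (r + 1 / R * g - r))\<^sup>2 / 2))) \<partial>lborel)
          = (\<integral>\<^sup>+g. ennreal \<bar>1 / R\<bar> * (ennreal ((cmod (ft (r + 1 / R * g)))\<^sup>2) * (ennreal (R / sqrt (2 * pi)) * ennreal (exp (- (R * (r + 1 / R * g - r))\<^sup>2 / 2)))) \<partial>lborel)"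
          by (rule nn_integral_cmult[symmetric]) measurable
        also have "\<dots> = (\<integral>\<^sup>+g. ennreal (exp (- g\<^sup>2 / 2) / sqrt (2 * pi)) * ennreal ((cmod (ft (r + g / R)))\<^sup>2) \<partial>lborel)"
        proof (rule nn_integral_cong)
          fix g
          have e: "R * (r + 1 / R * g - r) = g" "r + 1 / R * g = r + g / R" "\<bar>1 / R\<bar> = 1 / R" using R by auto
          have "1 / R * ((cmod (ft (r + g / R)))\<^sup>2 * (R / sqrt (2 * pi) * exp (- g\<^sup>2 / 2))) = exp (- g\<^sup>2 / 2) / sqrt (2 * pi) * (cmod (ft (r + g / R)))\<^sup>2"
            using R by simp
          then show "ennreal \<bar>1 / R\<bar> * (ennreal ((cmod (ft (r + 1 / R * g)))\<^sup>2) * (ennreal (R / sqrt (2 * pi)) * ennreal (exp (- (R * (r + 1 / R * g - r))\<^sup>2 / 2)))) =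
            ennreal (exp (- g\<^sup>2 / 2) / sqrt (2 * pi)) * ennreal ((cmod (ft (r + g / R)))\<^sup>2)"
            unfolding e using R by (simp only: ennreal_mult''[symmetric] exp_ge_zero zero_le_power2 mult_nonneg_nonneg) (simp add: ennreal_mult''[symmetric])
        qed
        finally show "(\<integral>\<^sup>+g. ennreal (exp (- g\<^sup>2 / 2) / sqrt (2 * pi)) * ennreal ((cmod (ft (r + g / R)))\<^sup>2) \<partial>lborel) =
          ennreal \<bar>1 / R\<bar> * (\<integral>\<^sup>+g. ennreal ((cmod (ft (r + 1 / R * g)))\<^sup>2) * (ennreal (R / sqrt (2 * pi)) * ennreal (exp (- (R * (r + 1 / R * g - r))\<^sup>2 / 2))) \<partial>lborel)" ..
      qed (use R in auto)
      finally show "ennreal ((cmod (h r))\<^sup>2) \<le> (\<integral>\<^sup>+s. ennreal ((cmod (ft s))\<^sup>2) * (ennreal (R / sqrt (2 * pi)) * ennreal (exp (- (R * (s - r))\<^sup>2 / 2))) \<partial>lborel)" .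
    qed
    \<comment> \<open>Once the order is exchanged, the integral over \<nu> for fixed s is the
      mollification bounded above.\<close>
    also have "\<dots> = (\<integral>\<^sup>+s. \<integral>\<^sup>+r. ennreal ((cmod (ft s))\<^sup>2) * (ennreal (R / sqrt (2 * pi)) * ennreal (exp (- (R * (s - r))\<^sup>2 / 2))) \<partial>\<nu> \<partial>lborel)"
    proof -
      interpret pair_sigma_finite \<nu> lborel ..
      show ?thesis by (rule Fubini'[symmetric]) (simp add: case_prod_unfold)
    qed
    also have "\<dots> = (\<integral>\<^sup>+s. ennreal ((cmod (ft s))\<^sup>2) * (ennreal (R / sqrt (2 * pi)) * (\<integral>\<^sup>+r. ennreal (exp (- (R * (s - r))\<^sup>2 / 2)) \<partial>\<nu>)) \<partial>lborel)"
      by (intro nn_integral_cong) (simp add: nn_integral_cmult)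
    also have "\<dots> \<le> (\<integral>\<^sup>+s. ennreal ((cmod (ft s))\<^sup>2) * (ennreal (R / sqrt (2 * pi)) * ennreal (C1 * R powr (- \<beta>) * exp (- s\<^sup>2 / 8))) \<partial>lborel)"
      by (intro nn_integral_mono mult_left_mono C1(2) R) auto
    also have "\<dots> = (\<integral>\<^sup>+s. ennreal (C1 * R powr (1 - \<beta>) / sqrt (2 * pi)) * ennreal ((cmod (ft s))\<^sup>2 * exp (- s\<^sup>2 / 8)) \<partial>lborel)"
    proof (rule nn_integral_cong)
      fix s
      have "(cmod (ft s))\<^sup>2 * (R / sqrt (2 * pi) * (C1 * R powr (- \<beta>) * exp (- s\<^sup>2 / 8))) =
         C1 * (R * R powr (- \<beta>)) / sqrt (2 * pi) * ((cmod (ft s))\<^sup>2 * exp (- s\<^sup>2 / 8))" by simp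
      also have "R * R powr (- \<beta>) = R powr (1 - \<beta>)" using R by (simp add: powr_diff powr_minus_divide)
      finally show "ennreal ((cmod (ft s))\<^sup>2) * (ennreal (R / sqrt (2 * pi)) * ennreal (C1 * R powr (- \<beta>) * exp (- s\<^sup>2 / 8))) =
        ennreal (C1 * R powr (1 - \<beta>) / sqrt (2 * pi)) * ennreal ((cmod (ft s))\<^sup>2 * exp (- s\<^sup>2 / 8))"
        using R C1(1) by (subst (1 2) ennreal_mult'[symmetric]) (auto simp: ennreal_mult'[symmetric])
    qed
    also have "\<dots> = ennreal (C1 * R powr (1 - \<beta>) / sqrt (2 * pi)) * (\<integral>\<^sup>+s. ennreal ((cmod (ft s))\<^sup>2 * exp (- s\<^sup>2 / 8)) \<partial>lborel)"
      by (rule nn_integral_cmult) measurable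
    \<comment> \<open>With s = 2 \<eta> the factor exp (-s^2 / 8) becomes the standard Gaussian
      weight; the doubled frequency is the origin of 4 pi in \<open>plate_bound\<close>.\<close>
    also have "(\<integral>\<^sup>+s. ennreal ((cmod (ft s))\<^sup>2 * exp (- s\<^sup>2 / 8)) \<partial>lborel) = ennreal (2 * sqrt (2 * pi)) * (\<integral>\<^sup>+\<eta>. ennreal ((cmod (ft (2 * \<eta>)))\<^sup>2) \<partial>gauss)"
    proof -
      have "(\<integral>\<^sup>+s. ennreal ((cmod (ft s))\<^sup>2 * exp (- s\<^sup>2 / 8)) \<partial>lborel) = 2 * (\<integral>\<^sup>+\<eta>. ennreal ((cmod (ft (2 * \<eta>)))\<^sup>2 * exp (- \<eta>\<^sup>2 / 2)) \<partial>lborel)"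
        by (subst nn_integral_real_affine[where t = 0 and c = 2]) (auto simp: power_mult_distrib)
      also have "(\<integral>\<^sup>+\<eta>. ennreal ((cmod (ft (2 * \<eta>)))\<^sup>2 * exp (- \<eta>\<^sup>2 / 2)) \<partial>lborel) =
         (\<integral>\<^sup>+\<eta>. ennreal (sqrt (2 * pi)) * (ennreal (exp (- \<eta>\<^sup>2 / 2) / sqrt (2 * pi)) * ennreal ((cmod (ft (2 * \<eta>)))\<^sup>2)) \<partial>lborel)"
        by (intro nn_integral_cong) (simp add: ennreal_mult'[symmetric] mult.commute)
      also have "\<dots> = ennreal (sqrt (2 * pi)) * (\<integral>\<^sup>+\<eta>. ennreal (exp (- \<eta>\<^sup>2 / 2) / sqrt (2 * pi)) * ennreal ((cmod (ft (2 * \<eta>)))\<^sup>2) \<partial>lborel)"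
        by (rule nn_integral_cmult) measurable
      also have "(\<integral>\<^sup>+\<eta>. ennreal (exp (- \<eta>\<^sup>2 / 2) / sqrt (2 * pi)) * ennreal ((cmod (ft (2 * \<eta>)))\<^sup>2) \<partial>lborel) = (\<integral>\<^sup>+\<eta>. ennreal ((cmod (ft (2 * \<eta>)))\<^sup>2) \<partial>gauss)"
        by (rule nn_integral_gauss_real[symmetric]) measurable
      finally show ?thesis by (simp add: ennreal_mult mult.assoc)
    qed
    also have "(\<integral>\<^sup>+\<eta>. ennreal ((cmod (ft (2 * \<eta>)))\<^sup>2) \<partial>gauss) = (\<integral>\<^sup>+x. \<integral>\<^sup>+y. ennreal (exp (- (norm (- (4 * pi * t x) - - (4 * pi * t y)))\<^sup>2 / 2)) \<partial>M \<partial>M)"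
    proof -
      have "ft (2 * \<eta>) = (\<integral>x. iexp (\<eta> \<bullet> (- (4 * pi * t x))) \<partial>M)" for \<eta>
        unfolding ft_def by (intro Bochner_Integration.integral_cong refl arg_cong[where f = exp]) simp
      then show ?thesis by (simp only:) (rule gauss_energy, unfold_locales, measurable)
    qed
    also have "\<dots> = (\<integral>\<^sup>+x. \<integral>\<^sup>+y. ennreal (exp (- (4 * pi * t y - 4 * pi * t x)\<^sup>2 / 2)) \<partial>M \<partial>M)"
      by simp
    \<comment> \<open>For fixed x the inner integral is a slab integral centred at the phase of x;
      the outer one costs only the total mass of M.\<close>
    also have "\<dots> \<le> (\<integral>\<^sup>+x. ennreal W * ennreal (C2 * R powr (real DIM('a) - 1 - \<alpha>)) \<partial>M)"
    proof (rule nn_integral_mono)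
      fix x
      have "(\<integral>\<^sup>+y. ennreal (exp (- (4 * pi * t y - 4 * pi * t x)\<^sup>2 / 2)) \<partial>M) \<le> ennreal W * (\<integral>\<^sup>+y. ennreal (exp (- (4 * pi * t y - 4 * pi * t x)\<^sup>2 / 2)) \<partial>\<mu>)"
        by (rule nnM) measurable
      also have "\<dots> \<le> ennreal W * ennreal (C2 * R powr (real DIM('a) - 1 - \<alpha>))"
        unfolding t_def R_def by (intro mult_left_mono C2(2) \<xi>) auto
      finally show "(\<integral>\<^sup>+y. ennreal (exp (- (4 * pi * t y - 4 * pi * t x)\<^sup>2 / 2)) \<partial>M) \<le> ennreal W * ennreal (C2 * R powr (real DIM('a) - 1 - \<alpha>))" .
    qed
    also have "\<dots> = ennreal W * ennreal (C2 * R powr (real DIM('a) - 1 - \<alpha>)) * emeasure M (space M)" by simp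
    also have "\<dots> \<le> ennreal W * ennreal (C2 * R powr (real DIM('a) - 1 - \<alpha>)) * ennreal W"
      by (intro mult_left_mono eM) simp
    also have "ennreal (C1 * R powr (1 - \<beta>) / sqrt (2 * pi)) * (ennreal (2 * sqrt (2 * pi)) * (ennreal W * ennreal (C2 * R powr (real DIM('a) - 1 - \<alpha>)) * ennreal W))
       = ennreal (C1 * R powr (1 - \<beta>) / sqrt (2 * pi) * (2 * sqrt (2 * pi) * (W * (C2 * R powr (real DIM('a) - 1 - \<alpha>)) * W)))"
    proof -
      have nn: "0 \<le> W" "0 \<le> C2 * R powr (real DIM('a) - 1 - \<alpha>)" "0 \<le> C1 * R powr (1 - \<beta>) / sqrt (2 * pi)" "0 \<le> 2 * sqrt (2 * pi)"
        using W C1(1) C2(1) by auto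
      show ?thesis using nn by (simp only: ennreal_mult'[symmetric] mult_nonneg_nonneg)
    qed
    also have "C1 * R powr (1 - \<beta>) / sqrt (2 * pi) * (2 * sqrt (2 * pi) * (W * (C2 * R powr (real DIM('a) - 1 - \<alpha>)) * W))
        = 2 * C1 * W\<^sup>2 * C2 * (R powr (1 - \<beta>) * R powr (real DIM('a) - 1 - \<alpha>))"
      by (simp add: power2_eq_square)
    also have "R powr (1 - \<beta>) * R powr (real DIM('a) - 1 - \<alpha>) = R powr (real DIM('a) - \<alpha> - \<beta>)"
      by (simp add: powr_add[symmetric] algebra_simps)
    finally show "(cmod ?F)\<^sup>2 \<le> 2 * C1 * W\<^sup>2 * C2 * norm \<xi> powr (real DIM('a) - \<alpha> - \<beta>)"
      using C1(1) C2(1) by (simp add: R_def mult_left_mono)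
  qed
qed

section \<open>Energies and Sobolev norms\<close>

lemma nn_integral_affine_euclidean:
  fixes t :: "'a::euclidean_space"
  assumes [measurable]: "f \<in> borel_measurable borel" and c: "c \<noteq> 0"
  shows "(\<integral>\<^sup>+x. f x \<partial>lborel) = ennreal (\<bar>c\<bar> ^ DIM('a)) * (\<integral>\<^sup>+x. f (t + c *\<^sub>R x) \<partial>lborel)"
  by (subst lborel_affine[OF c, of t])
     (simp add: nn_integral_density nn_integral_distr nn_integral_cmult)

lemma nn_integral_gauss:
  fixes f :: "'a::euclidean_space \<Rightarrow> ennreal"
  assumes [measurable]: "f \<in> borel_measurable borel"
  shows "(\<integral>\<^sup>+x. f x * ennreal (exp (- (norm x)\<^sup>2 / 2)) \<partial>lborel) = ennreal (sqrt (2 * pi) ^ DIM('a)) * (\<integral>\<^sup>+x. f x \<partial>gauss)"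
proof -
  have "(\<integral>\<^sup>+x. f x \<partial>gauss) = (\<integral>\<^sup>+x. ennreal (exp (- (norm x)\<^sup>2 / 2) / sqrt (2 * pi) ^ DIM('a)) * f x \<partial>lborel)"
    unfolding gauss_def by (subst nn_integral_density) auto
  also have "ennreal (sqrt (2 * pi) ^ DIM('a)) * \<dots> = (\<integral>\<^sup>+x. ennreal (sqrt (2 * pi) ^ DIM('a)) * (ennreal (exp (- (norm x)\<^sup>2 / 2) / sqrt (2 * pi) ^ DIM('a)) * f x) \<partial>lborel)"
    by (rule nn_integral_cmult[symmetric]) measurable
  also have "\<dots> = (\<integral>\<^sup>+x. f x * ennreal (exp (- (norm x)\<^sup>2 / 2)) \<partial>lborel)"
  proof (rule nn_integral_cong)
    fix x :: 'a
    let ?V = "sqrt (2 * pi) ^ DIM('a)" and ?e = "exp (- (norm x)\<^sup>2 / 2)"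
    have "ennreal ?V * ennreal (?e / ?V) = ennreal (?V * (?e / ?V))" by (rule ennreal_mult'[symmetric]) simp
    also have "?V * (?e / ?V) = ?e" by simp
    finally show "ennreal ?V * (ennreal (?e / ?V) * f x) = f x * ennreal ?e"
      by (metis mult.assoc mult.commute)
  qed
  finally show ?thesis ..
qed

lemma fourier_transform_iexp:
  "fourier_transform \<mu> \<xi> = (\<integral>x. iexp (- (2 * pi * (\<xi> \<bullet> x))) \<partial>\<mu>)"
  unfolding fourier_transform_def
  by (intro Bochner_Integration.integral_cong refl arg_cong[where f = exp]) (simp add: mult_ac)

lemma measurable_fourier_transform:
  assumes "sets \<mu> = sets borel" "prob_space \<mu>"
  shows "fourier_transform (\<mu> :: 'a::euclidean_space measure) \<in> borel_measurable borel"
proof -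
  interpret prob_space \<mu> by fact
  have [measurable_cong]: "sets \<mu> = sets borel" by fact
  have "(\<lambda>\<xi>. fourier_transform \<mu> \<xi>) \<in> borel_measurable borel"
    unfolding fourier_transform_iexp by measurable
  then show ?thesis .
qed

text \<open>\<open>gauss_energy\<close> rescaled by \<rho>. As an equality it serves both ways: ball
  growth controls the Fourier mass up to frequency \<rho>, and Fourier decay controls the energy at
  scale 1/\<rho>.\<close>

lemma fourier_energy:
  fixes \<mu> :: "'a::euclidean_space measure"
  assumes sb: "sets \<mu> = sets borel" and p: "prob_space \<mu>" and \<rho>: "0 < \<rho>"
  shows "(\<integral>\<^sup>+\<xi>. ennreal ((cmod (fourier_transform \<mu> \<xi>))\<^sup>2) * ennreal (exp (- (norm \<xi> / \<rho>)\<^sup>2 / 2)) \<partial>lborel)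
    = ennreal ((sqrt (2 * pi) * \<rho>) ^ DIM('a)) * (\<integral>\<^sup>+x. \<integral>\<^sup>+y. ennreal (exp (- (2 * pi * \<rho> * norm (x - y))\<^sup>2 / 2)) \<partial>\<mu> \<partial>\<mu>)"
proof -
  interpret prob_space \<mu> by fact
  have [measurable_cong]: "sets \<mu> = sets borel" by fact
  have norm_eq: "norm ((- (2 * pi * \<rho>)) *\<^sub>R x - (- (2 * pi * \<rho>)) *\<^sub>R y) = 2 * pi * \<rho> * norm (x - y)" for x y :: 'a
    unfolding scaleR_diff_right[symmetric] norm_scaleR using \<rho> by simp
  have [measurable]: "fourier_transform \<mu> \<in> borel_measurable borel" by (rule measurable_fourier_transform[OF sb p])
  have "(\<integral>\<^sup>+\<xi>. ennreal ((cmod (fourier_transform \<mu> \<xi>))\<^sup>2) * ennreal (exp (- (norm \<xi> / \<rho>)\<^sup>2 / 2)) \<partial>lborel)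
    = ennreal (\<bar>\<rho>\<bar> ^ DIM('a)) * (\<integral>\<^sup>+\<eta>. ennreal ((cmod (fourier_transform \<mu> (\<rho> *\<^sub>R \<eta>)))\<^sup>2) * ennreal (exp (- (norm (\<rho> *\<^sub>R \<eta>) / \<rho>)\<^sup>2 / 2)) \<partial>lborel)"
    using \<rho> by (subst nn_integral_affine_euclidean[of _ \<rho> 0]) auto
  also have "(\<integral>\<^sup>+\<eta>. ennreal ((cmod (fourier_transform \<mu> (\<rho> *\<^sub>R \<eta>)))\<^sup>2) * ennreal (exp (- (norm (\<rho> *\<^sub>R \<eta>) / \<rho>)\<^sup>2 / 2)) \<partial>lborel)
     = (\<integral>\<^sup>+\<eta>. ennreal ((cmod (fourier_transform \<mu> (\<rho> *\<^sub>R \<eta>)))\<^sup>2) * ennreal (exp (- (norm \<eta>)\<^sup>2 / 2)) \<partial>lborel)"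
    using \<rho> by simp
  also have "\<dots> = ennreal (sqrt (2 * pi) ^ DIM('a)) * (\<integral>\<^sup>+\<eta>. ennreal ((cmod (fourier_transform \<mu> (\<rho> *\<^sub>R \<eta>)))\<^sup>2) \<partial>gauss)"
    by (rule nn_integral_gauss) measurable
  also have "(\<integral>\<^sup>+\<eta>. ennreal ((cmod (fourier_transform \<mu> (\<rho> *\<^sub>R \<eta>)))\<^sup>2) \<partial>gauss) =
     (\<integral>\<^sup>+\<eta>. ennreal ((cmod (\<integral>x. iexp (\<eta> \<bullet> ((- (2 * pi * \<rho>)) *\<^sub>R x)) \<partial>\<mu>))\<^sup>2) \<partial>gauss)"
    unfolding fourier_transform_iexp by (simp add: mult_ac)
  also have "\<dots> = (\<integral>\<^sup>+x. \<integral>\<^sup>+y. ennreal (exp (- (norm ((- (2 * pi * \<rho>)) *\<^sub>R x - (- (2 * pi * \<rho>)) *\<^sub>R y))\<^sup>2 / 2)) \<partial>\<mu> \<partial>\<mu>)"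
    by (rule gauss_energy) (unfold_locales, measurable)
  also have "\<dots> = (\<integral>\<^sup>+x. \<integral>\<^sup>+y. ennreal (exp (- (2 * pi * \<rho> * norm (x - y))\<^sup>2 / 2)) \<partial>\<mu> \<partial>\<mu>)"
    by (simp only: norm_eq)
  also have "ennreal (\<bar>\<rho>\<bar> ^ DIM('a)) * (ennreal (sqrt (2 * pi) ^ DIM('a)) * (\<integral>\<^sup>+x. \<integral>\<^sup>+y. ennreal (exp (- (2 * pi * \<rho> * norm (x - y))\<^sup>2 / 2)) \<partial>\<mu> \<partial>\<mu>))
    = ennreal ((sqrt (2 * pi) * \<rho>) ^ DIM('a)) * (\<integral>\<^sup>+x. \<integral>\<^sup>+y. ennreal (exp (- (2 * pi * \<rho> * norm (x - y))\<^sup>2 / 2)) \<partial>\<mu> \<partial>\<mu>)"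
  proof -
    have "ennreal (\<bar>\<rho>\<bar> ^ DIM('a)) * ennreal (sqrt (2 * pi) ^ DIM('a)) = ennreal (\<bar>\<rho>\<bar> ^ DIM('a) * sqrt (2 * pi) ^ DIM('a))"
      by (rule ennreal_mult'[symmetric]) simp
    also have "\<bar>\<rho>\<bar> ^ DIM('a) * sqrt (2 * pi) ^ DIM('a) = (sqrt (2 * pi) * \<rho>) ^ DIM('a)"
      using \<rho> by (simp only: abs_of_pos power_mult_distrib) (rule mult.commute)
    finally show ?thesis by (simp only: mult.assoc[symmetric])
  qed
  finally show ?thesis .
qed

text \<open>The Fourier mass up to \<rho> is of order \<rho>^d times the energy at scale 1/\<rho>,
  and ball growth bounds each inner integral of that energy by a multiple of \<rho>^(-s).\<close>

lemma frostman_fourier_growth: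
  fixes \<mu> :: "'a::euclidean_space measure"
  assumes \<mu>: "frostman s \<mu>"
  shows "\<exists>C>0. \<forall>\<rho>\<ge>1. (\<integral>\<^sup>+\<xi>. ennreal ((cmod (fourier_transform \<mu> \<xi>))\<^sup>2) * ennreal (exp (- (norm \<xi> / \<rho>)\<^sup>2 / 2)) \<partial>lborel)
     \<le> ennreal (C * \<rho> powr (real DIM('a) - s))"
proof -
  obtain K where K: "0 < K" "\<And>\<rho> \<Phi> \<Psi>. 1 \<le> \<rho> \<Longrightarrow> \<Phi> \<in> borel_measurable borel \<Longrightarrow> \<Psi> \<in> borel_measurable borel \<Longrightarrow>
      (\<And>y z. dist y z \<le> 1 / \<rho> \<Longrightarrow> \<Phi> y \<le> \<Psi> z) \<Longrightarrow>
      (\<integral>\<^sup>+y. \<Phi> y \<partial>\<mu>) \<le> ennreal (K * \<rho> powr (real DIM('a) - s)) * (\<integral>\<^sup>+z. \<Psi> z \<partial>lborel)"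
    using smoothing_frostman[OF \<mu>] by metis
  have sb[measurable_cong]: "sets \<mu> = sets borel" and p: "prob_space \<mu>" using \<mu> by (auto simp: frostman_def)
  interpret prob_space \<mu> by fact
  define E where "E = exp ((2 * pi)\<^sup>2 / 2)"
  define V where "V = sqrt (2 * pi) ^ DIM('a)"
  \<comment> \<open>With the exponent halved the Gaussian has width 1 / (sqrt 2 pi \<rho>); a and V
    are the parts of its integral that do not depend on \<rho>.\<close>
  define a where "a = (1 / (sqrt 2 * pi)) ^ DIM('a)"
  have pos: "0 < E" "0 < V" "0 < a" by (auto simp: E_def V_def a_def)
  have inner: "(\<integral>\<^sup>+y. ennreal (exp (- (2 * pi * \<rho> * norm (x - y))\<^sup>2 / 2)) \<partial>\<mu>)
     \<le> ennreal (K * \<rho> powr (real DIM('a) - s) * (E * (a * (1 / \<rho>) ^ DIM('a) * V)))" if \<rho>: "1 \<le> \<rho>" for \<rho> x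
  proof -
    define \<Phi> where "\<Phi> y = ennreal (exp (- (2 * pi * \<rho> * norm (x - y))\<^sup>2 / 2))" for y
    define \<Psi> where "\<Psi> z = ennreal E * ennreal (exp (- (sqrt 2 * pi * \<rho> * norm (z - x))\<^sup>2 / 2))" for z
    have m: "\<Phi> \<in> borel_measurable borel" "\<Psi> \<in> borel_measurable borel"
      unfolding \<Phi>_def \<Psi>_def by measurable
    have "(\<integral>\<^sup>+y. \<Phi> y \<partial>\<mu>) \<le> ennreal (K * \<rho> powr (real DIM('a) - s)) * (\<integral>\<^sup>+z. \<Psi> z \<partial>lborel)"
    proof (rule K(2)[OF \<rho> m])
      fix y z :: 'a assume yz: "dist y z \<le> 1 / \<rho>"
      have "\<bar>2 * pi * \<rho> * norm (x - y) - 2 * pi * \<rho> * norm (x - z)\<bar> = 2 * pi * \<rho> * \<bar>norm (x - y) - norm (x - z)\<bar>"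
        using \<rho> by (simp add: right_diff_distrib[symmetric] abs_mult)
      also have "\<dots> \<le> 2 * pi * \<rho> * (1 / \<rho>)"
      proof (rule mult_left_mono)
        have "\<bar>norm (x - y) - norm (x - z)\<bar> \<le> norm ((x - y) - (x - z))" by (rule norm_triangle_ineq3)
        then show "\<bar>norm (x - y) - norm (x - z)\<bar> \<le> 1 / \<rho>" using yz by (simp add: dist_norm norm_minus_commute)
      qed (use \<rho> in simp)
      finally have "\<bar>2 * pi * \<rho> * norm (x - y) - 2 * pi * \<rho> * norm (x - z)\<bar> \<le> 2 * pi" using \<rho> by simp
      then have "- (2 * pi * \<rho> * norm (x - y))\<^sup>2 / 2 \<le> - (2 * pi * \<rho> * norm (x - z))\<^sup>2 / 4 + (2 * pi)\<^sup>2 / 2"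
        by (rule square_shift_le)
      also have "- (2 * pi * \<rho> * norm (x - z))\<^sup>2 / 4 = - (sqrt 2 * pi * \<rho> * norm (z - x))\<^sup>2 / 2"
        by (simp add: power_mult_distrib norm_minus_commute)
      finally have "exp (- (2 * pi * \<rho> * norm (x - y))\<^sup>2 / 2) \<le> E * exp (- (sqrt 2 * pi * \<rho> * norm (z - x))\<^sup>2 / 2)"
        unfolding E_def exp_add[symmetric] by (simp add: add.commute)
      then show "\<Phi> y \<le> \<Psi> z"
        unfolding \<Phi>_def \<Psi>_def using pos by (subst ennreal_mult'[symmetric]) (auto intro: ennreal_leI)
    qed
    also have "(\<integral>\<^sup>+z. \<Psi> z \<partial>lborel) = ennreal E * (\<integral>\<^sup>+z. ennreal (exp (- (sqrt 2 * pi * \<rho> * norm (z - x))\<^sup>2 / 2)) \<partial>lborel)"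
      unfolding \<Psi>_def by (rule nn_integral_cmult) measurable
    also have "(\<integral>\<^sup>+z. ennreal (exp (- (sqrt 2 * pi * \<rho> * norm (z - x))\<^sup>2 / 2)) \<partial>lborel) = ennreal (a * (1 / \<rho>) ^ DIM('a) * V)"
    proof -
      let ?c = "1 / (sqrt 2 * pi * \<rho>)"
      have c: "0 < ?c" using \<rho> by simp
      have "(\<integral>\<^sup>+z. ennreal (exp (- (sqrt 2 * pi * \<rho> * norm (z - x))\<^sup>2 / 2)) \<partial>lborel) =
         ennreal (\<bar>?c\<bar> ^ DIM('a)) * (\<integral>\<^sup>+z. ennreal (exp (- (sqrt 2 * pi * \<rho> * norm (x + ?c *\<^sub>R z - x))\<^sup>2 / 2)) \<partial>lborel)"
        using c by (intro nn_integral_affine_euclidean) auto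
      also have "(\<integral>\<^sup>+z. ennreal (exp (- (sqrt 2 * pi * \<rho> * norm (x + ?c *\<^sub>R z - x))\<^sup>2 / 2)) \<partial>lborel) =
        (\<integral>\<^sup>+z. 1 * ennreal (exp (- (norm (z::'a))\<^sup>2 / 2)) \<partial>lborel)"
        using \<rho> by (intro nn_integral_cong) simp
      also have "\<dots> = ennreal V * (\<integral>\<^sup>+z. 1 \<partial>(gauss :: 'a measure))"
        unfolding V_def by (rule nn_integral_gauss) simp
      also have "(\<integral>\<^sup>+z. 1 \<partial>(gauss :: 'a measure)) = 1"
        using prob_space.emeasure_space_1[OF prob_space_gauss] by simp
      also have "\<bar>?c\<bar> ^ DIM('a) = a * (1 / \<rho>) ^ DIM('a)"
        using c \<rho> by (simp add: a_def power_mult_distrib power_divide)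
      finally show ?thesis using pos \<rho> by (simp only: mult_1_right) (subst ennreal_mult', auto)
    qed
    also have "ennreal (K * \<rho> powr (real DIM('a) - s)) * (ennreal E * ennreal (a * (1 / \<rho>) ^ DIM('a) * V)) =
      ennreal (K * \<rho> powr (real DIM('a) - s) * (E * (a * (1 / \<rho>) ^ DIM('a) * V)))"
      using K(1) pos by (simp only: ennreal_mult'[symmetric] less_imp_le mult_nonneg_nonneg powr_ge_zero)
    finally show ?thesis by (simp only: \<Phi>_def)
  qed
  show ?thesis
  proof (intro exI[of _ "K * E * a * V * V"] conjI allI impI)
    show "0 < K * E * a * V * V" using K(1) pos by simp
    fix \<rho> :: real assume \<rho>: "1 \<le> \<rho>"
    let ?b = "K * \<rho> powr (real DIM('a) - s) * (E * (a * (1 / \<rho>) ^ DIM('a) * V))"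
    have "(\<integral>\<^sup>+\<xi>. ennreal ((cmod (fourier_transform \<mu> \<xi>))\<^sup>2) * ennreal (exp (- (norm \<xi> / \<rho>)\<^sup>2 / 2)) \<partial>lborel)
      = ennreal ((sqrt (2 * pi) * \<rho>) ^ DIM('a)) * (\<integral>\<^sup>+x. \<integral>\<^sup>+y. ennreal (exp (- (2 * pi * \<rho> * norm (x - y))\<^sup>2 / 2)) \<partial>\<mu> \<partial>\<mu>)"
      using \<rho> by (intro fourier_energy sb p) auto
    also have "\<dots> \<le> ennreal ((sqrt (2 * pi) * \<rho>) ^ DIM('a)) * (\<integral>\<^sup>+x. ennreal ?b \<partial>\<mu>)"
      by (intro mult_left_mono nn_integral_mono inner \<rho>) auto
    also have "(\<integral>\<^sup>+x. ennreal ?b \<partial>\<mu>) = ennreal ?b" using emeasure_space_1 by simp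
    also have "ennreal ((sqrt (2 * pi) * \<rho>) ^ DIM('a)) * ennreal ?b = ennreal ((sqrt (2 * pi) * \<rho>) ^ DIM('a) * ?b)"
      using \<rho> by (intro ennreal_mult'[symmetric]) simp
    also have "(sqrt (2 * pi) * \<rho>) ^ DIM('a) * ?b = K * E * a * V * V * \<rho> powr (real DIM('a) - s)"
      using \<rho> by (simp add: V_def power_mult_distrib power_divide)
    finally show "(\<integral>\<^sup>+\<xi>. ennreal ((cmod (fourier_transform \<mu> \<xi>))\<^sup>2) * ennreal (exp (- (norm \<xi> / \<rho>)\<^sup>2 / 2)) \<partial>lborel)
       \<le> ennreal (K * E * a * V * V * \<rho> powr (real DIM('a) - s))" .
  qed
qed

lemma powr_bounds_1_2:
  fixes x e :: real
  assumes "1 \<le> x" "x \<le> 2"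
  shows "2 powr - \<bar>e\<bar> \<le> x powr e" "x powr e \<le> 2 powr \<bar>e\<bar>"
proof -
  have l: "0 \<le> ln x" "ln x \<le> ln 2" using assms by auto
  have "\<bar>e * ln x\<bar> \<le> \<bar>e\<bar> * ln 2" using l by (simp add: abs_mult mult_left_mono)
  then have "- (\<bar>e\<bar> * ln 2) \<le> e * ln x" "e * ln x \<le> \<bar>e\<bar> * ln 2" by linarith+
  then show "2 powr - \<bar>e\<bar> \<le> x powr e" "x powr e \<le> 2 powr \<bar>e\<bar>" using assms by (auto simp: powr_def)
qed

text \<open>Each dyadic annulus 2^n \<le> 1 + |\<xi>| < 2^(n+1) contributes at most a multiple of
  2^(n (\<kappa> + d - s)), a convergent geometric series because \<kappa> < s - d.\<close>

lemma frostman_sobolev: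
  fixes \<mu> :: "'a::euclidean_space measure"
  assumes \<mu>: "frostman s \<mu>" and \<kappa>: "\<kappa> < s - real DIM('a)"
  shows "(\<integral>\<^sup>+\<xi>. ennreal ((cmod (fourier_transform \<mu> \<xi>))\<^sup>2 * (1 + norm \<xi>) powr \<kappa>) \<partial>lborel) < \<infinity>"
proof -
  have sb: "sets \<mu> = sets borel" and p: "prob_space \<mu>" using \<mu> by (auto simp: frostman_def)
  have [measurable]: "fourier_transform \<mu> \<in> borel_measurable borel" by (rule measurable_fourier_transform[OF sb p])
  obtain C where C: "0 < C" "\<And>\<rho>. 1 \<le> \<rho> \<Longrightarrow> (\<integral>\<^sup>+\<xi>. ennreal ((cmod (fourier_transform \<mu> \<xi>))\<^sup>2) * ennreal (exp (- (norm \<xi> / \<rho>)\<^sup>2 / 2)) \<partial>lborel)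
     \<le> ennreal (C * \<rho> powr (real DIM('a) - s))"
    using frostman_fourier_growth[OF \<mu>] by blast
  \<comment> \<open>On the n-th annulus |\<xi>| / 2^n \<le> 2, so the Gaussian is at least exp (-2)
    there; the power of 2 covers either sign of \<kappa>.\<close>
  define c where "c = 2 powr \<bar>\<kappa>\<bar> * exp 2"
  define q where "q = 2 powr (\<kappa> + real DIM('a) - s)"
  have c: "0 < c" by (simp add: c_def)
  have q: "0 < q" "q < 1"
    unfolding q_def using \<kappa> powr_less_mono[of "\<kappa> + real DIM('a) - s" 0 2] by auto
  let ?f = "\<lambda>n \<xi>. ennreal (c * (2 ^ n) powr \<kappa>) * (ennreal ((cmod (fourier_transform \<mu> \<xi>))\<^sup>2) * ennreal (exp (- (norm \<xi> / 2 ^ n)\<^sup>2 / 2)))"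
  have "(\<integral>\<^sup>+\<xi>. ennreal ((cmod (fourier_transform \<mu> \<xi>))\<^sup>2 * (1 + norm \<xi>) powr \<kappa>) \<partial>lborel) \<le> (\<integral>\<^sup>+\<xi>. (\<Sum>n. ?f n \<xi>) \<partial>lborel)"
  proof (rule nn_integral_mono)
    fix \<xi> :: 'a
    obtain n :: nat where n: "1 / 2 ^ Suc n < 1 / (1 + norm \<xi>)" "1 / (1 + norm \<xi>) \<le> 1 / 2 ^ n"
      by (rule dyadic_scale[of "1 / (1 + norm \<xi>)"]) (auto simp: add_pos_nonneg)
    define t where "t = (1 + norm \<xi>) / 2 ^ n"
    have pos: "0 < 1 + norm \<xi>" by (simp add: add_pos_nonneg)
    have n': "1 + norm \<xi> < 2 ^ Suc n" "2 ^ n \<le> 1 + norm \<xi>"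
      using n pos by (auto simp: field_simps)
    have t: "1 \<le> t" "t \<le> 2" using n' by (auto simp: t_def field_simps)
    have "(1 + norm \<xi>) powr \<kappa> = (2 ^ n) powr \<kappa> * t powr \<kappa>"
      using pos by (simp add: t_def powr_mult[symmetric])
    also have "\<dots> \<le> (2 ^ n) powr \<kappa> * (2 powr \<bar>\<kappa>\<bar> * (exp 2 * exp (- (norm \<xi> / 2 ^ n)\<^sup>2 / 2)))"
    proof (intro mult_left_mono)
      have "norm \<xi> / 2 ^ n \<le> 2" using n' by (simp add: field_simps)
      then have "(norm \<xi> / 2 ^ n)\<^sup>2 \<le> 2\<^sup>2" by (intro power_mono) auto
      then have "1 \<le> exp 2 * exp (- (norm \<xi> / 2 ^ n)\<^sup>2 / 2)" unfolding exp_add[symmetric] by simp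
      then have m: "2 powr \<bar>\<kappa>\<bar> * 1 \<le> 2 powr \<bar>\<kappa>\<bar> * (exp 2 * exp (- (norm \<xi> / 2 ^ n)\<^sup>2 / 2))" by (rule mult_left_mono) simp
      show "t powr \<kappa> \<le> 2 powr \<bar>\<kappa>\<bar> * (exp 2 * exp (- (norm \<xi> / 2 ^ n)\<^sup>2 / 2))"
        using powr_bounds_1_2(2)[OF t] m[unfolded mult_1_right] by (rule order_trans)
    qed simp
    finally have "(cmod (fourier_transform \<mu> \<xi>))\<^sup>2 * (1 + norm \<xi>) powr \<kappa> \<le>
       (cmod (fourier_transform \<mu> \<xi>))\<^sup>2 * ((2 ^ n) powr \<kappa> * (2 powr \<bar>\<kappa>\<bar> * (exp 2 * exp (- (norm \<xi> / 2 ^ n)\<^sup>2 / 2))))"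
      by (rule mult_left_mono) simp
    then have "ennreal ((cmod (fourier_transform \<mu> \<xi>))\<^sup>2 * (1 + norm \<xi>) powr \<kappa>) \<le>
       ennreal (c * (2 ^ n) powr \<kappa> * ((cmod (fourier_transform \<mu> \<xi>))\<^sup>2 * exp (- (norm \<xi> / 2 ^ n)\<^sup>2 / 2)))"
      by (intro ennreal_leI) (simp add: c_def mult_ac)
    also have "\<dots> = ?f n \<xi>" using c by (simp add: ennreal_mult)
    also have "\<dots> = (\<Sum>i\<in>{n}. ?f i \<xi>)" by simp
    also have "\<dots> \<le> (\<Sum>i. ?f i \<xi>)" by (rule sum_le_suminf) auto
    finally show "ennreal ((cmod (fourier_transform \<mu> \<xi>))\<^sup>2 * (1 + norm \<xi>) powr \<kappa>) \<le> (\<Sum>n. ?f n \<xi>)" .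
  qed
  also have "\<dots> = (\<Sum>n. \<integral>\<^sup>+\<xi>. ?f n \<xi> \<partial>lborel)" by (rule nn_integral_suminf) measurable
  also have "\<dots> \<le> (\<Sum>n. ennreal (c * C * q ^ n))"
  proof (rule suminf_le)
    fix n :: nat
    have "(\<integral>\<^sup>+\<xi>. ?f n \<xi> \<partial>lborel) = ennreal (c * (2 ^ n) powr \<kappa>) * (\<integral>\<^sup>+\<xi>. ennreal ((cmod (fourier_transform \<mu> \<xi>))\<^sup>2) * ennreal (exp (- (norm \<xi> / 2 ^ n)\<^sup>2 / 2)) \<partial>lborel)"
      by (rule nn_integral_cmult) measurable
    also have "\<dots> \<le> ennreal (c * (2 ^ n) powr \<kappa>) * ennreal (C * (2 ^ n) powr (real DIM('a) - s))"
      by (intro mult_left_mono C(2)) auto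
    also have "\<dots> = ennreal (c * (2 ^ n) powr \<kappa> * (C * (2 ^ n) powr (real DIM('a) - s)))"
      using c by (intro ennreal_mult'[symmetric]) simp
    also have "c * (2 ^ n) powr \<kappa> * (C * (2 ^ n) powr (real DIM('a) - s)) = c * C * ((2 ^ n) powr (\<kappa> + real DIM('a) - s))"
      by (simp add: powr_add powr_diff)
    also have "(2 ^ n) powr (\<kappa> + real DIM('a) - s) = q ^ n"
      by (simp add: q_def powr_realpow[symmetric] powr_powr mult.commute)
    finally show "(\<integral>\<^sup>+\<xi>. ?f n \<xi> \<partial>lborel) \<le> ennreal (c * C * q ^ n)" .
  qed auto
  also have "\<dots> = ennreal (\<Sum>n. c * C * q ^ n)"
    using c C(1) q by (intro suminf_ennreal2 summable_mult summable_geometric) auto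
  also have "\<dots> < \<infinity>" by simp
  finally show ?thesis .
qed

text \<open>The converse passage: a Gaussian of frequency width 1/r is at most a multiple of r^(u-d)
  times the Sobolev weight, so a finite Sobolev norm bounds the energy at scale r and with it the
  average mass of balls.\<close>

lemma sobolev_energy_ball:
  fixes \<mu> :: "'a::euclidean_space measure"
  assumes sb[measurable_cong]: "sets \<mu> = sets borel" and p: "prob_space \<mu>" and u: "u \<le> real DIM('a)"
    and fin: "(\<integral>\<^sup>+\<xi>. ennreal ((cmod (fourier_transform \<mu> \<xi>))\<^sup>2 * (1 + norm \<xi>) powr (u - real DIM('a))) \<partial>lborel) < \<infinity>"
  shows "\<exists>C>0. \<forall>r. 0 < r \<and> r \<le> 1 \<longrightarrow> (\<integral>\<^sup>+x. emeasure \<mu> (cball x r) \<partial>\<mu>) \<le> ennreal (C * r powr u)"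
proof -
  interpret prob_space \<mu> by fact
  have mf[measurable]: "fourier_transform \<mu> \<in> borel_measurable borel" by (rule measurable_fourier_transform[OF sb p])
  let ?d = "real DIM('a)"
  obtain A where A: "0 \<le> A" "(\<integral>\<^sup>+\<xi>. ennreal ((cmod (fourier_transform \<mu> \<xi>))\<^sup>2 * (1 + norm \<xi>) powr (u - ?d)) \<partial>lborel) = ennreal A"
    using fin by (auto simp: less_top_ennreal)
  define c where "c = exp ((?d - u)\<^sup>2 / 2)"
  have c: "0 < c" by (simp add: c_def)
  \<comment> \<open>With k = d - u \<ge> 0 this is k ln (1 + t) \<le> k t \<le> k^2 / 2 + t^2 / 2,
    whence the value of c.\<close>
  have decay: "exp (- t\<^sup>2 / 2) \<le> c * (1 + t) powr (u - ?d)" if t: "0 \<le> t" for t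
  proof -
    define k where "k = ?d - u"
    have k: "0 \<le> k" using u by (simp add: k_def)
    have "k * ln (1 + t) \<le> k * t" using t k by (intro mult_left_mono ln_add_one_self_le_self) auto
    moreover have "k * t \<le> k\<^sup>2 / 2 + t\<^sup>2 / 2" using sum_squares_bound[of k t] by (simp add: power2_eq_square)
    ultimately have "- t\<^sup>2 / 2 \<le> k\<^sup>2 / 2 + (u - ?d) * ln (1 + t)" by (simp add: k_def algebra_simps)
    then have "exp (- t\<^sup>2 / 2) \<le> exp (k\<^sup>2 / 2 + (u - ?d) * ln (1 + t))" by simp
    also have "\<dots> = c * (1 + t) powr (u - ?d)"
      using t unfolding exp_add by (simp add: powr_def c_def k_def)
    finally show ?thesis .
  qed
  define V where "V = sqrt (2 * pi) ^ DIM('a)"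
  have V: "0 < V" by (simp add: V_def)
  define E where "E = exp ((2 * pi)\<^sup>2 / 2)"
  show ?thesis
  proof (intro exI[of _ "E * (c * (A + 1)) / V"] conjI allI impI)
    show "0 < E * (c * (A + 1)) / V" using c A V by (auto simp: E_def intro!: divide_pos_pos mult_pos_pos)
    fix r :: real assume r: "0 < r \<and> r \<le> 1"
    define \<rho> where "\<rho> = 1 / r"
    have \<rho>: "1 \<le> \<rho>" using r by (simp add: \<rho>_def)
    let ?I = "\<integral>\<^sup>+x. \<integral>\<^sup>+y. ennreal (exp (- (2 * pi * \<rho> * norm (x - y))\<^sup>2 / 2)) \<partial>\<mu> \<partial>\<mu>"
    have "ennreal ((sqrt (2 * pi) * \<rho>) ^ DIM('a)) * ?I =
      (\<integral>\<^sup>+\<xi>. ennreal ((cmod (fourier_transform \<mu> \<xi>))\<^sup>2) * ennreal (exp (- (norm \<xi> / \<rho>)\<^sup>2 / 2)) \<partial>lborel)"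
      using \<rho> by (intro fourier_energy[symmetric] sb p) auto
    also have "\<dots> \<le> (\<integral>\<^sup>+\<xi>. ennreal (c * \<rho> powr (?d - u)) * ennreal ((cmod (fourier_transform \<mu> \<xi>))\<^sup>2 * (1 + norm \<xi>) powr (u - ?d)) \<partial>lborel)"
    proof (rule nn_integral_mono)
      fix \<xi> :: 'a
      have "exp (- (norm \<xi> / \<rho>)\<^sup>2 / 2) \<le> c * (1 + norm \<xi> / \<rho>) powr (u - ?d)" using \<rho> by (intro decay) auto
      \<comment> \<open>The exponent u - d is at most 0, so decreasing the base increases the
        power.\<close>
      also have "\<dots> \<le> c * ((1 + norm \<xi>) / \<rho>) powr (u - ?d)"
      proof (intro mult_left_mono powr_mono2')
        show "(1 + norm \<xi>) / \<rho> \<le> 1 + norm \<xi> / \<rho>" using \<rho> by (simp add: add_divide_distrib)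
      qed (use \<rho> u c in \<open>auto intro!: divide_pos_pos simp: add_pos_nonneg\<close>)
      also have "((1 + norm \<xi>) / \<rho>) powr (u - ?d) = \<rho> powr (?d - u) * (1 + norm \<xi>) powr (u - ?d)"
        using \<rho> powr_minus_divide[of \<rho> "?d - u"] by (simp add: powr_divide)
      finally have "(cmod (fourier_transform \<mu> \<xi>))\<^sup>2 * exp (- (norm \<xi> / \<rho>)\<^sup>2 / 2) \<le> (cmod (fourier_transform \<mu> \<xi>))\<^sup>2 * (c * (\<rho> powr (?d - u) * (1 + norm \<xi>) powr (u - ?d)))"
        by (rule mult_left_mono) simp
      then have "ennreal ((cmod (fourier_transform \<mu> \<xi>))\<^sup>2 * exp (- (norm \<xi> / \<rho>)\<^sup>2 / 2)) \<le> ennreal (c * \<rho> powr (?d - u) * ((cmod (fourier_transform \<mu> \<xi>))\<^sup>2 * (1 + norm \<xi>) powr (u - ?d)))"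
        by (intro ennreal_leI) (simp add: mult_ac)
      then show "ennreal ((cmod (fourier_transform \<mu> \<xi>))\<^sup>2) * ennreal (exp (- (norm \<xi> / \<rho>)\<^sup>2 / 2)) \<le> ennreal (c * \<rho> powr (?d - u)) * ennreal ((cmod (fourier_transform \<mu> \<xi>))\<^sup>2 * (1 + norm \<xi>) powr (u - ?d))"
        using c by (simp add: ennreal_mult'[symmetric])
    qed
    also have "\<dots> = ennreal (c * \<rho> powr (?d - u)) * ennreal A"
      unfolding A(2)[symmetric] by (rule nn_integral_cmult) measurable
    also have "\<dots> \<le> ennreal (c * \<rho> powr (?d - u) * (A + 1))"
      using c A(1) by (subst ennreal_mult'[symmetric]) (auto intro!: ennreal_leI mult_left_mono)
    finally have "ennreal (1 / (V * \<rho> ^ DIM('a))) * (ennreal ((sqrt (2 * pi) * \<rho>) ^ DIM('a)) * ?I) \<le>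
        ennreal (1 / (V * \<rho> ^ DIM('a))) * ennreal (c * \<rho> powr (?d - u) * (A + 1))"
      by (rule mult_left_mono) simp
    also have "ennreal (1 / (V * \<rho> ^ DIM('a))) * (ennreal ((sqrt (2 * pi) * \<rho>) ^ DIM('a)) * ?I) = ?I"
      using V \<rho> by (simp add: mult.assoc[symmetric] ennreal_mult'[symmetric] power_mult_distrib V_def)
    also have "ennreal (1 / (V * \<rho> ^ DIM('a))) * ennreal (c * \<rho> powr (?d - u) * (A + 1)) = ennreal (1 / (V * \<rho> ^ DIM('a)) * (c * \<rho> powr (?d - u) * (A + 1)))"
      using V \<rho> by (intro ennreal_mult'[symmetric]) simp
    also have "1 / (V * \<rho> ^ DIM('a)) * (c * \<rho> powr (?d - u) * (A + 1)) = c * (A + 1) / V * r powr u"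
    proof -
      have "\<rho> powr (?d - u) = \<rho> ^ DIM('a) * r powr u"
        using r \<rho> by (simp add: powr_diff powr_realpow) (simp add: \<rho>_def powr_divide)
      then show ?thesis using \<rho> by simp
    qed
    finally have I: "?I \<le> ennreal (c * (A + 1) / V * r powr u)" .
    have "(\<integral>\<^sup>+x. emeasure \<mu> (cball x r) \<partial>\<mu>) \<le> (\<integral>\<^sup>+x. \<integral>\<^sup>+y. ennreal E * ennreal (exp (- (2 * pi * \<rho> * norm (x - y))\<^sup>2 / 2)) \<partial>\<mu> \<partial>\<mu>)"
    proof (rule nn_integral_mono)
      fix x
      have "emeasure \<mu> (cball x r) = (\<integral>\<^sup>+y. indicator (cball x r) y \<partial>\<mu>)" by (simp add: sb)
      also have "\<dots> \<le> (\<integral>\<^sup>+y. ennreal E * ennreal (exp (- (2 * pi * \<rho> * norm (x - y))\<^sup>2 / 2)) \<partial>\<mu>)"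
      proof (rule nn_integral_mono)
        fix y
        show "indicator (cball x r) y \<le> ennreal E * ennreal (exp (- (2 * pi * \<rho> * norm (x - y))\<^sup>2 / 2))"
        proof (cases "y \<in> cball x r")
          case True
          then have "\<rho> * norm (x - y) \<le> 1" using r by (simp add: \<rho>_def dist_norm)
          then have "2 * pi * (\<rho> * norm (x - y)) \<le> 2 * pi * 1" by (intro mult_left_mono) auto
          then have "(2 * pi * \<rho> * norm (x - y))\<^sup>2 \<le> (2 * pi)\<^sup>2" using \<rho> by (intro power_mono) (auto simp: mult_ac)
          then have "1 \<le> E * exp (- (2 * pi * \<rho> * norm (x - y))\<^sup>2 / 2)" unfolding E_def exp_add[symmetric] by simp
          then have "1 \<le> ennreal (E * exp (- (2 * pi * \<rho> * norm (x - y))\<^sup>2 / 2))" by simp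
          then show ?thesis using True by (simp add: ennreal_mult'' )
        qed simp
      qed
      finally show "emeasure \<mu> (cball x r) \<le> (\<integral>\<^sup>+y. ennreal E * ennreal (exp (- (2 * pi * \<rho> * norm (x - y))\<^sup>2 / 2)) \<partial>\<mu>)" .
    qed
    also have "\<dots> = ennreal E * ?I" by (simp add: nn_integral_cmult)
    also have "\<dots> \<le> ennreal E * ennreal (c * (A + 1) / V * r powr u)" by (intro mult_left_mono I) simp
    also have "\<dots> = ennreal (E * (c * (A + 1)) / V * r powr u)"
      by (subst ennreal_mult'[symmetric]) (auto simp: E_def mult.assoc)
    finally show "(\<integral>\<^sup>+x. emeasure \<mu> (cball x r) \<partial>\<mu>) \<le> ennreal (E * (c * (A + 1)) / V * r powr u)" .
  qed
qed

section \<open>Images under families of similarities\<close>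

text \<open>The support may be smaller than K, so its compactness comes from its being closed: a
  point outside it has a null open neighbourhood, which lies outside it entirely.\<close>

lemma compact_radon_measuresI:
  fixes \<theta> :: "'a::euclidean_space measure"
  assumes sb: "sets \<theta> = sets borel" and p: "prob_space \<theta>" and K: "compact K" "emeasure \<theta> K = 1" "K \<subseteq> A"
  shows "\<theta> \<in> compact_radon_measures A"
proof -
  interpret prob_space \<theta> by fact
  have sp: "space \<theta> = UNIV" using sb sets_eq_imp_space_eq by fastforce
  have KE: "K \<in> events" using K(1) sb by (simp add: borel_compact)
  have sub: "measure_support \<theta> \<subseteq> K"
  proof
    fix x assume x: "x \<in> measure_support \<theta>"
    show "x \<in> K"
    proof (rule ccontr)
      assume "x \<notin> K"
      moreover have "open (- K)" using K(1) by (simp add: compact_imp_closed open_Compl)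
      ultimately have "0 < emeasure \<theta> (- K)" using x by (auto simp: measure_support_def)
      moreover have "emeasure \<theta> (- K) = 0"
        using emeasure_compl[OF KE] K(2) emeasure_space_1 by (simp add: sp Compl_eq_Diff_UNIV)
      ultimately show False by simp
    qed
  qed
  have "open (- measure_support \<theta>)"
  proof (subst open_subopen, intro ballI)
    fix x assume "x \<in> - measure_support \<theta>"
    then obtain U where U: "open U" "x \<in> U" "emeasure \<theta> U = 0"
      by (auto simp: measure_support_def not_gr_zero)
    then have "U \<subseteq> - measure_support \<theta>" by (auto simp: measure_support_def)
    then show "\<exists>T. open T \<and> x \<in> T \<and> T \<subseteq> - measure_support \<theta>" using U by blast
  qed
  then have "closed (measure_support \<theta>)" by (simp add: closed_def)
  then have "compact (measure_support \<theta>)"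
    using sub K(1) compact_Int_closed[OF K(1), of "measure_support \<theta>"] by (simp add: Int_absorb1)
  moreover have "radon_measure \<theta>"
    unfolding radon_measure_def using sb inner_regular[OF sb] emeasure_finite
    by (auto simp: less_top[symmetric] emeasure_space_1)
  ultimately show ?thesis
    unfolding compact_radon_measures_def using sub K(3) emeasure_space_1 by auto
qed

text \<open>The law of r x + z for independent r, x and z. A Dirac mass at 0 in the place of \<zeta>
  gives the law of r x alone.\<close>

definition sim_measure :: "real measure \<Rightarrow> 'a measure \<Rightarrow> 'a measure \<Rightarrow> 'a::euclidean_space measure" where
  "sim_measure \<nu> \<mu> \<zeta> = distr (\<nu> \<Otimes>\<^sub>M (\<mu> \<Otimes>\<^sub>M \<zeta>)) borel (\<lambda>p. fst p *\<^sub>R fst (snd p) + snd (snd p))"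

context
  fixes \<nu> :: "real measure" and \<mu> \<zeta> :: "'a::euclidean_space measure"
  assumes sets_eq[measurable_cong]: "sets \<nu> = sets borel" "sets \<mu> = sets borel" "sets \<zeta> = sets borel"
    and prob: "prob_space \<nu>" "prob_space \<mu>" "prob_space \<zeta>"
begin

interpretation \<nu>: prob_space \<nu> by (rule prob)
interpretation \<mu>: prob_space \<mu> by (rule prob)
interpretation \<zeta>: prob_space \<zeta> by (rule prob)
interpretation \<mu>\<zeta>: pair_prob_space \<mu> \<zeta> ..
interpretation \<nu>\<mu>\<zeta>: pair_prob_space \<nu> "\<mu> \<Otimes>\<^sub>M \<zeta>" ..

lemma sets_sim_measure: "sets (sim_measure \<nu> \<mu> \<zeta>) = sets borel"
  by (simp add: sim_measure_def)

lemma prob_space_sim_measure: "prob_space (sim_measure \<nu> \<mu> \<zeta>)"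
  unfolding sim_measure_def by (rule \<nu>\<mu>\<zeta>.prob_space_distr) measurable

lemma sim_measure_compact:
  assumes T: "compact T" "emeasure \<nu> T = 1" and E: "compact E" "emeasure \<mu> E = 1" and Z: "compact Z" "emeasure \<zeta> Z = 1"
  shows "compact (similarity_image (Z \<times> T) E)" "emeasure (sim_measure \<nu> \<mu> \<zeta>) (similarity_image (Z \<times> T) E) = 1"
proof -
  let ?f = "\<lambda>p :: real \<times> 'a \<times> 'a. fst p *\<^sub>R fst (snd p) + snd (snd p)"
  have im: "similarity_image (Z \<times> T) E = ?f ` (T \<times> (E \<times> Z))"
    unfolding similarity_image_def by (auto simp: image_iff Bex_def; metis)
  show c: "compact (similarity_image (Z \<times> T) E)"
    unfolding im by (intro compact_continuous_image compact_Times T E Z continuous_intros)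
  have [measurable]: "T \<in> sets \<nu>" "E \<in> sets \<mu>" "Z \<in> sets \<zeta>" "similarity_image (Z \<times> T) E \<in> sets borel"
    using T E Z c sets_eq by (auto simp: borel_compact)
  have "emeasure (\<nu> \<Otimes>\<^sub>M (\<mu> \<Otimes>\<^sub>M \<zeta>)) (T \<times> (E \<times> Z)) = emeasure \<nu> T * emeasure (\<mu> \<Otimes>\<^sub>M \<zeta>) (E \<times> Z)"
    by (rule sigma_finite_measure.emeasure_pair_measure_Times) (unfold_locales, measurable)
  moreover have "emeasure (\<mu> \<Otimes>\<^sub>M \<zeta>) (E \<times> Z) = emeasure \<mu> E * emeasure \<zeta> Z"
    by (rule sigma_finite_measure.emeasure_pair_measure_Times) (unfold_locales, measurable)
  ultimately
  have "1 = emeasure (\<nu> \<Otimes>\<^sub>M (\<mu> \<Otimes>\<^sub>M \<zeta>)) (T \<times> (E \<times> Z))"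
    using T E Z by simp
  also have "\<dots> \<le> emeasure (\<nu> \<Otimes>\<^sub>M (\<mu> \<Otimes>\<^sub>M \<zeta>)) (?f -` similarity_image (Z \<times> T) E \<inter> space (\<nu> \<Otimes>\<^sub>M (\<mu> \<Otimes>\<^sub>M \<zeta>)))"
  proof (rule emeasure_mono)
    have "T \<times> E \<times> Z \<subseteq> space (\<nu> \<Otimes>\<^sub>M (\<mu> \<Otimes>\<^sub>M \<zeta>))" by (rule sets.sets_into_space) measurable
    then show "T \<times> E \<times> Z \<subseteq> ?f -` similarity_image (Z \<times> T) E \<inter> space (\<nu> \<Otimes>\<^sub>M (\<mu> \<Otimes>\<^sub>M \<zeta>))"
      unfolding im by blast
  qed measurable
  also have "\<dots> = emeasure (sim_measure \<nu> \<mu> \<zeta>) (similarity_image (Z \<times> T) E)"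
    unfolding sim_measure_def by (rule emeasure_distr[symmetric]) measurable
  finally show "emeasure (sim_measure \<nu> \<mu> \<zeta>) (similarity_image (Z \<times> T) E) = 1"
    using prob_space.emeasure_le_1[OF prob_space_sim_measure] by (simp add: antisym)
qed

text \<open>The translation z enters additively, so its phase splits off; the dilation r and x stay
  coupled in the bilinear factor.\<close>

lemma fourier_transform_sim_measure:
  "fourier_transform (sim_measure \<nu> \<mu> \<zeta>) \<xi> =
     (\<integral>r. \<integral>x. iexp (- (2 * pi * r * (\<xi> \<bullet> x))) \<partial>\<mu> \<partial>\<nu>) * fourier_transform \<zeta> \<xi>"
proof -
  have split: "iexp (- (2 * pi * (\<xi> \<bullet> (r *\<^sub>R x + z)))) = iexp (- (2 * pi * r * (\<xi> \<bullet> x))) * iexp (- (2 * pi * (\<xi> \<bullet> z)))" for r x z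
    unfolding exp_add[symmetric] by (rule arg_cong[where f = exp]) (simp add: inner_add_right algebra_simps)
  have "fourier_transform (sim_measure \<nu> \<mu> \<zeta>) \<xi> =
    (\<integral>p. iexp (- (2 * pi * (\<xi> \<bullet> (fst p *\<^sub>R fst (snd p) + snd (snd p))))) \<partial>(\<nu> \<Otimes>\<^sub>M (\<mu> \<Otimes>\<^sub>M \<zeta>)))"
    unfolding fourier_transform_iexp sim_measure_def by (rule integral_distr) measurable
  also have "\<dots> = (\<integral>r. \<integral>q. iexp (- (2 * pi * (\<xi> \<bullet> (r *\<^sub>R fst q + snd q)))) \<partial>(\<mu> \<Otimes>\<^sub>M \<zeta>) \<partial>\<nu>)"
    by (subst \<nu>\<mu>\<zeta>.integral_fst'[symmetric]) (auto intro!: \<nu>\<mu>\<zeta>.integrable_const_bound[where B = 1])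
  also have "\<dots> = (\<integral>r. \<integral>x. \<integral>z. iexp (- (2 * pi * (\<xi> \<bullet> (r *\<^sub>R x + z)))) \<partial>\<zeta> \<partial>\<mu> \<partial>\<nu>)"
    by (subst \<mu>\<zeta>.integral_fst'[symmetric]) (auto intro!: \<mu>\<zeta>.integrable_const_bound[where B = 1])
  also have "\<dots> = (\<integral>r. \<integral>x. iexp (- (2 * pi * r * (\<xi> \<bullet> x))) \<partial>\<mu> \<partial>\<nu>) * fourier_transform \<zeta> \<xi>"
    unfolding split fourier_transform_iexp by simp
  finally show ?thesis .
qed

end

text \<open>For |\<xi>| \<ge> 1 the bases |\<xi>| and 1 + |\<xi>| differ by a factor of at most 2;
  for smaller \<xi> the trivial bound 1 suffices. The sign of the exponent is not known, hence its
  absolute value in the constant.\<close>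

lemma bilinear_decay_everywhere:
  fixes \<mu> :: "'a::euclidean_space measure" and \<nu> :: "real measure"
  assumes \<mu>: "frostman \<alpha> \<mu>" "AE x in \<mu>. x \<in> cball 0 B"
    and \<nu>: "frostman \<beta> \<nu>" "AE r in \<nu>. r \<in> cball 0 B" and B: "0 \<le> B"
  shows "\<exists>C>0. \<forall>\<xi>. (cmod (\<integral>r. \<integral>x. iexp (- (2 * pi * r * (\<xi> \<bullet> x))) \<partial>\<mu> \<partial>\<nu>))\<^sup>2
      \<le> C * (1 + norm \<xi>) powr (real DIM('a) - \<alpha> - \<beta>)"
proof -
  let ?F = "\<lambda>\<xi>. \<integral>r. \<integral>x. iexp (- (2 * pi * r * (\<xi> \<bullet> x))) \<partial>\<mu> \<partial>\<nu>" and ?e = "real DIM('a) - \<alpha> - \<beta>"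
  interpret \<mu>: prob_space \<mu> using \<mu> by (simp add: frostman_def)
  interpret \<nu>: prob_space \<nu> using \<nu> by (simp add: frostman_def)
  have s[measurable_cong]: "sets \<mu> = sets borel" "sets \<nu> = sets borel" using \<mu> \<nu> by (auto simp: frostman_def)
  obtain C where C: "0 < C" "\<And>\<xi>. 1 \<le> norm \<xi> \<Longrightarrow> (cmod (?F \<xi>))\<^sup>2 \<le> C * norm \<xi> powr ?e"
    using bilinear_decay[OF \<mu> \<nu> B] by blast
  show ?thesis
  proof (intro exI[of _ "(C + 1) * 2 powr \<bar>?e\<bar>"] conjI allI)
    show "0 < (C + 1) * 2 powr \<bar>?e\<bar>" using C by simp
    fix \<xi> :: 'a
    have pos: "0 < 1 + norm \<xi>" by (simp add: add_pos_nonneg)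
    show "(cmod (?F \<xi>))\<^sup>2 \<le> (C + 1) * 2 powr \<bar>?e\<bar> * (1 + norm \<xi>) powr ?e"
    proof (cases "1 \<le> norm \<xi>")
      case True
      define t where "t = (1 + norm \<xi>) / norm \<xi>"
      have "0 < norm \<xi>" using True by linarith
      then have t: "1 \<le> t" "t \<le> 2" using True by (simp_all add: t_def pos_le_divide_eq pos_divide_le_eq)
      have "norm \<xi> powr e = t powr - e * (1 + norm \<xi>) powr e" for e
        using True pos by (simp add: t_def powr_divide powr_minus_divide)
      then have "norm \<xi> powr ?e = t powr - ?e * (1 + norm \<xi>) powr ?e" .
      also have "\<dots> \<le> 2 powr \<bar>?e\<bar> * (1 + norm \<xi>) powr ?e"
        using powr_bounds_1_2(2)[OF t, of "- ?e"] unfolding abs_minus_cancel by (rule mult_right_mono) simp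
      finally have "C * norm \<xi> powr ?e \<le> (C + 1) * (2 powr \<bar>?e\<bar> * (1 + norm \<xi>) powr ?e)"
        using C(1) by (intro mult_mono) auto
      then show ?thesis using C(2)[OF True] by (simp add: mult.assoc)
    next
      case False
      have "cmod (\<integral>x. iexp (- (2 * pi * r * (\<xi> \<bullet> x))) \<partial>\<mu>) \<le> 1" for r
      proof -
        have "cmod (\<integral>x. iexp (- (2 * pi * r * (\<xi> \<bullet> x))) \<partial>\<mu>) \<le> (\<integral>x. cmod (iexp (- (2 * pi * r * (\<xi> \<bullet> x)))) \<partial>\<mu>)"
          by (rule integral_norm_bound)
        then show ?thesis by (simp add: \<mu>.prob_space)
      qed
      note inner = this
      have "cmod (?F \<xi>) \<le> (\<integral>r. cmod (\<integral>x. iexp (- (2 * pi * r * (\<xi> \<bullet> x))) \<partial>\<mu>) \<partial>\<nu>)" by (rule integral_norm_bound)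
      also have "\<dots> \<le> (\<integral>r. 1 \<partial>\<nu>)"
      proof (rule integral_mono)
        show "integrable \<nu> (\<lambda>r. cmod (\<integral>x. iexp (- (2 * pi * r * (\<xi> \<bullet> x))) \<partial>\<mu>))"
          by (rule \<nu>.integrable_const_bound[where B = 1]) (use inner in auto)
      qed (use inner in auto)
      finally have "cmod (?F \<xi>) \<le> 1" by (simp add: \<nu>.prob_space)
      then have "(cmod (?F \<xi>))\<^sup>2 \<le> 1\<^sup>2" by (intro power_mono) auto
      also have "1\<^sup>2 \<le> 2 powr \<bar>?e\<bar> * (1 + norm \<xi>) powr ?e"
      proof -
        have "2 powr - \<bar>?e\<bar> \<le> (1 + norm \<xi>) powr ?e" using False by (intro powr_bounds_1_2(1)) auto
        then have "2 powr \<bar>?e\<bar> * 2 powr - \<bar>?e\<bar> \<le> 2 powr \<bar>?e\<bar> * (1 + norm \<xi>) powr ?e" by (rule mult_left_mono) simp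
        then show ?thesis by (simp add: powr_add[symmetric])
      qed
      also have "\<dots> \<le> (C + 1) * (2 powr \<bar>?e\<bar> * (1 + norm \<xi>) powr ?e)"
        using C(1) mult_right_mono[of 1 "C + 1" "2 powr \<bar>?e\<bar> * (1 + norm \<xi>) powr ?e"] by simp
      finally show ?thesis by (simp add: mult.assoc)
    qed
  qed
qed

section \<open>From Frostman and energy bounds to dimension and volume\<close>

text \<open>For s > d smoothing bounds the total mass 1 by a multiple of \<rho>^(d-s), which tends
  to 0.\<close>

lemma frostman_exponent_le:
  fixes \<mu> :: "'a::euclidean_space measure"
  assumes \<mu>: "frostman s \<mu>" and K: "bounded K" "emeasure \<mu> K = 1"
  shows "s \<le> real DIM('a)"
proof (rule ccontr)
  assume "\<not> ?thesis"
  then have neg: "real DIM('a) - s < 0" by simp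
  obtain C where C: "0 < C" "\<And>\<rho> \<Phi> \<Psi>. 1 \<le> \<rho> \<Longrightarrow> \<Phi> \<in> borel_measurable borel \<Longrightarrow> \<Psi> \<in> borel_measurable borel \<Longrightarrow>
      (\<And>y z. dist y z \<le> 1 / \<rho> \<Longrightarrow> \<Phi> y \<le> \<Psi> z) \<Longrightarrow>
      (\<integral>\<^sup>+y. \<Phi> y \<partial>\<mu>) \<le> ennreal (C * \<rho> powr (real DIM('a) - s)) * (\<integral>\<^sup>+z. \<Psi> z \<partial>lborel)"
    using smoothing_frostman[OF \<mu>] by metis
  obtain B where B: "0 \<le> B" "K \<subseteq> cball 0 B"
  proof -
    obtain b where "0 < b" "\<forall>x\<in>K. norm x \<le> b" using K(1) unfolding bounded_pos by blast
    moreover from this(2) have "K \<subseteq> cball 0 b" by auto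
    ultimately show ?thesis using that[of b] by simp
  qed
  have sb: "sets \<mu> = sets borel" and p: "prob_space \<mu>" using \<mu> by (auto simp: frostman_def)
  define V where "V = measure lborel (cball (0::'a) (B + 1))"
  have V: "emeasure lborel (cball (0::'a) (B + 1)) = ennreal V"
    using emeasure_lborel_cball_finite[of "0::'a" "B + 1"]
    unfolding V_def by (intro emeasure_eq_ennreal_measure) auto
  have bound: "1 \<le> C * \<rho> powr (real DIM('a) - s) * V" if \<rho>: "1 \<le> \<rho>" for \<rho>
  proof -
    have "1 \<le> emeasure \<mu> (cball 0 B)" using K(2) B(2) sb by (metis emeasure_mono borel_closed closed_cball)
    also have "\<dots> = (\<integral>\<^sup>+y. indicator (cball 0 B) y \<partial>\<mu>)" by (simp add: sb)
    also have "\<dots> \<le> ennreal (C * \<rho> powr (real DIM('a) - s)) * (\<integral>\<^sup>+z. indicator (cball (0::'a) (B + 1)) z \<partial>lborel)"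
    proof (intro C(2)[OF \<rho>] borel_measurable_indicator)
      fix y z :: 'a assume yz: "dist y z \<le> 1 / \<rho>"
      have "1 / \<rho> \<le> 1" using \<rho> by simp
      then have "norm z \<le> B + 1" if "norm y \<le> B"
        using that yz norm_triangle_ineq2[of z y] by (simp add: dist_norm norm_minus_commute)
      then show "indicator (cball 0 B) y \<le> (indicator (cball 0 (B + 1)) z :: ennreal)" by (auto simp: indicator_def)
    qed auto
    also have "\<dots> = ennreal (C * \<rho> powr (real DIM('a) - s) * V)"
      using C(1) by (simp add: V ennreal_mult'')
        (simp add: V_def ennreal_mult'')
    finally show ?thesis by simp
  qed
  have "((\<lambda>\<rho>. C * \<rho> powr (real DIM('a) - s) * V) \<longlongrightarrow> C * 0 * V) at_top"
    using neg by (intro tendsto_intros tendsto_neg_powr filterlim_ident)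
  then have "eventually (\<lambda>\<rho>. C * \<rho> powr (real DIM('a) - s) * V < 1) at_top"
    by (rule order_tendstoD) simp
  moreover have "eventually (\<lambda>\<rho>::real. 1 \<le> \<rho>) at_top" by (rule eventually_ge_at_top)
  ultimately have "eventually (\<lambda>\<rho>::real. False) at_top"
    by eventually_elim (use bound in force)
  then show False by simp
qed

text \<open>The upper bound comes from Frostman's lemma itself, not from a covering by cubes. Real
  values of the dimensions turn extended sums into ordinary arithmetic.\<close>

lemma hausdorff_dim_real:
  fixes A :: "'a::euclidean_space set"
  assumes A: "A \<in> sets borel" "A \<noteq> {}"
  obtains a where "hausdorff_dim A = ereal a" "0 \<le> a" "a \<le> real DIM('a)"
proof -
  have 0: "0 \<le> hausdorff_dim A"
    unfolding hausdorff_dim_def by (intro Inf_greatest) auto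
  have "hausdorff_dim A \<le> ereal (real DIM('a))"
  proof (rule ccontr)
    assume "\<not> ?thesis"
    then obtain s where s: "ereal (real DIM('a)) < ereal s" "ereal s < hausdorff_dim A"
      using ereal_dense2[of "ereal (real DIM('a))" "hausdorff_dim A"] by (auto simp: not_le)
    obtain K :: "'a set" and \<mu> :: "'a measure" where "compact K" "frostman s \<mu>" "emeasure \<mu> K = 1" using frostman_borel[OF A s(2)] by metis
    then have "s \<le> real DIM('a)" by (intro frostman_exponent_le) (auto simp: compact_imp_bounded)
    then show False using s by simp
  qed
  with 0 show ?thesis using that by (cases "hausdorff_dim A") auto
qed

text \<open>Let g z be the mass of the ball of radius r about z, supported in a neighbourhood U of
  K. The integral of g is of order r^d, that of g^2 at most of order r^(2d) by the energy bound, so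
  Cauchy-Schwarz bounds the volume of U below independently of r.\<close>

theorem positive_volume:
  fixes \<theta> :: "'a::euclidean_space measure"
  assumes sb[measurable_cong]: "sets \<theta> = sets borel" and p: "prob_space \<theta>" and K: "compact K" "emeasure \<theta> K = 1"
    and C: "0 < C" "\<And>r. 0 < r \<Longrightarrow> r \<le> 1 \<Longrightarrow> (\<integral>\<^sup>+x. emeasure \<theta> (cball x r) \<partial>\<theta>) \<le> ennreal (C * r powr real DIM('a))"
  shows "0 < emeasure lborel K"
proof (rule ccontr)
  interpret prob_space \<theta> by fact
  interpret pair_sigma_finite lborel \<theta> ..
  assume "\<not> ?thesis"
  then have K0: "emeasure lborel K = 0" by (simp add: not_gr_zero)
  let ?d = "DIM('a)" and ?v = "unit_ball_vol (real DIM('a))"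
  have v: "0 < ?v" by simp
  have KB: "K \<in> sets borel" using K(1) by (simp add: borel_compact)
  \<comment> \<open>Chosen so that Cauchy-Schwarz would bound a positive square by half of
    itself.\<close>
  define \<epsilon> where "\<epsilon> = ?v / (2 * (C * 2 ^ ?d))"
  have \<epsilon>: "0 < \<epsilon>" using C v by (simp add: \<epsilon>_def)
  obtain U where U: "open U" "K \<subseteq> U" "emeasure lebesgue (U - K) < ennreal \<epsilon>"
    using sets_lebesgue_outer_open[of K \<epsilon>] KB \<epsilon> by auto
  have UB[measurable]: "U \<in> sets borel" using U(1) by simp
  have "emeasure lborel U \<le> emeasure lborel K + emeasure lborel (U - K)"
    using KB U by (subst plus_emeasure) (auto intro!: emeasure_mono)
  also have "\<dots> \<le> ennreal \<epsilon>" using U(3) KB UB K0 by simp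
  finally have U\<epsilon>: "emeasure lborel U \<le> ennreal \<epsilon>" .
  obtain r0 where r0: "0 < r0" "\<And>x. x \<in> K \<Longrightarrow> cball x r0 \<subseteq> U"
  proof (cases "- U = {}")
    case True then show ?thesis using that[of 1] by auto
  next
    case False
    have "\<exists>d>0. \<forall>x\<in>K. \<forall>y\<in>- U. d \<le> dist x y"
      using U K(1) by (intro separate_compact_closed) auto
    then obtain d where d: "d > 0" "\<And>x y. x \<in> K \<Longrightarrow> y \<in> - U \<Longrightarrow> d \<le> dist x y" by blast
    then show ?thesis using that[of "d / 2"] by force
  qed
  define r where "r = min (r0 / 2) (1 / 2)"
  have r: "0 < r" "2 * r \<le> 1" "r \<le> r0" using r0(1) by (auto simp: r_def)
  define J where "J z x = (indicator {p. dist (fst p) (snd p) \<le> r} (z, x) :: ennreal)" for z x :: 'a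
  have [measurable]: "(\<lambda>p. J (fst p) (snd p)) \<in> borel_measurable (lborel \<Otimes>\<^sub>M \<theta>)" unfolding J_def by measurable
  have [measurable]: "J z \<in> borel_measurable borel" for z unfolding J_def by measurable
  have [measurable]: "(\<lambda>z. J z x) \<in> borel_measurable borel" for x unfolding J_def by measurable
  define g where "g z = (\<integral>\<^sup>+x. J z x \<partial>\<theta>)" for z
  have [measurable]: "g \<in> borel_measurable borel" unfolding g_def J_def by measurable
  have Jvol: "(\<integral>\<^sup>+z. J z x \<partial>lborel) = ennreal (?v * r ^ ?d)" for x
  proof -
    have "(\<integral>\<^sup>+z. J z x \<partial>lborel) = (\<integral>\<^sup>+z. indicator (cball x r) z \<partial>lborel)"
      by (intro nn_integral_cong) (simp add: J_def indicator_def dist_commute)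
    then show ?thesis using r by (simp add: emeasure_cball)
  qed
  have gK: "g z = (\<integral>\<^sup>+x. J z x * indicator K x \<partial>\<theta>)" for z
  proof -
    have "AE x in \<theta>. x \<in> K" using K(2) KB sb by (simp add: AE_in_set_eq_1 emeasure_eq_measure)
    then show ?thesis unfolding g_def by (intro nn_integral_cong_AE) (auto elim!: eventually_mono)
  qed
  \<comment> \<open>A point z that sees mass within distance r is within r0 of K, hence in
    U.\<close>
  have gU: "g z * indicator U z = g z" for z
  proof (cases "z \<in> U")
    case False
    have "J z x * indicator K x = 0" for x
    proof (cases "x \<in> K \<and> dist z x \<le> r")
      case True
      then have "z \<in> cball x r0" using r(3) by (simp add: dist_commute)
      then show ?thesis using r0(2)[of x] True False by blast
    qed (auto simp: J_def indicator_def)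
    then have "g z = (\<integral>\<^sup>+x. 0 \<partial>\<theta>)" unfolding gK by (intro nn_integral_cong)
    then show ?thesis by simp
  qed simp
  have int_g: "(\<integral>\<^sup>+z. g z \<partial>lborel) = ennreal (?v * r ^ ?d)"
  proof -
    have "(\<integral>\<^sup>+z. g z \<partial>lborel) = (\<integral>\<^sup>+x. \<integral>\<^sup>+z. J z x \<partial>lborel \<partial>\<theta>)"
      unfolding g_def by (rule Fubini'[symmetric]) (simp add: case_prod_unfold)
    then show ?thesis by (simp add: Jvol emeasure_space_1)
  qed
  have int_g2: "(\<integral>\<^sup>+z. (g z)\<^sup>2 \<partial>lborel) \<le> ennreal (?v * r ^ ?d * (C * (2 * r) ^ ?d))"
  proof -
    have "(\<integral>\<^sup>+z. (g z)\<^sup>2 \<partial>lborel) = (\<integral>\<^sup>+z. \<integral>\<^sup>+x. J z x * g z \<partial>\<theta> \<partial>lborel)"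
      by (intro nn_integral_cong) (subst nn_integral_multc, simp_all add: g_def power2_eq_square)
    also have "\<dots> = (\<integral>\<^sup>+x. \<integral>\<^sup>+z. J z x * g z \<partial>lborel \<partial>\<theta>)"
      by (rule Fubini'[symmetric]) (simp add: case_prod_unfold)
    also have "\<dots> \<le> (\<integral>\<^sup>+x. \<integral>\<^sup>+z. J z x * emeasure \<theta> (cball x (2 * r)) \<partial>lborel \<partial>\<theta>)"
    proof (intro nn_integral_mono)
      fix x z
      show "J z x * g z \<le> J z x * emeasure \<theta> (cball x (2 * r))"
      proof (cases "dist z x \<le> r")
        case True
        have "g z = emeasure \<theta> (cball z r)"
          by (simp add: g_def J_def sb nn_integral_indicator[symmetric] indicator_def cball_def)
        also have "\<dots> \<le> emeasure \<theta> (cball x (2 * r))"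
        proof (rule emeasure_mono)
          show "cball z r \<subseteq> cball x (2 * r)"
          proof
            fix y assume "y \<in> cball z r"
            then show "y \<in> cball x (2 * r)" using True dist_triangle[of x y z] by (simp add: dist_commute)
          qed
        qed (simp add: sb)
        finally show ?thesis by (rule mult_left_mono) simp
      qed (simp add: J_def)
    qed
    also have "\<dots> = (\<integral>\<^sup>+x. ennreal (?v * r ^ ?d) * emeasure \<theta> (cball x (2 * r)) \<partial>\<theta>)"
      by (intro nn_integral_cong) (subst nn_integral_multc, simp_all add: Jvol)
    also have "\<dots> = ennreal (?v * r ^ ?d) * (\<integral>\<^sup>+x. emeasure \<theta> (cball x (2 * r)) \<partial>\<theta>)"
    proof (rule nn_integral_cmult)
      have "(\<lambda>x. \<integral>\<^sup>+y. indicator {p. dist (fst p) (snd p) \<le> 2 * r} (x, y) \<partial>\<theta>) \<in> borel_measurable \<theta>" by measurable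
      also have "(\<lambda>x. \<integral>\<^sup>+y. indicator {p. dist (fst p) (snd p) \<le> 2 * r} (x, y) \<partial>\<theta>) = (\<lambda>x. emeasure \<theta> (cball x (2 * r)))"
        by (rule ext) (simp add: sb nn_integral_indicator[symmetric] indicator_def cball_def)
      finally show "(\<lambda>x. emeasure \<theta> (cball x (2 * r))) \<in> borel_measurable \<theta>" .
    qed
    also have "\<dots> \<le> ennreal (?v * r ^ ?d) * ennreal (C * (2 * r) powr real ?d)"
      using r by (intro mult_left_mono C(2)) auto
    also have "\<dots> = ennreal (?v * r ^ ?d * (C * (2 * r) ^ ?d))"
      using r v by (subst ennreal_mult'[symmetric]) (auto simp: powr_realpow)
    finally show ?thesis .
  qed
  have "(\<integral>\<^sup>+z. g z * indicator U z \<partial>lborel)\<^sup>2 \<le> (\<integral>\<^sup>+z. (g z)\<^sup>2 \<partial>lborel) * (\<integral>\<^sup>+z. (indicator U z)\<^sup>2 \<partial>lborel)"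
    by (rule Cauchy_Schwarz_nn_integral) measurable
  also have "(\<integral>\<^sup>+z. (indicator U z :: ennreal)\<^sup>2 \<partial>lborel) = emeasure lborel U"
  proof -
    have "(\<integral>\<^sup>+z. (indicator U z :: ennreal)\<^sup>2 \<partial>lborel) = (\<integral>\<^sup>+z. indicator U z \<partial>lborel)"
      by (intro nn_integral_cong) (simp add: indicator_def)
    then show ?thesis by simp
  qed
  also have "(\<integral>\<^sup>+z. (g z)\<^sup>2 \<partial>lborel) * emeasure lborel U \<le> ennreal (?v * r ^ ?d * (C * (2 * r) ^ ?d)) * ennreal \<epsilon>"
    by (intro mult_mono int_g2 U\<epsilon>) auto
  finally have "ennreal ((?v * r ^ ?d)\<^sup>2) \<le> ennreal (?v * r ^ ?d * (C * (2 * r) ^ ?d) * \<epsilon>)"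
    unfolding gU int_g using r C(1) v \<epsilon> by (simp add: ennreal_power ennreal_mult'[symmetric])
  then have "(?v * r ^ ?d)\<^sup>2 \<le> ?v * r ^ ?d * (C * (2 * r) ^ ?d) * \<epsilon>"
    using r C(1) v \<epsilon> by (simp add: ennreal_le_iff)
  also have "\<dots> = (?v * r ^ ?d)\<^sup>2 / 2"
    using C(1) by (simp add: \<epsilon>_def power_mult_distrib power2_eq_square)
  finally have "(?v * r ^ ?d)\<^sup>2 \<le> 0" by simp
  moreover have "0 < (?v * r ^ ?d)\<^sup>2" using r by (intro zero_less_power mult_pos_pos v) auto
  ultimately show False by simp
qed

text \<open>Mass distribution principle: a covering set that meets G lies in a ball centred in G
  with its diameter as radius. Radius 0 is included because the set may be a single point.\<close>

lemma hausdorff_dim_ge: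
  fixes \<theta> :: "'a::euclidean_space measure"
  assumes sb: "sets \<theta> = sets borel" and G: "G \<in> sets borel" "0 < emeasure \<theta> G" "G \<subseteq> A"
    and M: "0 < M" "\<And>x r. x \<in> G \<Longrightarrow> 0 \<le> r \<Longrightarrow> r \<le> 1 \<Longrightarrow> emeasure \<theta> (cball x r) \<le> ennreal (M * r powr u)"
    and u: "0 < u"
  shows "ereal u \<le> hausdorff_dim A"
  unfolding hausdorff_dim_def
proof (rule Inf_greatest, clarify)
  fix s assume s: "0 \<le> s" "hausdorff_measure s A = 0"
  show "ereal u \<le> ereal s"
  proof (rule ccontr)
    assume "\<not> ?thesis"
    then have su: "s < u" by simp
    have "hausdorff_premeasure s 1 A \<le> hausdorff_measure s A"
      unfolding hausdorff_measure_def by (rule SUP_upper) simp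
    then have pre0: "hausdorff_premeasure s 1 A = 0" using s(2) by simp
    obtain e where e: "0 < e" "ennreal M * e < emeasure \<theta> G"
    proof -
      obtain c where c: "0 < c" "c < emeasure \<theta> G" using G(2) dense by blast
      then obtain c' where c': "c = ennreal c'" "0 < c'" by (cases c) auto
      have "ennreal M * ennreal (c' / M) = c"
        using M(1) c' by (subst ennreal_mult'[symmetric]) auto
      then show ?thesis using that[of "ennreal (c' / M)"] c(2) c' M(1) by simp
    qed
    obtain U where U: "A \<subseteq> (\<Union>i. U i)" "\<And>i. bounded (U i)" "\<And>i. diameter (U i) \<le> 1"
      "(\<Sum>i. hausdorff_gauge s (U i)) < e"
      using e(1) pre0 unfolding hausdorff_premeasure_def by (auto simp: INF_less_iff dest!: eq_refl[THEN order.strict_trans1])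
    have "\<exists>B\<in>sets borel. U i \<inter> G \<subseteq> B \<and> emeasure \<theta> B \<le> ennreal M * hausdorff_gauge s (U i)" for i :: nat
    proof (cases "U i \<inter> G = {}")
      case True then show ?thesis by (intro bexI[of _ "{}"]) auto
    next
      case False
      then obtain x where x: "x \<in> U i" "x \<in> G" by blast
      let ?D = "diameter (U i)"
      have D: "0 \<le> ?D" "?D \<le> 1" using U by (auto simp: diameter_ge_0)
      have "U i \<subseteq> cball x ?D" using diameter_bounded_bound[OF U(2)] x by auto
      moreover have "emeasure \<theta> (cball x ?D) \<le> ennreal (M * ?D powr u)" using M(2) x D by blast
      moreover have "ennreal (M * ?D powr u) \<le> ennreal M * hausdorff_gauge s (U i)"
      proof -
        have "ennreal (?D powr u) \<le> hausdorff_gauge s (U i)"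
        \<comment> \<open>At s = 0 the gauge of a non-empty set is 1, while powr would give 0 for a
          single point.\<close>
        proof (cases "s = 0")
          case True
          have "?D powr u \<le> 1" using D u by (simp add: powr_le1)
          then show ?thesis using True x by (auto simp: hausdorff_gauge_def)
        next
          case False
          have "?D powr u \<le> ?D powr s" using D su by (intro powr_mono') auto
          then show ?thesis using False x by (auto simp: hausdorff_gauge_def intro: ennreal_leI)
        qed
        then show ?thesis using M(1) by (subst ennreal_mult') (auto intro: mult_left_mono)
      qed
      ultimately show ?thesis by (intro bexI[of _ "cball x ?D"]) auto
    qed
    then obtain B where B: "\<And>i. B i \<in> sets borel" "\<And>i. U i \<inter> G \<subseteq> B i" "\<And>i. emeasure \<theta> (B i) \<le> ennreal M * hausdorff_gauge s (U i)"
      by metis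
    have "G \<subseteq> (\<Union>i. B i)" using G(3) U(1) B(2) by blast
    then have "emeasure \<theta> G \<le> emeasure \<theta> (\<Union>i. B i)"
      using B(1) sb by (intro emeasure_mono) auto
    also have "\<dots> \<le> (\<Sum>i. emeasure \<theta> (B i))"
      using B(1) sb by (intro emeasure_subadditive_countably) auto
    also have "\<dots> \<le> (\<Sum>i. ennreal M * hausdorff_gauge s (U i))"
      by (intro suminf_le B(3)) auto
    also have "\<dots> = ennreal M * (\<Sum>i. hausdorff_gauge s (U i))" by simp
    also have "\<dots> \<le> ennreal M * e" using U(4) by (intro mult_left_mono) auto
    finally show False using e(2) by simp
  qed
qed

text \<open>Ball growth is known only on average. Giving up u' - u in the exponent makes the sum
  over dyadic scales integrable, hence bounded on a set of positive mass, and there the mass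
  distribution principle applies.\<close>

theorem hausdorff_dim_ge_energy:
  fixes \<theta> :: "'a::euclidean_space measure"
  assumes sb[measurable_cong]: "sets \<theta> = sets borel" and p: "prob_space \<theta>" and K: "compact K" "emeasure \<theta> K = 1" "K \<subseteq> A"
    and C: "0 < C" "\<And>r. 0 < r \<Longrightarrow> r \<le> 1 \<Longrightarrow> (\<integral>\<^sup>+x. emeasure \<theta> (cball x r) \<partial>\<theta>) \<le> ennreal (C * r powr u')"
    and u: "0 < u" "u < u'"
  shows "ereal u \<le> hausdorff_dim A"
proof -
  interpret prob_space \<theta> by fact
  have KB[measurable]: "K \<in> sets borel" using K(1) by (simp add: borel_compact)
  have [measurable]: "(\<lambda>x. emeasure \<theta> (cball x r)) \<in> borel_measurable borel" for r
  proof -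
    have "(\<lambda>x. \<integral>\<^sup>+y. indicator {p. dist (fst p) (snd p) \<le> r} (x, y) \<partial>\<theta>) \<in> borel_measurable borel" by measurable
    also have "(\<lambda>x. \<integral>\<^sup>+y. indicator {p. dist (fst p) (snd p) \<le> r} (x, y) \<partial>\<theta>) = (\<lambda>x. emeasure \<theta> (cball x r))"
      by (rule ext) (simp add: sb nn_integral_indicator[symmetric] indicator_def cball_def)
    finally show ?thesis .
  qed
  define \<Phi> where "\<Phi> x = (\<Sum>n::nat. ennreal ((2 ^ n) powr u) * emeasure \<theta> (cball x (1 / 2 ^ n)))" for x
  have [measurable]: "\<Phi> \<in> borel_measurable borel" unfolding \<Phi>_def by measurable
  define q where "q = 2 powr (u - u')"
  have q: "0 < q" "q < 1" unfolding q_def using u powr_less_mono[of "u - u'" 0 2] by auto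
  have "(\<integral>\<^sup>+x. \<Phi> x \<partial>\<theta>) = (\<Sum>n. \<integral>\<^sup>+x. ennreal ((2 ^ n) powr u) * emeasure \<theta> (cball x (1 / 2 ^ n)) \<partial>\<theta>)"
    unfolding \<Phi>_def by (rule nn_integral_suminf) measurable
  also have "\<dots> \<le> (\<Sum>n. ennreal (C * q ^ n))"
  proof (rule suminf_le)
    fix n :: nat
    have "(\<integral>\<^sup>+x. ennreal ((2 ^ n) powr u) * emeasure \<theta> (cball x (1 / 2 ^ n)) \<partial>\<theta>) = ennreal ((2 ^ n) powr u) * (\<integral>\<^sup>+x. emeasure \<theta> (cball x (1 / 2 ^ n)) \<partial>\<theta>)"
      by (rule nn_integral_cmult) measurable
    also have "\<dots> \<le> ennreal ((2 ^ n) powr u) * ennreal (C * (1 / 2 ^ n) powr u')"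
      by (intro mult_left_mono C(2)) auto
    also have "\<dots> = ennreal ((2 ^ n) powr u * (C * (1 / 2 ^ n) powr u'))"
      by (rule ennreal_mult'[symmetric]) simp
    also have "(2 ^ n) powr u * (C * (1 / 2 ^ n) powr u') = C * (2 ^ n) powr (u - u')"
      by (simp add: powr_diff powr_divide)
    also have "(2 ^ n) powr (u - u') = q ^ n"
      by (simp add: q_def powr_realpow[symmetric] powr_powr mult.commute)
    finally show "(\<integral>\<^sup>+x. ennreal ((2 ^ n) powr u) * emeasure \<theta> (cball x (1 / 2 ^ n)) \<partial>\<theta>) \<le> ennreal (C * q ^ n)" .
  qed auto
  also have "\<dots> = ennreal (\<Sum>n. C * q ^ n)"
    using C(1) q by (intro suminf_ennreal2 summable_mult summable_geometric) auto
  also have "\<dots> < \<infinity>" by simp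
  finally have "AE x in \<theta>. \<Phi> x \<noteq> \<infinity>" by (intro nn_integral_PInf_AE) auto
  moreover have "AE x in \<theta>. x \<in> K" using K(2) KB sb by (simp add: AE_in_set_eq_1 emeasure_eq_measure)
  ultimately have "AE x in \<theta>. x \<in> (\<Union>m::nat. {x \<in> K. \<Phi> x \<le> of_nat m})"
  proof eventually_elim
    case (elim x)
    then obtain m :: nat where "\<Phi> x < of_nat m"
      using ennreal_Ex_less_of_nat[of "\<Phi> x"] by (auto simp: less_top)
    then show ?case using elim by (auto intro: less_imp_le)
  qed
  moreover have G: "{x \<in> K. \<Phi> x \<le> of_nat m} \<in> sets borel" for m by measurable
  ultimately have "\<not> (\<forall>m::nat. emeasure \<theta> {x \<in> K. \<Phi> x \<le> of_nat m} = 0)"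
  proof -
    assume ae: "AE x in \<theta>. x \<in> (\<Union>m::nat. {x \<in> K. \<Phi> x \<le> of_nat m})"
    show ?thesis
    proof
      assume "\<forall>m::nat. emeasure \<theta> {x \<in> K. \<Phi> x \<le> of_nat m} = 0"
      then have "AE x in \<theta>. \<forall>m::nat. x \<notin> {x \<in> K. \<Phi> x \<le> of_nat m}"
        using G sb unfolding AE_all_countable by (intro allI AE_not_in null_setsI) auto
      with ae have "AE x in \<theta>. False" by eventually_elim blast
      then show False by simp
    qed
  qed
  then obtain m :: nat where "emeasure \<theta> {x \<in> K. \<Phi> x \<le> of_nat m} \<noteq> 0" by blast
  then have m: "emeasure \<theta> {x \<in> K. \<Phi> x \<le> of_nat m} > 0" by (simp add: zero_less_iff_neq_zero)
  \<comment> \<open>Every term of \<Phi> is at most m; 2 powr u pays for enlarging r to a dyadic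
    radius.\<close>
  define M where "M = (real m + 1) * 2 powr u"
  have bound: "emeasure \<theta> (cball x r) \<le> ennreal (M * r powr u)" if x: "\<Phi> x \<le> of_nat m" and r: "0 < r" "r \<le> 1" for x r
  proof -
    obtain n where n: "1 / 2 ^ Suc n < r" "r \<le> 1 / 2 ^ n" using dyadic_scale[OF r] .
    have "ennreal ((2 ^ n) powr u) * emeasure \<theta> (cball x (1 / 2 ^ n)) = (\<Sum>k\<in>{n}. ennreal ((2 ^ k) powr u) * emeasure \<theta> (cball x (1 / 2 ^ k)))" by simp
    also have "\<dots> \<le> \<Phi> x" unfolding \<Phi>_def by (rule sum_le_suminf) auto
    also have "\<dots> \<le> ennreal (real m)" using x by (simp add: ennreal_of_nat_eq_real_of_nat)
    finally have "ennreal ((1 / 2 ^ n) powr u) * (ennreal ((2 ^ n) powr u) * emeasure \<theta> (cball x (1 / 2 ^ n))) \<le> ennreal ((1 / 2 ^ n) powr u) * ennreal (real m)"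
      by (rule mult_left_mono) simp
    moreover have "ennreal ((1 / 2 ^ n) powr u) * ennreal ((2 ^ n) powr u) = 1"
      by (subst ennreal_mult'[symmetric]) (auto simp: powr_mult[symmetric])
    ultimately have "emeasure \<theta> (cball x (1 / 2 ^ n)) \<le> ennreal ((1 / 2 ^ n) powr u) * ennreal (real m)"
      by (simp add: mult.assoc[symmetric])
    also have "\<dots> = ennreal ((1 / 2 ^ n) powr u * real m)" by (rule ennreal_mult'[symmetric]) simp
    also have "\<dots> \<le> ennreal (M * r powr u)"
    proof (rule ennreal_leI)
      have "(1 / 2 ^ n) powr u \<le> (2 * r) powr u" using n u by (intro powr_mono2) (auto simp: field_simps)
      also have "\<dots> = 2 powr u * r powr u" using r by (simp add: powr_mult)
      finally have "(1 / 2 ^ n) powr u * real m \<le> (2 powr u * r powr u) * (real m + 1)" by (intro mult_mono) auto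
      then show "(1 / 2 ^ n) powr u * real m \<le> M * r powr u" by (simp add: M_def mult_ac)
    qed
    finally have "emeasure \<theta> (cball x (1 / 2 ^ n)) \<le> ennreal (M * r powr u)" .
    moreover have "emeasure \<theta> (cball x r) \<le> emeasure \<theta> (cball x (1 / 2 ^ n))" using n sb by (intro emeasure_mono) auto
    ultimately show ?thesis by (rule order_trans[rotated])
  qed
  \<comment> \<open>The case of radius 0 in \<open>hausdorff_dim_ge\<close>: the dyadic bounds tend
    to 0, so single points of this set carry no mass.\<close>
  have bound0: "emeasure \<theta> (cball x 0) \<le> ennreal (M * 0 powr u)" if x: "\<Phi> x \<le> of_nat m" for x
  proof -
    have "emeasure \<theta> (cball x 0) \<le> ennreal (M * (1 / 2 ^ n) powr u)" for n :: nat
    proof -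
      have "emeasure \<theta> (cball x 0) \<le> emeasure \<theta> (cball x (1 / 2 ^ n))" using sb by (intro emeasure_mono) auto
      also have "\<dots> \<le> ennreal (M * (1 / 2 ^ n) powr u)" by (rule bound[OF x]) auto
      finally show ?thesis .
    qed
    moreover have "(\<lambda>n. ennreal (M * (1 / 2 ^ n) powr u)) \<longlonglongrightarrow> ennreal (M * 0)"
    proof (intro tendsto_ennrealI tendsto_mult tendsto_const)
      have "(\<lambda>n. (1 / 2 powr u) ^ n) \<longlonglongrightarrow> 0" using u by (intro LIMSEQ_power_zero) (simp add: divide_less_eq)
      moreover have "(1 / 2 ^ n) powr u = (1 / 2 powr u) ^ n" for n :: nat
        by (simp add: powr_divide power_divide powr_realpow[symmetric] powr_powr mult.commute)
      ultimately show "(\<lambda>n. (1 / 2 ^ n) powr u) \<longlonglongrightarrow> (0::real)" by simp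
    qed
    ultimately have "emeasure \<theta> (cball x 0) \<le> ennreal (M * 0)" by (intro LIMSEQ_le_const) auto
    then show ?thesis by simp
  qed
  show ?thesis
  proof (rule hausdorff_dim_ge[OF sb G m, where M = M])
    show "{x \<in> K. \<Phi> x \<le> of_nat m} \<subseteq> A" using K(3) by auto
    show "0 < M" by (simp add: M_def)
    fix x r assume "x \<in> {x \<in> K. \<Phi> x \<le> of_nat m}" "0 \<le> (r::real)" "r \<le> 1"
    then show "emeasure \<theta> (cball x r) \<le> ennreal (M * r powr u)"
      using bound[of x r] bound0[of x] by (cases "r = 0") auto
  qed (use u in auto)
qed

section \<open>Assembly of the estimates\<close>

lemma frostman_borel_ball:
  fixes A :: "'a::euclidean_space set"
  assumes A: "A \<in> sets borel" "A \<noteq> {}" and s: "ereal s < hausdorff_dim A"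
  obtains K \<mu> B where "compact K" "K \<subseteq> A" "frostman s \<mu>" "emeasure \<mu> K = 1"
    "\<forall>B'\<ge>B. AE x in \<mu>. x \<in> cball 0 B'"
proof -
  obtain K \<mu> where K: "compact K" "K \<subseteq> A" "frostman s \<mu>" "emeasure \<mu> K = 1"
    using frostman_borel[OF A s] .
  obtain B where B: "\<forall>x\<in>K. norm x \<le> B" using compact_imp_bounded[OF K(1)] unfolding bounded_iff by blast
  have "prob_space \<mu>" "sets \<mu> = sets borel" using K(3) by (auto simp: frostman_def)
  then have "AE x in \<mu>. x \<in> K"
    using K(1,4) by (simp add: prob_space.AE_in_set_eq_1 borel_compact measure_def)
  then have "AE x in \<mu>. x \<in> cball 0 B'" if "B \<le> B'" for B'
    using B that by (auto elim!: eventually_mono)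
  then show ?thesis using that K by blast
qed

text \<open>The bilinear factor contributes (1 + |\<xi>|)^(d - \<alpha> - \<beta>), which leaves a
  Sobolev integral of \<zeta> with exponent s - \<alpha> - \<beta>. The hypothesis on s says that
  this is below \<gamma> - d, the threshold of \<open>frostman_sobolev\<close>.\<close>

theorem sobolev_similarity:
  fixes E Z :: "'a::euclidean_space set" and T :: "real set"
  assumes E: "E \<in> sets borel" "E \<noteq> {}" "ereal \<alpha> < hausdorff_dim E"
    and Z: "Z \<in> sets borel" "Z \<noteq> {}" "ereal \<gamma> < hausdorff_dim Z"
    and T: "T \<in> sets borel" "T \<noteq> {}" "ereal \<beta> < hausdorff_dim T"
    and s: "s < \<alpha> + \<beta> + \<gamma> - real DIM('a)"
  obtains K \<theta> where "compact K" "K \<subseteq> similarity_image (Z \<times> T) E" "sets \<theta> = sets borel" "prob_space \<theta>" "emeasure \<theta> K = 1"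
    "(\<integral>\<^sup>+\<xi>. ennreal ((cmod (fourier_transform \<theta> \<xi>))\<^sup>2 * (1 + norm \<xi>) powr (s - real DIM('a))) \<partial>lborel) < \<infinity>"
proof -
  obtain KE \<mu> BE where KE: "compact KE" "KE \<subseteq> E" "frostman \<alpha> \<mu>" "emeasure \<mu> KE = 1"
    "\<forall>B'\<ge>BE. AE x in \<mu>. x \<in> cball 0 B'" using frostman_borel_ball[OF E] .
  obtain KZ \<zeta> BZ where KZ: "compact KZ" "KZ \<subseteq> Z" "frostman \<gamma> \<zeta>" "emeasure \<zeta> KZ = 1"
    "\<forall>B'\<ge>BZ. AE x in \<zeta>. x \<in> cball 0 B'" using frostman_borel_ball[OF Z] .
  obtain KT \<nu> BT where KT: "compact KT" "KT \<subseteq> T" "frostman \<beta> \<nu>" "emeasure \<nu> KT = 1"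
    "\<forall>B'\<ge>BT. AE x in \<nu>. x \<in> cball 0 B'" using frostman_borel_ball[OF T] .
  define B where "B = max 0 (max BE BT)"
  have B: "BE \<le> B" "BT \<le> B" "0 \<le> B" by (auto simp: B_def)
  have sb: "sets \<nu> = sets borel" "sets \<mu> = sets borel" "sets \<zeta> = sets borel"
    and p: "prob_space \<nu>" "prob_space \<mu>" "prob_space \<zeta>"
    using KE KZ KT by (auto simp: frostman_def)
  let ?K = "similarity_image (KZ \<times> KT) KE" and ?\<theta> = "sim_measure \<nu> \<mu> \<zeta>"
  have K: "compact ?K" "emeasure ?\<theta> ?K = 1"
    using sim_measure_compact[OF sb p KT(1,4) KE(1,4) KZ(1,4)] by auto
  have sub: "?K \<subseteq> similarity_image (Z \<times> T) E"
    using KE(2) KZ(2) KT(2) unfolding similarity_image_def by blast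
  obtain C where C: "0 < C" "\<And>\<xi>. (cmod (\<integral>r. \<integral>x. iexp (- (2 * pi * r * (\<xi> \<bullet> x))) \<partial>\<mu> \<partial>\<nu>))\<^sup>2
      \<le> C * (1 + norm \<xi>) powr (real DIM('a) - \<alpha> - \<beta>)"
    using bilinear_decay_everywhere[OF KE(3) KE(5)[rule_format, OF B(1)] KT(3) KT(5)[rule_format, OF B(2)] B(3)] by blast
  have mf[measurable]: "fourier_transform \<zeta> \<in> borel_measurable borel"
    by (rule measurable_fourier_transform[OF sb(3) p(3)])
  let ?\<kappa> = "s - \<alpha> - \<beta>"
  have "(\<integral>\<^sup>+\<xi>. ennreal ((cmod (fourier_transform ?\<theta> \<xi>))\<^sup>2 * (1 + norm \<xi>) powr (s - real DIM('a))) \<partial>lborel)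
    \<le> (\<integral>\<^sup>+\<xi>. ennreal C * ennreal ((cmod (fourier_transform \<zeta> \<xi>))\<^sup>2 * (1 + norm \<xi>) powr ?\<kappa>) \<partial>lborel)"
  proof (rule nn_integral_mono)
    fix \<xi> :: 'a
    let ?F = "\<integral>r. \<integral>x. iexp (- (2 * pi * r * (\<xi> \<bullet> x))) \<partial>\<mu> \<partial>\<nu>"
    have "(cmod (fourier_transform ?\<theta> \<xi>))\<^sup>2 * (1 + norm \<xi>) powr (s - real DIM('a)) =
       (cmod ?F)\<^sup>2 * ((cmod (fourier_transform \<zeta> \<xi>))\<^sup>2 * (1 + norm \<xi>) powr (s - real DIM('a)))"
      by (simp only: fourier_transform_sim_measure[OF sb p] norm_mult power_mult_distrib mult.assoc)
    also have "\<dots> \<le> C * (1 + norm \<xi>) powr (real DIM('a) - \<alpha> - \<beta>) * ((cmod (fourier_transform \<zeta> \<xi>))\<^sup>2 * (1 + norm \<xi>) powr (s - real DIM('a)))"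
      by (intro mult_right_mono C(2)) auto
    also have "\<dots> = C * ((cmod (fourier_transform \<zeta> \<xi>))\<^sup>2 * ((1 + norm \<xi>) powr (real DIM('a) - \<alpha> - \<beta>) * (1 + norm \<xi>) powr (s - real DIM('a))))"
      by (simp only: mult_ac)
    also have "(1 + norm \<xi>) powr (real DIM('a) - \<alpha> - \<beta>) * (1 + norm \<xi>) powr (s - real DIM('a)) = (1 + norm \<xi>) powr ?\<kappa>"
      unfolding powr_add[symmetric] by (rule arg_cong[where f = "\<lambda>e. (1 + norm \<xi>) powr e"]) simp
    finally show "ennreal ((cmod (fourier_transform ?\<theta> \<xi>))\<^sup>2 * (1 + norm \<xi>) powr (s - real DIM('a)))
       \<le> ennreal C * ennreal ((cmod (fourier_transform \<zeta> \<xi>))\<^sup>2 * (1 + norm \<xi>) powr ?\<kappa>)"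
      using C(1) by (subst ennreal_mult'[symmetric]) (auto intro: ennreal_leI)
  qed
  also have "\<dots> = ennreal C * (\<integral>\<^sup>+\<xi>. ennreal ((cmod (fourier_transform \<zeta> \<xi>))\<^sup>2 * (1 + norm \<xi>) powr ?\<kappa>) \<partial>lborel)"
    by (rule nn_integral_cmult) measurable
  also have "\<dots> < \<infinity>"
    using frostman_sobolev[OF KZ(3), of ?\<kappa>] s by (simp add: ennreal_mult_less_top)
  finally show ?thesis
    using that[OF K(1) sub sets_sim_measure[OF sb p] prob_space_sim_measure[OF sb p] K(2)] by blast
qed

text \<open>Taking for \<zeta> the Dirac mass at 0, whose transform is 1, leaves the bilinear factor
  alone. The last hypothesis reflects the cap built into \<open>fourier_dim\<close>.\<close>

theorem fourier_dim_dilates_ge: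
  fixes E :: "'a::euclidean_space set" and T :: "real set"
  assumes E: "E \<in> sets borel" "E \<noteq> {}" "ereal \<alpha> < hausdorff_dim E"
    and T: "T \<in> sets borel" "T \<noteq> {}" "ereal \<beta> < hausdorff_dim T"
    and s: "\<alpha> + \<beta> - real DIM('a) \<le> real DIM('a)"
  shows "ereal (\<alpha> + \<beta> - real DIM('a)) \<le> fourier_dim (dilates T E)"
proof -
  obtain KE \<mu> BE where KE: "compact KE" "KE \<subseteq> E" "frostman \<alpha> \<mu>" "emeasure \<mu> KE = 1"
    "\<forall>B'\<ge>BE. AE x in \<mu>. x \<in> cball 0 B'" using frostman_borel_ball[OF E] .
  obtain KT \<nu> BT where KT: "compact KT" "KT \<subseteq> T" "frostman \<beta> \<nu>" "emeasure \<nu> KT = 1"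
    "\<forall>B'\<ge>BT. AE x in \<nu>. x \<in> cball 0 B'" using frostman_borel_ball[OF T] .
  define \<zeta> where "\<zeta> = return borel (0::'a)"
  define B where "B = max 0 (max BE BT)"
  have B: "BE \<le> B" "BT \<le> B" "0 \<le> B" by (auto simp: B_def)
  have sb: "sets \<nu> = sets borel" "sets \<mu> = sets borel" "sets \<zeta> = sets borel"
    and p: "prob_space \<nu>" "prob_space \<mu>" "prob_space \<zeta>"
    using KE KT by (auto simp: frostman_def \<zeta>_def intro!: prob_space_return)
  have \<zeta>: "compact {0::'a}" "emeasure \<zeta> {0} = 1" by (auto simp: \<zeta>_def)
  let ?K = "similarity_image ({0} \<times> KT) KE" and ?\<theta> = "sim_measure \<nu> \<mu> \<zeta>"
  have K: "compact ?K" "emeasure ?\<theta> ?K = 1"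
    using sim_measure_compact[OF sb p KT(1,4) KE(1,4) \<zeta>] by auto
  have sub: "?K \<subseteq> dilates T E"
    using KE(2) KT(2) unfolding similarity_image_def dilates_def by auto
  have \<theta>: "?\<theta> \<in> compact_radon_measures (dilates T E)"
    by (rule compact_radon_measuresI[OF sets_sim_measure[OF sb p] prob_space_sim_measure[OF sb p] K sub])
  let ?e = "\<alpha> + \<beta> - real DIM('a)"
  obtain C where C: "0 < C" "\<And>\<xi>. (cmod (\<integral>r. \<integral>x. iexp (- (2 * pi * r * (\<xi> \<bullet> x))) \<partial>\<mu> \<partial>\<nu>))\<^sup>2
      \<le> C * (1 + norm \<xi>) powr (real DIM('a) - \<alpha> - \<beta>)"
    using bilinear_decay_everywhere[OF KE(3) KE(5)[rule_format, OF B(1)] KT(3) KT(5)[rule_format, OF B(2)] B(3)] by blast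
  have "cmod (fourier_transform ?\<theta> \<xi>) \<le> sqrt C * (1 + norm \<xi>) powr (- ?e / 2)" for \<xi>
  proof -
    have "fourier_transform \<zeta> \<xi> = 1"
      unfolding fourier_transform_iexp \<zeta>_def by (subst integral_return) auto
    then have "(cmod (fourier_transform ?\<theta> \<xi>))\<^sup>2 \<le> C * (1 + norm \<xi>) powr (real DIM('a) - \<alpha> - \<beta>)"
      using C(2)[of \<xi>] by (simp add: fourier_transform_sim_measure[OF sb p])
    also have "\<dots> = (sqrt C * (1 + norm \<xi>) powr (- ?e / 2))\<^sup>2"
    proof -
      have "((1 + norm \<xi>) powr (- ?e / 2))\<^sup>2 = (1 + norm \<xi>) powr (- ?e / 2 + - ?e / 2)"
        unfolding powr_add power2_eq_square ..
      also have "- ?e / 2 + - ?e / 2 = real DIM('a) - \<alpha> - \<beta>" by simp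
      finally show ?thesis using C(1) by (simp only: power_mult_distrib real_sqrt_pow2 less_imp_le)
    qed
    finally show ?thesis by (rule power2_le_imp_le) (use C(1) in simp)
  qed
  moreover have "0 < sqrt C" using C(1) by simp
  ultimately have "\<exists>\<mu>\<in>compact_radon_measures (dilates T E). \<exists>C>0. \<forall>x. cmod (fourier_transform \<mu> x) \<le> C * (1 + norm x) powr (- ?e / 2)"
    using \<theta> by blast
  then show ?thesis
    unfolding fourier_dim_def using s by (intro Sup_upper) blast
qed

text \<open>Needed for (ii): \<open>emeasure lebesgue\<close> of a non-measurable set is \<open>0\<close>, so a compact subset of
  positive volume alone would not suffice.\<close>

lemma similarity_image_lebesgue:
  fixes E Z :: "'a::euclidean_space set" and T :: "real set"
  assumes "E \<in> sets borel" "Z \<in> sets borel" "T \<in> sets borel"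
  shows "similarity_image (Z \<times> T) E \<in> sets lebesgue"
proof -
  have "similarity_image (Z \<times> T) E = (\<lambda>p. fst p *\<^sub>R fst (snd p) + snd (snd p)) ` (T \<times> (E \<times> Z))"
    unfolding similarity_image_def by (auto simp: image_iff Bex_def; metis)
  moreover have "(\<lambda>p :: real \<times> 'a \<times> 'a. fst p *\<^sub>R fst (snd p) + snd (snd p)) ` (T \<times> (E \<times> Z)) \<in> sets lebesgue"
    by (intro analytic_image_lebesgue borel_imp_analytic borel_Times assms continuous_intros)
  ultimately show ?thesis by simp
qed

theorem theorem1p1:
  fixes E Z :: "'a::euclidean_space set" and T :: "real set"
    and \<Gamma> :: "('a \<times> real) set" and d :: real
  assumes d: "d = real DIM('a)"
    and E: "E \<in> sets borel" "E \<noteq> {}"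
    and Z: "Z \<in> sets borel" "Z \<noteq> {}"
    and T: "T \<in> sets borel" "T \<noteq> {}" "T \<subseteq> {0<..}"
    and \<Gamma>: "\<Gamma> = Z \<times> T"
  shows "fourier_dim (dilates T E) \<ge> hausdorff_dim E + hausdorff_dim T - ereal d \<and>
         sobolev_dim (similarity_image \<Gamma> E)
           \<ge> hausdorff_dim E + hausdorff_dim Z + hausdorff_dim T - ereal d \<and>
         (hausdorff_dim E + hausdorff_dim Z + hausdorff_dim T > ereal (2 * d) \<longrightarrow>
            emeasure lebesgue (similarity_image \<Gamma> E) > 0) \<and>
         (\<forall>u::real. 0 < u \<and> u < d \<and>
            hausdorff_dim E + hausdorff_dim Z + hausdorff_dim T > ereal (d + u) \<longrightarrow>
            hausdorff_dim (similarity_image \<Gamma> E) \<ge> ereal u)"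
proof -
  obtain e where e: "hausdorff_dim E = ereal e" "0 \<le> e" "e \<le> d" using hausdorff_dim_real[OF E] d by metis
  obtain z where z: "hausdorff_dim Z = ereal z" "0 \<le> z" "z \<le> d" using hausdorff_dim_real[OF Z] d by metis
  obtain t where t: "hausdorff_dim T = ereal t" "0 \<le> t" "t \<le> 1"
    using hausdorff_dim_real[OF T(1,2)] by auto
  have d1: "1 \<le> d" using d by (simp add: Suc_leI)
  define m where "m = e + z + t - d"
  have exists: "\<exists>K \<theta>. compact K \<and> K \<subseteq> similarity_image \<Gamma> E \<and> sets \<theta> = sets borel \<and> prob_space \<theta> \<and> emeasure \<theta> K = 1 \<and>
    (\<integral>\<^sup>+\<xi>. ennreal ((cmod (fourier_transform \<theta> \<xi>))\<^sup>2 * (1 + norm \<xi>) powr (s - d)) \<partial>lborel) < \<infinity>" if s: "s < m" for s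
  proof -
    \<comment> \<open>Each of the three exponents gives up \<epsilon>; a fourth \<epsilon> remains
      for the strict inequality.\<close>
    define \<epsilon> where "\<epsilon> = (m - s) / 4"
    have \<epsilon>: "0 < \<epsilon>" using s by (simp add: \<epsilon>_def)
    have lt: "ereal (e - \<epsilon>) < hausdorff_dim E" "ereal (z - \<epsilon>) < hausdorff_dim Z" "ereal (t - \<epsilon>) < hausdorff_dim T"
      using \<epsilon> by (auto simp: e z t)
    have "s < (e - \<epsilon>) + (t - \<epsilon>) + (z - \<epsilon>) - real DIM('a)"
      using s by (simp add: \<epsilon>_def m_def d field_simps)
    then obtain K \<theta> where "compact K" "K \<subseteq> similarity_image (Z \<times> T) E" "sets \<theta> = sets borel" "prob_space \<theta>" "emeasure \<theta> K = 1"
      "(\<integral>\<^sup>+\<xi>. ennreal ((cmod (fourier_transform \<theta> \<xi>))\<^sup>2 * (1 + norm \<xi>) powr (s - real DIM('a))) \<partial>lborel) < \<infinity>"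
      by (rule sobolev_similarity[OF E lt(1) Z lt(2) T(1,2) lt(3)])
    then show ?thesis unfolding \<Gamma> d by (intro exI[of _ K] exI[of _ \<theta>] conjI)
  qed
  have energy: "\<exists>K \<theta> C. compact K \<and> K \<subseteq> similarity_image \<Gamma> E \<and> sets \<theta> = sets borel \<and> prob_space \<theta> \<and> emeasure \<theta> K = 1 \<and>
    0 < C \<and> (\<forall>r. 0 < r \<and> r \<le> 1 \<longrightarrow> (\<integral>\<^sup>+x. emeasure \<theta> (cball x r) \<partial>\<theta>) \<le> ennreal (C * r powr s))" if s: "s < m" "s \<le> d" for s
  proof -
    obtain K \<theta> where K: "compact K" "K \<subseteq> similarity_image \<Gamma> E" "sets \<theta> = sets borel" "prob_space \<theta>" "emeasure \<theta> K = 1"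
      and f: "(\<integral>\<^sup>+\<xi>. ennreal ((cmod (fourier_transform \<theta> \<xi>))\<^sup>2 * (1 + norm \<xi>) powr (s - d)) \<partial>lborel) < \<infinity>"
      using exists[OF s(1)] by blast
    show ?thesis
      using sobolev_energy_ball[OF K(3,4), of s] s(2) f K unfolding d by blast
  qed
  have 1: "hausdorff_dim E + hausdorff_dim T - ereal d \<le> fourier_dim (dilates T E)"
  proof -
    have "ereal (e + t - d) \<le> fourier_dim (dilates T E) + ereal \<delta>" if \<delta>: "0 < \<delta>" for \<delta>
    proof -
      \<comment> \<open>The cap of \<open>fourier_dim\<close> holds because e \<le> d and t \<le> 1
        \<le> d.\<close>
      have "(e - \<delta> / 2) + (t - \<delta> / 2) - real DIM('a) \<le> real DIM('a)"
        using \<delta> e t d1 unfolding d[symmetric] by linarith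
      then have "ereal ((e - \<delta> / 2) + (t - \<delta> / 2) - real DIM('a)) \<le> fourier_dim (dilates T E)"
        using \<delta> by (intro fourier_dim_dilates_ge E T) (simp_all add: e t)
      then have "ereal ((e - \<delta> / 2) + (t - \<delta> / 2) - real DIM('a)) + ereal \<delta> \<le> fourier_dim (dilates T E) + ereal \<delta>"
        by (rule add_right_mono)
      then show ?thesis by (simp add: d algebra_simps)
    qed
    then have "ereal (e + t - d) \<le> fourier_dim (dilates T E)" by (rule ereal_le_epsilon2)
    then show ?thesis by (simp add: e t)
  qed
  have 2: "hausdorff_dim E + hausdorff_dim Z + hausdorff_dim T - ereal d \<le> sobolev_dim (similarity_image \<Gamma> E)"
  proof -
    have "ereal m \<le> sobolev_dim (similarity_image \<Gamma> E)"
    proof (rule dense_le)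
      fix y assume y: "y < ereal m"
      then obtain s where s: "y < ereal s" "ereal s < ereal m" using ereal_dense2 by blast
      obtain K \<theta> where K: "compact K" "K \<subseteq> similarity_image \<Gamma> E" "sets \<theta> = sets borel" "prob_space \<theta>" "emeasure \<theta> K = 1"
        and f: "(\<integral>\<^sup>+\<xi>. ennreal ((cmod (fourier_transform \<theta> \<xi>))\<^sup>2 * (1 + norm \<xi>) powr (s - d)) \<partial>lborel) < \<infinity>"
        using exists[of s] s(2) by auto
      have "ereal s \<le> sobolev_dim_measure \<theta>"
        unfolding sobolev_dim_measure_def using f d by (intro Sup_upper) auto
      also have "\<dots> \<le> sobolev_dim (similarity_image \<Gamma> E)"
        unfolding sobolev_dim_def
        using compact_radon_measuresI[OF K(3,4,1,5,2)] K(4) by (intro Sup_upper) blast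
      finally show "y \<le> sobolev_dim (similarity_image \<Gamma> E)" using s(1) by simp
    qed
    then show ?thesis by (simp add: e z t m_def)
  qed
  have 3: "0 < emeasure lebesgue (similarity_image \<Gamma> E)"
    if "hausdorff_dim E + hausdorff_dim Z + hausdorff_dim T > ereal (2 * d)"
  proof -
    \<comment> \<open>Since m exceeds d, the averaged ball bound is available with exponent exactly
      d, as \<open>positive_volume\<close> requires.\<close>
    have "d < m" using that by (simp add: e z t m_def)
    then obtain K \<theta> C where K: "compact K" "K \<subseteq> similarity_image \<Gamma> E" "sets \<theta> = sets borel" "prob_space \<theta>" "emeasure \<theta> K = 1"
      "0 < C" "\<And>r. 0 < r \<Longrightarrow> r \<le> 1 \<Longrightarrow> (\<integral>\<^sup>+x. emeasure \<theta> (cball x r) \<partial>\<theta>) \<le> ennreal (C * r powr real DIM('a))"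
      using energy[of d] d by auto
    have "0 < emeasure lborel K" by (rule positive_volume[OF K(3,4,1,5,6,7)])
    also have "\<dots> = emeasure lebesgue K" using K(1) by (simp add: borel_compact)
    also have "\<dots> \<le> emeasure lebesgue (similarity_image \<Gamma> E)"
      using K(2) similarity_image_lebesgue[OF E(1) Z(1) T(1)] unfolding \<Gamma> by (intro emeasure_mono)
    finally show ?thesis .
  qed
  have 4: "ereal u \<le> hausdorff_dim (similarity_image \<Gamma> E)"
    if u: "0 < u" "u < d" "hausdorff_dim E + hausdorff_dim Z + hausdorff_dim T > ereal (d + u)" for u
  proof -
    \<comment> \<open>Strictly between u and m, and capped at d because
      \<open>sobolev_energy_ball\<close> takes exponents up to d only.\<close>
    define u' where "u' = min d ((u + m) / 2)"
    have "u < m" using u(3) by (simp add: e z t m_def)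
    then have u': "u < u'" "u' < m" "u' \<le> d" using u(2) by (auto simp: u'_def min_less_iff_disj)
    obtain K \<theta> C where K: "compact K" "K \<subseteq> similarity_image \<Gamma> E" "sets \<theta> = sets borel" "prob_space \<theta>" "emeasure \<theta> K = 1"
      "0 < C" "\<And>r. 0 < r \<Longrightarrow> r \<le> 1 \<Longrightarrow> (\<integral>\<^sup>+x. emeasure \<theta> (cball x r) \<partial>\<theta>) \<le> ennreal (C * r powr u')"
      using energy[OF u'(2,3)] by auto
    show ?thesis by (rule hausdorff_dim_ge_energy[OF K(3,4,1,5,2,6,7) u(1) u'(1)])
  qed
  show ?thesis using 1 2 3 4 by blast
qed

end
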